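(* Let $f\in L^2(D)$ and let $A\subset S^1\times\mathbb{R}$ satisfy Assumption (A) (stated in the context). A. If $(\theta,p)\in \operatorname{int}(A)$, then $\mathrm{WF}_{L(\theta,p)}(f)=\mathrm{WF}_{L(\theta,p)}(\mathcal{L}_A f)$. Therefore, all singularities of $f$ normal to $L(\theta,p)$ are visible, and $\mathcal{L}_A f$ has no artifacts normal to $L(\theta,p)$. B. If $(\theta,p)\notin A\cap\operatorname{supp}(Rf)$, then $\mathrm{WF}_{L(\theta,p)}(\mathcal{L}_A f)=\emptyset$. Therefore, all singularities of $f$ normal to $L(\theta,p)$ are invisible from data on $A$, and $\mathcal{L}_A f$ has no artifacts normal to $L(\theta,p)$. C. If $x\in D$ and $(\theta,x\cdot\theta)\in\operatorname{int}(A)$ for all $\theta\in S^1$, then $\mathrm{WF}_x(f)=\mathrm{WF}_x(\mathcal{L}_A f)$. In this case all singularities of $f$ at $x$ are visible in $\mathcal{L}_A f$. Therefore, artifacts occur only normal to lines $L(\theta,p)$ with $(\theta,p)\in\operatorname{bd}(A)$; that is, if $(x,\xi)\in\mathrm{WF}(\mathcal{L}_A f)\setminus\mathrm{WF}(f)$ then $(x,\xi)\in N(L(\theta,p))$ for some $(\theta,p)\in\operatorname{bd}(A)$.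
   Context: $D=\{x\in\mathbb{R}^2:\|x\|\le 1\}$; $f\in L^2(D)$ is extended by $0$ to $\mathbb{R}^2$. For $(\theta,p)\in S^1\times\mathbb{R}$, $L(\theta,p)=\{x\in\mathbb{R}^2: x\cdot\theta=p\}$ (so $L(\theta,p)=L(-\theta,-p)$), and $\theta^\perp$ is $\theta$ rotated by $\pi/2$ counterclockwise. Radon transform: $Rf(\theta,p)=\int_{-\infty}^\infty f(p\theta+t\theta^\perp)\,dt$. Backprojection: $R^*g(x)=\int_{S^1}g(\theta,x\cdot\theta)\,d\theta$, extended to distributions by duality. $\Lambda$ is the standard filtered-backprojection filter: the Fourier multiplier in the variable $p$ with symbol $c|\tau|$ ($\tau$ dual to $p$), where $c>0$ is the normalizing constant ($c=1/(4\pi)$) for which $R^*\Lambda R f=f$; the value of $c$ is irrelevant here. For $A\subset S^1\times\mathbb{R}$ with characteristic function $\mathbf{1}_A$, $\mathcal{L}_A f=R^*\big(\Lambda(\mathbf{1}_A\,Rf)\big)$, a distribution on $\mathbb{R}^2$. Assumption (A): $A\subsetneq S^1\times\mathbb{R}$ is a proper subset with nonempty interior, $(\theta,p)\in A\Rightarrow(-\theta,-p)\in A$, and $A=\operatorname{cl}(\operatorname{int}(A))$. Here $\operatorname{int}$, $\operatorname{cl}$, $\operatorname{bd}$ denote interior, closure, boundary in $S^1\times\mathbb{R}$. Wavefront set: for a distribution $u$ on $\mathbb{R}^2$, $x_0\in\mathbb{R}^2$ and $\xi_0\in\mathbb{R}^2\setminus\{0\}$, $u$ is smooth at $x_0$ in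 direction $\xi_0$ if there are $\psi\in C_c^\infty(\mathbb{R}^2)$ with $\psi(x_0)\ne0$ and an open cone $V\ni\xi_0$ such that the Fourier transform $\mathcal{F}(\psi u)(\xi)$ is rapidly decaying for $\xi\in V$ (for each $k\in\mathbb{N}$ there is $C_k$ with $|\mathcal{F}(\psi u)(\xi)|\le C_k(1+\|\xi\|)^{-k}$ on $V$). Otherwise $u$ has a singularity at $(x_0,\xi_0)$. $\mathrm{WF}(u)$ is the set of all singularities $(x_0,\xi_0)$ of $u$. Put $N(L(\theta,p))=\{(x,\omega\theta):x\in L(\theta,p),\ \omega\in\mathbb{R}\}$, $\mathrm{WF}_{L(\theta,p)}(u)=\mathrm{WF}(u)\cap N(L(\theta,p))$ (the singularities of $u$ normal to $L(\theta,p)$), and $\mathrm{WF}_{x}(u)=\mathrm{WF}(u)\cap(\{x\}\times\mathbb{R}^2)$. An artifact is an element of $\mathrm{WF}(\mathcal{L}_A f)\setminus\mathrm{WF}(f)$. A singularity of $f$ is visible (from data on $A$) if it lies in $\mathrm{WF}(f)\cap\mathrm{WF}(\mathcal{L}_A f)$, and invisible if it lies in $\mathrm{WF}(f)\setminus\mathrm{WF}(\mathcal{L}_A f)$. $\operatorname{supp}(Rf)$ is the (closed) distributional support of $Rf$. *)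

theory Defs
  imports "HOL-Analysis.Analysis"
begin

section \<open>Test functions and distributions\<close>

primrec Ck :: "nat \<Rightarrow> ('a::euclidean_space \<Rightarrow> 'b::real_normed_vector) \<Rightarrow> bool" where
  "Ck 0 f \<longleftrightarrow> continuous_on UNIV f"
| "Ck (Suc k) f \<longleftrightarrow>
     (\<forall>x. f differentiable (at x)) \<and> (\<forall>b\<in>Basis. Ck k (\<lambda>x. frechet_derivative f (at x) b))"

definition smooth :: "('a::euclidean_space \<Rightarrow> 'b::real_normed_vector) \<Rightarrow> bool" where
  "smooth f \<longleftrightarrow> (\<forall>k. Ck k f)"

definition test_fun :: "('a::euclidean_space \<Rightarrow> complex) \<Rightarrow> bool" where
  "test_fun \<phi> \<longleftrightarrow> smooth \<phi> \<and> compact (closure (support_on UNIV \<phi>))"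

text \<open>A distribution is represented by its action \<open>\<phi> \<mapsto> \<langle>u, \<phi>\<rangle>\<close> (bilinear pairing, no complex
  conjugation). As HOL functions are total, the action is also given a value outside the test
  functions; on \<open>\<real>\<^sup>2\<close> only the values at test functions are ever used.\<close>

type_synonym 'a distribution = "('a \<Rightarrow> complex) \<Rightarrow> complex"

definition dist_of :: "('a::euclidean_space \<Rightarrow> complex) \<Rightarrow> 'a distribution" where
  "dist_of f \<phi> = (\<integral>x. f x * \<phi> x \<partial>lebesgue)"

definition dist_mult :: "('a \<Rightarrow> complex) \<Rightarrow> 'a distribution \<Rightarrow> 'a distribution" where
  "dist_mult \<psi> u = (\<lambda>\<phi>. u (\<lambda>x. \<psi> x * \<phi> x))"

text \<open>Fourier transform of a compactly supported distribution, as a function: the pairing with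
  \<open>x \<mapsto> exp (- \<i> (x \<bullet> \<xi>))\<close>.\<close>

definition dist_fourier :: "'a::euclidean_space distribution \<Rightarrow> 'a \<Rightarrow> complex" where
  "dist_fourier v \<xi> = v (\<lambda>x. cis (- (x \<bullet> \<xi>)))"

section \<open>Wavefront set\<close>

text \<open>The library's \<open>cone\<close> also demands closure under multiplication by 0, so that its only
  nonempty open instance is the whole space; here only positive multiples are required.\<close>

definition open_cone :: "'a::real_normed_vector set \<Rightarrow> bool" where
  "open_cone V \<longleftrightarrow> open V \<and> (\<forall>v\<in>V. \<forall>t>0. t *\<^sub>R v \<in> V)"

definition rapidly_decaying_on :: "'a::real_normed_vector set \<Rightarrow> ('a \<Rightarrow> complex) \<Rightarrow> bool" where
  "rapidly_decaying_on V F \<longleftrightarrow> (\<forall>k::nat. \<exists>C::real. \<forall>\<xi>\<in>V. norm (F \<xi>) \<le> C / (1 + norm \<xi>) ^ k)"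

definition smooth_in_direction ::
    "(real^2) distribution \<Rightarrow> real^2 \<Rightarrow> real^2 \<Rightarrow> bool" where
  "smooth_in_direction u x0 \<xi>0 \<longleftrightarrow>
     (\<exists>\<psi> V. test_fun \<psi> \<and> \<psi> x0 \<noteq> 0 \<and> open_cone V \<and> \<xi>0 \<in> V \<and>
        rapidly_decaying_on V (dist_fourier (dist_mult \<psi> u)))"

definition WF :: "(real^2) distribution \<Rightarrow> ((real^2) \<times> (real^2)) set" where
  "WF u = {(x, \<xi>). \<xi> \<noteq> 0 \<and> \<not> smooth_in_direction u x \<xi>}"

definition line :: "real^2 \<Rightarrow> real \<Rightarrow> (real^2) set" where
  "line \<theta> p = {x. x \<bullet> \<theta> = p}"

definition normals :: "real^2 \<Rightarrow> real \<Rightarrow> ((real^2) \<times> (real^2)) set" where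
  "normals \<theta> p = {(x, \<omega> *\<^sub>R \<theta>) | x \<omega>. x \<in> line \<theta> p}"

definition WF_line :: "real^2 \<Rightarrow> real \<Rightarrow> (real^2) distribution \<Rightarrow> ((real^2) \<times> (real^2)) set" where
  "WF_line \<theta> p u = WF u \<inter> normals \<theta> p"

definition WF_at :: "real^2 \<Rightarrow> (real^2) distribution \<Rightarrow> ((real^2) \<times> (real^2)) set" where
  "WF_at x u = WF u \<inter> ({x} \<times> UNIV)"

section \<open>The cylinder \<open>S\<^sup>1 \<times> \<real>\<close>\<close>

text \<open>Functions on \<open>S\<^sup>1 \<times> \<real>\<close> are represented by functions on \<open>\<real>\<^sup>2 \<times> \<real>\<close> whose values off the
  cylinder are irrelevant.\<close>

definition cyl :: "((real^2) \<times> real) set" where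
  "cyl = sphere 0 1 \<times> UNIV"

abbreviation cyl_top :: "((real^2) \<times> real) topology" where
  "cyl_top \<equiv> top_of_set cyl"

definition circ :: "real \<Rightarrow> real^2" where
  "circ s = vector [cos s, sin s]"

text \<open>Smoothness on the cylinder is tested in the coordinates \<open>(s, p) \<mapsto> (circ s, p)\<close>, a local
  diffeomorphism of \<open>\<real>\<^sup>2\<close> onto the cylinder.\<close>

definition cyl_test_fun :: "((real^2) \<times> real \<Rightarrow> complex) \<Rightarrow> bool" where
  "cyl_test_fun h \<longleftrightarrow>
     smooth (\<lambda>(s::real, p::real). h (circ s, p)) \<and> compact (closure (support_on cyl h))"

definition cyl_dist_of :: "((real^2) \<times> real \<Rightarrow> complex) \<Rightarrow> ((real^2) \<times> real) distribution" where
  "cyl_dist_of g h =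
     (LINT s:{0..2*pi}|lebesgue. (\<integral>p. g (circ s, p) * h (circ s, p) \<partial>lebesgue))"

definition cyl_dist_support :: "((real^2) \<times> real) distribution \<Rightarrow> ((real^2) \<times> real) set" where
  "cyl_dist_support G =
     {z \<in> cyl. \<forall>U. openin cyl_top U \<and> z \<in> U \<longrightarrow>
        (\<exists>h. cyl_test_fun h \<and> closure (support_on cyl h) \<subseteq> U \<and> G h \<noteq> 0)}"

section \<open>Radon transform, filter, backprojection\<close>

definition perp :: "real^2 \<Rightarrow> real^2" where
  "perp \<theta> = vector [- (\<theta> $ 2), \<theta> $ 1]"

definition radon :: "(real^2 \<Rightarrow> complex) \<Rightarrow> (real^2) \<times> real \<Rightarrow> complex" where
  "radon f = (\<lambda>(\<theta>, p). \<integral>t. f (p *\<^sub>R \<theta> + t *\<^sub>R perp \<theta>) \<partial>lebesgue)"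

text \<open>Partial Fourier transform in \<open>p\<close>, with the convention \<open>\<integral> h(\<theta>, p) exp (- \<i> \<tau> p) dp\<close> and
  inverse carrying the factor \<open>1 / (2 * pi)\<close>. For this convention the multiplier \<open>c \<bar>\<tau>\<bar>\<close> inverts
  the Radon transform precisely when \<open>c = 1 / (4 * pi)\<close>.\<close>

definition fourier_p :: "((real^2) \<times> real \<Rightarrow> complex) \<Rightarrow> (real^2) \<times> real \<Rightarrow> complex" where
  "fourier_p h = (\<lambda>(\<theta>, \<tau>). \<integral>p. h (\<theta>, p) * cis (- (\<tau> * p)) \<partial>lebesgue)"

definition inv_fourier_p :: "((real^2) \<times> real \<Rightarrow> complex) \<Rightarrow> (real^2) \<times> real \<Rightarrow> complex" where
  "inv_fourier_p H = (\<lambda>(\<theta>, p). (\<integral>\<tau>. H (\<theta>, \<tau>) * cis (\<tau> * p) \<partial>lebesgue) / (2 * pi))"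

definition fbp_filter :: "((real^2) \<times> real \<Rightarrow> complex) \<Rightarrow> (real^2) \<times> real \<Rightarrow> complex" where
  "fbp_filter h =
     inv_fourier_p (\<lambda>(\<theta>, \<tau>). of_real (\<bar>\<tau>\<bar> / (4 * pi)) * fourier_p h (\<theta>, \<tau>))"

text \<open>Since the symbol \<open>c \<bar>\<tau>\<bar>\<close> is even, the filter is its own transpose for the bilinear pairing,
  and \<open>\<langle>\<Lambda>G, h\<rangle> = \<langle>G, \<Lambda>h\<rangle>\<close>. For a test function \<open>h\<close>, \<open>\<Lambda>h\<close> is smooth and bounded but not
  compactly supported; this is harmless because the filter is only applied to data \<open>G\<close> that are
  compactly supported.\<close>

definition dist_fbp_filter ::
    "((real^2) \<times> real) distribution \<Rightarrow> ((real^2) \<times> real) distribution" where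
  "dist_fbp_filter G = (\<lambda>h. G (fbp_filter h))"

text \<open>Backprojection of distributions by duality, \<open>\<langle>R\<^sup>*G, \<phi>\<rangle> = \<langle>G, R\<phi>\<rangle>\<close>. If \<open>G\<close> is given by a
  function \<open>g\<close>, Fubini's theorem identifies the result with the function
  \<open>x \<mapsto> \<integral> g (\<theta>, x \<bullet> \<theta>) d\<theta>\<close>, integrated over the unit circle with respect to arc length.\<close>

definition backprojection :: "((real^2) \<times> real) distribution \<Rightarrow> (real^2) distribution" where
  "backprojection G = (\<lambda>\<phi>. G (radon \<phi>))"

definition recon :: "((real^2) \<times> real) set \<Rightarrow> (real^2 \<Rightarrow> complex) \<Rightarrow> (real^2) distribution" where
  "recon A f =
     backprojection (dist_fbp_filter (cyl_dist_of (\<lambda>z. indicator A z * radon f z)))"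

section \<open>Hypotheses, artifacts and visibility\<close>

definition L2_disc :: "(real^2 \<Rightarrow> complex) \<Rightarrow> bool" where
  "L2_disc f \<longleftrightarrow> f \<in> borel_measurable lebesgue \<and>
     integrable lebesgue (\<lambda>x. (norm (f x))\<^sup>2) \<and> (\<forall>x. x \<notin> cball 0 1 \<longrightarrow> f x = 0)"

definition assumption_A :: "((real^2) \<times> real) set \<Rightarrow> bool" where
  "assumption_A A \<longleftrightarrow> A \<subset> cyl \<and> cyl_top interior_of A \<noteq> {} \<and>
     (\<forall>\<theta> p. (\<theta>, p) \<in> A \<longrightarrow> (- \<theta>, - p) \<in> A) \<and>
     A = cyl_top closure_of (cyl_top interior_of A)"

definition artifacts ::
    "((real^2) \<times> real) set \<Rightarrow> (real^2 \<Rightarrow> complex) \<Rightarrow> ((real^2) \<times> (real^2)) set" where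
  "artifacts A f = WF (recon A f) - WF (dist_of f)"

definition visible ::
    "((real^2) \<times> real) set \<Rightarrow> (real^2 \<Rightarrow> complex) \<Rightarrow> ((real^2) \<times> (real^2)) set" where
  "visible A f = WF (dist_of f) \<inter> WF (recon A f)"

definition invisible ::
    "((real^2) \<times> real) set \<Rightarrow> (real^2 \<Rightarrow> complex) \<Rightarrow> ((real^2) \<times> (real^2)) set" where
  "invisible A f = WF (dist_of f) - WF (recon A f)"

end

theory Submission
  imports Defs "HOL-Probability.Probability"
begin

text \<open>
  For a test function \<open>\<phi>\<close> the Fourier slice theorem turns the action of \<open>\<L>\<^sub>A f\<close> into
  \<open>\<integral>\<integral> 1\<^sub>A Rf(\<theta>, p) k(\<theta>, p) dp d\<theta>\<close> with \<open>8 \<pi>\<^sup>2 k(\<theta>, p) = \<integral> \<bar>\<tau>\<bar> (\<F> \<phi>)(\<tau> \<theta>) e\<^sup>i\<^sup>\<tau>\<^sup>p d\<tau>\<close>; for \<open>A\<close> the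
  whole cylinder polar coordinates and Fourier inversion give back \<open>f\<close>. All claims therefore reduce
  to one: if the data \<open>g\<close> vanish near \<open>\<plusminus>(\<theta>\<^sub>0, x\<^sub>0 \<bullet> \<theta>\<^sub>0)\<close>, their filtered backprojection is smooth at
  \<open>x\<^sub>0\<close> in the directions \<open>\<plusminus>\<theta>\<^sub>0\<close>. It is applied to \<open>g = Rf - 1\<^sub>A Rf\<close> in the interior of \<open>A\<close> and to
  \<open>g = 1\<^sub>A Rf\<close> off \<open>A \<inter> supp (Rf)\<close>.

  For \<open>\<phi>(x) = \<psi>(x) e\<^sup>-\<^sup>i\<^sup>x\<^sup>\<xi>\<close> with \<open>\<psi>\<close> supported near \<open>x\<^sub>0\<close> and \<open>\<xi>\<close> nearly parallel to \<open>\<theta>\<^sub>0\<close>, the integrand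
  involves \<open>(\<F> \<psi>)(\<tau> \<theta> + \<xi>)\<close>. If \<open>\<theta>\<close> is not close to \<open>\<plusminus>\<theta>\<^sub>0\<close>, then \<open>\<bar>\<tau> \<theta> + \<xi>\<bar> \<ge> c (\<bar>\<tau>\<bar> + \<bar>\<xi>\<bar>)\<close> and \<open>k\<close> decays
  rapidly in \<open>\<xi>\<close>. If \<open>\<theta>\<close> is close to \<open>\<plusminus>\<theta>\<^sub>0\<close> but \<open>p\<close> is not close to \<open>\<plusminus>x\<^sub>0 \<bullet> \<theta>\<^sub>0\<close>, the line misses the
  support of \<open>\<psi>\<close>, so replacing \<open>\<bar>\<tau>\<bar>\<close> by \<open>\<bar>\<tau>\<bar> \<plusminus> \<tau>\<close> does not change \<open>k\<close>: this removes the half-line of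
  \<open>\<tau>\<close> containing the peak, and on the other one the same lower bound holds.
\<close>


section \<open>Smooth functions\<close>

text \<open>On test functions both \<open>dist_of f\<close> and \<open>recon A f\<close> have the
  form \<open>fbp g\<close> with \<open>g\<close> integrable on the cylinder, and the microlocal
  estimates use only this integrability and the zero set of the data. The obstacle that shapes the
  rest is the cutoff in the wavefront set: the hypothesis supplies some \<open>\<psi>\<close> with
  \<open>\<psi> x0 \<noteq> 0\<close> and uncontrolled support, whereas the decay estimate asks for
  a cutoff living close to \<open>x0\<close>. The two meet in a product
  \<open>\<rho> x * \<psi> x\<close>, so rapid decay has to survive multiplication by
  \<open>\<rho>\<close>. Modulated by \<xi>, the product is a superposition over \<eta> of
  \<open>\<psi>\<close> modulated by \<open>\<xi> - \<eta>\<close>, weighted by the Fourier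
  transform of \<open>\<rho>\<close>; the price is a smaller cone and an a priori bound of
  polynomial growth for frequencies outside the given cone. A second gap separates functions from
  distributions: \<open>f\<close> is only Lebesgue measurable, and vanishing off the support of its
  Radon transform is only tested against smooth functions. It is closed by a Borel representative
  and by a Dynkin class argument on boxes.\<close>

lemma Ck_imp_continuous_on: "Ck k f \<Longrightarrow> continuous_on UNIV f"
  by (cases k)
    (auto intro!: continuous_at_imp_continuous_on dest: differentiable_imp_continuous_within)

lemma Ck_SucD: "Ck (Suc k) f \<Longrightarrow> Ck k f"
proof (induction k arbitrary: f)
  case 0
  then show ?case using Ck_imp_continuous_on by (metis Ck.simps(1))
next
  case (Suc k)
  then show ?case by (metis Ck.simps(2))
qed

lemma frechet_derivative_eqI:
  "(f has_derivative f') (at x) \<Longrightarrow> frechet_derivative f (at x) = f'"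
  using frechet_derivative_at by metis

lemma Ck_SucI:
  assumes "\<And>x. (f has_derivative f' x) (at x)" and "\<And>b. b \<in> Basis \<Longrightarrow> Ck k (\<lambda>x. f' x b)"
  shows "Ck (Suc k) f"
  using assms frechet_derivative_eqI[OF assms(1)] by (auto simp: differentiable_def)

lemma Ck_Suc_has_derivative:
  "Ck (Suc k) f \<Longrightarrow> (f has_derivative frechet_derivative f (at x)) (at x)"
  by (simp add: frechet_derivative_works[symmetric])

lemma Ck_const: "Ck k (\<lambda>x. c)"
proof (induction k arbitrary: c)
  case (Suc k)
  show ?case by (rule Ck_SucI[where f' = "\<lambda>x h. 0"]) (auto intro: Suc)
qed simp

lemma Ck_add: "Ck k f \<Longrightarrow> Ck k g \<Longrightarrow> Ck k (\<lambda>x. f x + g x)"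
proof (induction k arbitrary: f g)
  case 0
  then show ?case by (auto intro: continuous_intros)
next
  case (Suc k)
  show ?case
    by (rule Ck_SucI[OF has_derivative_add[OF Ck_Suc_has_derivative[OF Suc.prems(1)]
            Ck_Suc_has_derivative[OF Suc.prems(2)]]])
      (use Suc in auto)
qed

text \<open>The product rule gives two terms of the same bilinear shape. In each of them one factor
  stays undifferentiated, which is why \<open>Ck_SucD\<close> enters the induction.\<close>

lemma Ck_bilinear:
  assumes "bounded_bilinear B"
  shows "Ck k f \<Longrightarrow> Ck k g \<Longrightarrow> Ck k (\<lambda>x. B (f x) (g x))"
proof (induction k arbitrary: f g)
  case 0
  then show ?case using bounded_bilinear.continuous_on[OF assms] by auto
next
  case (Suc k)
  show ?case
    by (rule Ck_SucI[OF bounded_bilinear.FDERIV[OF assms Ck_Suc_has_derivative[OF Suc.prems(1)]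
            Ck_Suc_has_derivative[OF Suc.prems(2)]]])
      (use Suc Ck_SucD[OF Suc.prems(1)] Ck_SucD[OF Suc.prems(2)] in \<open>auto intro!: Ck_add\<close>)
qed

lemmas Ck_mult = Ck_bilinear[OF bounded_bilinear_mult]

lemma Ck_prod:
  fixes f :: "'i \<Rightarrow> 'a::euclidean_space \<Rightarrow> 'b::real_normed_field"
  shows "(\<And>i. i \<in> I \<Longrightarrow> Ck k (f i)) \<Longrightarrow> Ck k (\<lambda>x. \<Prod>i\<in>I. f i x)"
  by (induction I rule: infinite_finite_induct) (auto intro: Ck_const Ck_mult)

lemma Ck_bounded_linear: "bounded_linear f \<Longrightarrow> Ck k f"
  by (cases k)
    (auto simp: linear_continuous_on simp del: Ck.simps(2)
      intro!: Ck_SucI[OF bounded_linear_imp_has_derivative] Ck_const)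

lemma Ck_linear_compose:
  assumes "bounded_linear T"
  shows "Ck k f \<Longrightarrow> Ck k (\<lambda>x. T (f x))"
proof (induction k arbitrary: f)
  case 0
  then show ?case using bounded_linear.continuous_on[OF assms] by auto
next
  case (Suc k)
  show ?case
    by (rule Ck_SucI[OF bounded_linear.has_derivative[OF assms Ck_Suc_has_derivative[OF Suc.prems]]])
      (use Suc in auto)
qed

text \<open>\<open>F n\<close> plays the role of the n-th derivative of \<open>F 0\<close>. With n
  arbitrary the induction closes, because the chain rule produces the derivative of \<open>G\<close>
  times \<open>F (Suc n)\<close> composed with \<open>G\<close>. For \<open>cis\<close> the sequence
  is \<open>\<i> ^ n * cis t\<close>.\<close>

lemma Ck_real_compose:
  fixes F :: "nat \<Rightarrow> real \<Rightarrow> 'b::real_normed_vector" and G :: "'a::euclidean_space \<Rightarrow> real"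
  assumes F: "\<And>n t. (F n has_vector_derivative F (Suc n) t) (at t)"
  shows "Ck k G \<Longrightarrow> Ck k (\<lambda>x. F n (G x))"
proof (induction k arbitrary: n)
  case 0
  have "continuous_on UNIV (F n)" for n
    by (meson F continuous_at_imp_continuous_on has_vector_derivative_continuous)
  with 0 show ?case by (auto intro: continuous_on_compose2)
next
  case (Suc k)
  have "((\<lambda>x. F n (G x)) has_derivative (\<lambda>h. frechet_derivative G (at x) h *\<^sub>R F (Suc n) (G x))) (at x)" for x
    using diff_chain_at[OF Ck_Suc_has_derivative[OF Suc.prems, of x] F[unfolded has_vector_derivative_def, of n "G x"]]
    by (simp add: o_def)
  then show ?case
    by (rule Ck_SucI) (use Suc Ck_SucD[OF Suc.prems] in \<open>auto intro!: Ck_bilinear[OF bounded_bilinear_scaleR]\<close>)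
qed

lemma Ck_cis_compose:
  assumes "Ck k G"
  shows "Ck k (\<lambda>x. cis (G x))"
proof -
  have "((\<lambda>t. \<i> ^ n * cis t) has_vector_derivative \<i> ^ Suc n * cis t) (at t)" for n t
    by (auto intro!: derivative_eq_intros simp: has_vector_derivative_def)
  from Ck_real_compose[of "\<lambda>n t. \<i> ^ n * cis t", OF this, of k G 0] assms show ?thesis
    by simp
qed

lemma Ck_cos_compose: "Ck k (G :: 'a::euclidean_space \<Rightarrow> real) \<Longrightarrow> Ck k (\<lambda>x. cos (G x))"
  using Ck_linear_compose[OF bounded_linear_Re Ck_cis_compose, of k G] by simp

lemma Ck_sin_compose: "Ck k (G :: 'a::euclidean_space \<Rightarrow> real) \<Longrightarrow> Ck k (\<lambda>x. sin (G x))"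
  using Ck_linear_compose[OF bounded_linear_Im Ck_cis_compose, of k G] by simp

subsection \<open>Bump functions\<close>

text \<open>The bump functions are built from \<open>flat_exp 0\<close>. Allowing division by powers
  of t makes the family closed under differentiation up to linear combinations, so smoothness
  follows without formulas for higher derivatives.\<close>

definition flat_exp :: "nat \<Rightarrow> real \<Rightarrow> real" where
  "flat_exp n t = (if t > 0 then exp (- (1 / t)) / t ^ n else 0)"

text \<open>The exponential series at \<open>1 / t\<close> dominates its single term of index n + 2.
  The two powers beyond n leave a factor \<open>t\<^sup>2\<close>, one more than the difference
  quotient at 0 consumes.\<close>

lemma flat_exp_bound: "t > 0 \<Longrightarrow> flat_exp n t \<le> fact (n + 2) * t\<^sup>2"
proof -
  assume t: "t > 0"
  have "(1 / t) ^ (n + 2) / fact (n + 2) \<le> exp (1 / t)"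
  proof -
    have "(\<Sum>i\<in>{n+2}. (1/t) ^ i /\<^sub>R fact i) \<le> exp (1 / t)"
      unfolding exp_def using t
      by (intro sum_le_suminf) (auto intro!: summable_exp)
    then show ?thesis by (simp add: divide_inverse mult.commute)
  qed
  then have "1 / (t ^ n * t\<^sup>2) \<le> fact (n + 2) * exp (1 / t)"
    using t by (simp add: power_divide power_add pos_divide_le_eq pos_le_divide_eq mult_ac power2_eq_square del: fact_Suc)
  then show ?thesis
    using t by (simp add: flat_exp_def exp_minus field_simps power_add power2_eq_square del: fact_Suc)
qed

lemma flat_exp_has_derivative:
  "(flat_exp n has_real_derivative flat_exp (n + 2) t - n * flat_exp (n + 1) t) (at t)"
proof -
  consider "t > 0" | "t < 0" | "t = 0" by linarith
  then show ?thesis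
  proof cases
    case 1
    have "((\<lambda>t. exp (- (1 / t)) / t ^ n) has_real_derivative
        (exp (- (1 / t)) * (1 / t\<^sup>2) * t ^ n - exp (- (1 / t)) * (real n * t ^ (n - 1))) / (t ^ n * t ^ n)) (at t)"
      using 1 by (auto intro!: derivative_eq_intros simp: power2_eq_square)
    also have "(exp (- (1 / t)) * (1 / t\<^sup>2) * t ^ n - exp (- (1 / t)) * (real n * t ^ (n - 1))) / (t ^ n * t ^ n)
        = flat_exp (n + 2) t - n * flat_exp (n + 1) t"
      using 1 by (cases n) (simp_all add: flat_exp_def field_simps power2_eq_square)
    finally have "((\<lambda>t. exp (- (1 / t)) / t ^ n) has_real_derivative
        flat_exp (n + 2) t - n * flat_exp (n + 1) t) (at t)" .
    then show ?thesis
      by (rule has_field_derivative_transform_within_open[where S="{0<..}"]) (use 1 in \<open>auto simp: flat_exp_def\<close>)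
  next
    case 2
    have "((\<lambda>t. 0) has_real_derivative flat_exp (n + 2) t - n * flat_exp (n + 1) t) (at t)"
      using 2 by (auto simp: flat_exp_def)
    then show ?thesis
      by (rule has_field_derivative_transform_within_open[where S="{..<0}"]) (use 2 in \<open>auto simp: flat_exp_def\<close>)
  next
    case 3
    \<comment> \<open>At the origin the quadratic bound makes the difference quotient of order
      \<open>\<bar>h\<bar>\<close>; the claimed derivative is 0 there by the default branch of
      \<open>flat_exp\<close>.\<close>
    have b: "norm (flat_exp n h / h) \<le> fact (n + 2) * \<bar>h\<bar>" for h :: real
    proof (cases "h > 0")
      case True
      then show ?thesis using flat_exp_bound[OF True, of n]
        by (simp add: flat_exp_def abs_mult field_simps power2_eq_square)
    next
      case False
      then have "norm (flat_exp n h / h) = 0" by (simp add: flat_exp_def)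
      then show ?thesis by (metis abs_ge_zero fact_ge_zero mult_nonneg_nonneg)
    qed
    have "((\<lambda>h. flat_exp n h / h) \<longlongrightarrow> 0) (at 0)"
      by (rule Lim_null_comparison[OF always_eventually[OF allI[OF b]]])
        (auto intro!: tendsto_eq_intros)
    then show ?thesis unfolding 3 DERIV_def by (simp add: flat_exp_def)
  qed
qed

text \<open>The derivative combines two members of the family instead of being the next one, so the
  induction is carried out anew rather than taken from \<open>Ck_real_compose\<close>.\<close>

lemma Ck_flat_exp_compose: "Ck k G \<Longrightarrow> Ck k (\<lambda>x. flat_exp n (G x))"
proof (induction k arbitrary: n)
  case 0
  have "continuous_on UNIV (flat_exp n)" for n
    by (meson DERIV_continuous continuous_at_imp_continuous_on flat_exp_has_derivative)
  with 0 show ?case by (auto intro: continuous_on_compose2)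
next
  case (Suc k)
  let ?d = "\<lambda>x. flat_exp (n + 2) (G x) + (- real n) * flat_exp (n + 1) (G x)"
  have "((\<lambda>x. flat_exp n (G x)) has_derivative (\<lambda>h. frechet_derivative G (at x) h * ?d x)) (at x)" for x
    using diff_chain_at[OF Ck_Suc_has_derivative[OF Suc.prems, of x]
        flat_exp_has_derivative[of n "G x", unfolded has_field_derivative_def]]
    by (simp add: o_def mult.commute)
  note * = this
  have "Ck k ?d"
    using Suc Ck_SucD[OF Suc.prems] by (intro Ck_add Ck_mult Ck_const) auto
  with Suc.prems show ?case
    by (intro Ck_SucI[OF *] Ck_mult) auto
qed

text \<open>The parameter n is a steepness. For every n > 0 the zero set is exactly the complement
  of the open box, and for n tending to infinity the function tends to the indicator of the box. One
  n serves as a cutoff; the whole sequence turns distributional vanishing into vanishing almost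
  everywhere.\<close>

definition box_bump :: "real \<Rightarrow> 'a::euclidean_space \<Rightarrow> 'a \<Rightarrow> 'a \<Rightarrow> complex" where
  "box_bump n a b x =
     (\<Prod>i\<in>Basis. of_real (flat_exp 0 (n * (x \<bullet> i - a \<bullet> i)) * flat_exp 0 (n * (b \<bullet> i - x \<bullet> i))))"

text \<open>The map T is there because test functions on the cylinder are checked in the coordinates
  \<open>(circ s, p)\<close>, whose components are smooth but not all linear.\<close>

lemma Ck_box_bump_compose:
  assumes "\<And>i. i \<in> Basis \<Longrightarrow> Ck k (\<lambda>x. T x \<bullet> i)"
  shows "Ck k (\<lambda>x. box_bump n a b (T x))"
proof -
  have 1: "Ck k (\<lambda>x. n * (T x \<bullet> i - a \<bullet> i))" if "i \<in> Basis" for i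
    using Ck_mult[OF Ck_const[of k n] Ck_add[OF assms[OF that] Ck_const[of k "- (a \<bullet> i)"]]] by simp
  have 2: "Ck k (\<lambda>x. n * (b \<bullet> i - T x \<bullet> i))" if "i \<in> Basis" for i
    using Ck_add[OF Ck_const[of k "n * (b \<bullet> i)"] Ck_mult[OF Ck_const[of k "-n"] assms[OF that]]]
    by (simp add: algebra_simps)
  show ?thesis unfolding box_bump_def
    by (intro Ck_prod Ck_linear_compose[OF bounded_linear_of_real] Ck_mult Ck_flat_exp_compose 1 2)
qed

lemma box_bump_eq_0:
  assumes "n > 0" "x \<notin> box a b"
  shows "box_bump n a b x = 0"
proof -
  obtain i where i: "i \<in> Basis" "x \<bullet> i - a \<bullet> i \<le> 0 \<or> b \<bullet> i - x \<bullet> i \<le> 0"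
    using assms(2) by (auto simp: mem_box not_less)
  then have "flat_exp 0 (n * (x \<bullet> i - a \<bullet> i)) * flat_exp 0 (n * (b \<bullet> i - x \<bullet> i)) = 0"
    using assms(1) by (auto simp: flat_exp_def zero_less_mult_iff)
  with i(1) show ?thesis by (auto simp: box_bump_def)
qed

lemma box_bump_neq_0: "n > 0 \<Longrightarrow> x \<in> box a b \<Longrightarrow> box_bump n a b x \<noteq> 0"
  by (auto simp: box_bump_def mem_box flat_exp_def)

lemma abs_flat_exp_0_le: "\<bar>flat_exp 0 t\<bar> \<le> 1"
  by (simp add: flat_exp_def)

lemma norm_box_bump_le: "norm (box_bump n a b x) \<le> 1"
  unfolding box_bump_def prod_norm[symmetric]
  by (rule prod_le_1) (auto simp: norm_mult intro!: mult_le_one abs_flat_exp_0_le)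

lemma box_bump_tendsto:
  "(\<lambda>n. box_bump (real (Suc n)) a b x) \<longlonglongrightarrow> indicator (box a b) x"
proof (cases "x \<in> box a b")
  case False
  then show ?thesis by (simp add: box_bump_eq_0)
next
  case True
  have *: "(\<lambda>n. flat_exp 0 (real (Suc n) * t)) \<longlonglongrightarrow> 1" if "t > 0" for t
  proof -
    have "(\<lambda>n. exp (- (1 / t) * inverse (real (Suc n)))) \<longlonglongrightarrow> exp (- (1 / t) * 0)"
      by (intro tendsto_intros LIMSEQ_inverse_real_of_nat)
    then show ?thesis using that by (simp add: flat_exp_def divide_inverse mult.commute)
  qed
  have "(\<lambda>n. box_bump (real (Suc n)) a b x) \<longlonglongrightarrow> (\<Prod>i\<in>(Basis::'a set). of_real (1 * 1))"
    unfolding box_bump_def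
    by (intro tendsto_intros *) (use True in \<open>auto simp: mem_box\<close>)
  then show ?thesis using True by simp
qed

subsection \<open>Test functions\<close>

lemma smooth_mult:
  fixes f g :: "'a::euclidean_space \<Rightarrow> 'b::real_normed_algebra"
  shows "smooth f \<Longrightarrow> smooth g \<Longrightarrow> smooth (\<lambda>x. f x * g x)"
  by (simp add: smooth_def Ck_mult)

lemma support_on_closure_compact:
  fixes K :: "'a::heine_borel set"
  assumes "compact K" "\<And>x. x \<in> S \<Longrightarrow> x \<notin> K \<Longrightarrow> f x = 0"
  shows "compact (closure (support_on S f))" "closure (support_on S f) \<subseteq> K"
proof -
  have "support_on S f \<subseteq> K" using assms by (auto simp: support_on_def)
  then show "compact (closure (support_on S f))" "closure (support_on S f) \<subseteq> K"
    using bounded_subset[OF compact_imp_bounded[OF assms(1)], of "support_on S f"]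
      closure_minimal[OF _ compact_imp_closed[OF assms(1)], of "support_on S f"]
    by (simp_all add: compact_closure)
qed

lemma test_funI:
  assumes "smooth f" "compact K" "\<And>x. x \<notin> K \<Longrightarrow> f x = 0"
  shows "test_fun f"
  using assms support_on_closure_compact(1)[of K UNIV f] by (auto simp: test_fun_def)

lemma test_fun_vanish: "x \<notin> closure (support_on UNIV f) \<Longrightarrow> f x = 0"
  using closure_subset[of "support_on UNIV f"] by (auto simp: support_on_def)

lemma test_fun_mult: "test_fun f \<Longrightarrow> smooth g \<Longrightarrow> test_fun (\<lambda>x. f x * g x)"
  by (rule test_funI[where K="closure (support_on UNIV f)"])
    (auto simp: test_fun_def smooth_mult dest: test_fun_vanish)

lemma smooth_cis: "smooth (\<lambda>x. cis (- (x \<bullet> \<xi>)))"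
  unfolding smooth_def
  using Ck_cis_compose[OF Ck_bounded_linear[OF bounded_linear_minus[OF bounded_linear_inner_left]]] by auto

lemma test_fun_box_bump: "n > 0 \<Longrightarrow> test_fun (box_bump n a b)"
  using Ck_box_bump_compose[where T="\<lambda>x. x", OF Ck_bounded_linear[OF bounded_linear_inner_left]]
  by (intro test_funI[where K="cbox a b"])
    (auto simp: smooth_def intro!: box_bump_eq_0 dest: subsetD[OF box_subset_cbox])

lemma test_fun_continuous: "test_fun f \<Longrightarrow> continuous_on UNIV f"
  by (auto simp: test_fun_def smooth_def intro: Ck_imp_continuous_on)

lemma test_fun_has_derivative:
  "test_fun f \<Longrightarrow> (f has_derivative frechet_derivative f (at x)) (at x)"
  by (metis Ck_Suc_has_derivative smooth_def test_fun_def)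

lemma frechet_derivative_vanish:
  fixes f :: "'a::euclidean_space \<Rightarrow> complex"
  assumes "x \<notin> closure (support_on UNIV f)"
  shows "frechet_derivative f (at x) = (\<lambda>h. 0)"
proof -
  have "(f has_derivative (\<lambda>h. 0)) (at x)"
    by (rule has_derivative_transform_within_open[where f="\<lambda>x. 0" and s="- closure (support_on UNIV f)"])
      (use assms in \<open>auto dest: test_fun_vanish\<close>)
  then show ?thesis by (rule frechet_derivative_eqI)
qed

lemma test_fun_frechet_derivative:
  assumes "test_fun f" "b \<in> Basis"
  shows "test_fun (\<lambda>x. frechet_derivative f (at x) b)"
proof (rule test_funI[where K="closure (support_on UNIV f)"])
  show "smooth (\<lambda>x. frechet_derivative f (at x) b)"
    unfolding smooth_def
  proof
    fix k
    have "Ck (Suc k) f" using assms(1) by (simp only: test_fun_def smooth_def)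
    then show "Ck k (\<lambda>x. frechet_derivative f (at x) b)" using assms(2) by simp
  qed
qed (use assms in \<open>auto simp: frechet_derivative_vanish test_fun_def\<close>)

lemma test_fun_bounded: "test_fun f \<Longrightarrow> \<exists>C. \<forall>x. norm (f x) \<le> C"
proof -
  assume f: "test_fun f"
  let ?K = "closure (support_on UNIV f)"
  have "compact (f ` ?K)"
    using f by (auto simp: test_fun_def intro!: compact_continuous_image continuous_on_subset[OF test_fun_continuous[OF f]])
  then obtain C where C: "\<And>y. y \<in> f ` ?K \<Longrightarrow> norm y \<le> C"
    using compact_imp_bounded bounded_iff by metis
  have "norm (f x) \<le> max C 0" for x
    using C[of "f x"] test_fun_vanish[of x f] by (cases "x \<in> ?K") (auto simp: le_max_iff_disj)
  then show ?thesis by blast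
qed

lemma continuous_compact_support_integrable:
  fixes f :: "'a::euclidean_space \<Rightarrow> complex"
  assumes "continuous_on UNIV f" "compact K" "\<And>x. x \<notin> K \<Longrightarrow> f x = 0"
  shows "integrable lborel f"
proof -
  have "set_integrable lborel K f"
    unfolding set_integrable_def by (rule borel_integrable_compact) (use assms in \<open>auto intro: continuous_on_subset\<close>)
  then show ?thesis
    unfolding set_integrable_def
    by (rule Bochner_Integration.integrable_cong[THEN iffD1, rotated 2])
      (use assms in \<open>auto simp: indicator_def\<close>)
qed

lemma test_fun_integrable: "test_fun f \<Longrightarrow> integrable lborel f"
  by (rule continuous_compact_support_integrable[where K="closure (support_on UNIV f)"])
   (auto simp: test_fun_continuous test_fun_vanish, simp add: test_fun_def)

lemma test_fun_borel: "test_fun f \<Longrightarrow> f \<in> borel_measurable borel"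
  by (rule borel_measurable_continuous_onI) (rule test_fun_continuous)


section \<open>The Fourier transform\<close>

definition ft :: "('a::euclidean_space \<Rightarrow> complex) \<Rightarrow> 'a \<Rightarrow> complex" where
  "ft f \<eta> = (\<integral>x. f x * cis (- (x \<bullet> \<eta>)) \<partial>lborel)"

lemma continuous_cis[continuous_intros]: "continuous_on S g \<Longrightarrow> continuous_on S (\<lambda>x. cis (g x))"
  by (auto simp: cis_conv_exp intro!: continuous_intros)

lemma borel_measurable_cis[measurable]: "cis \<in> borel_measurable borel"
  by (rule borel_measurable_continuous_onI) (intro continuous_intros)

lemma integrable_mult_cis:
  assumes "integrable M f" "g \<in> borel_measurable M"
  shows "integrable M (\<lambda>x. f x * cis (g x))"
  by (rule Bochner_Integration.integrable_bound[OF assms(1)])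
    (use assms in \<open>auto simp: norm_mult\<close>)

lemma ft_borel[measurable]:
  assumes [measurable]: "f \<in> borel_measurable borel"
  shows "ft f \<in> borel_measurable borel"
  unfolding ft_def by measurable

lemma norm_ft_le:
  assumes "integrable lborel f"
  shows "norm (ft f \<eta>) \<le> (\<integral>x. norm (f x) \<partial>lborel)"
  unfolding ft_def
  by (rule order_trans[OF integral_norm_bound]) (simp add: norm_mult)

lemma ft_mult_cis: "ft (\<lambda>x. f x * cis (- (x \<bullet> \<xi>))) \<eta> = ft f (\<eta> + \<xi>)"
  unfolding ft_def by (simp add: cis_mult inner_add_right mult.assoc add.commute)

lemma integral_lborel_shift:
  fixes f :: "'a::euclidean_space \<Rightarrow> 'b::{banach, second_countable_topology}"
  assumes [measurable]: "f \<in> borel_measurable borel"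
  shows "(\<integral>x. f (x + a) \<partial>lborel) = (\<integral>x. f x \<partial>lborel)"
proof -
  have "(\<integral>x. f x \<partial>distr lborel borel ((+) a)) = (\<integral>x. f (a + x) \<partial>lborel)"
    by (rule integral_distr) auto
  then show ?thesis by (simp add: lborel_distr_plus add.commute)
qed

lemma integrable_lborel_shift:
  fixes f :: "'a::euclidean_space \<Rightarrow> 'b::{banach, second_countable_topology}"
  assumes "integrable lborel f"
  shows "integrable lborel (\<lambda>x. f (x + a))"
proof -
  have "integrable (distr lborel borel ((+) a)) f"
    using assms by (simp add: lborel_distr_plus)
  then have "integrable lborel (\<lambda>x. f (a + x))"
    by (subst (asm) integrable_distr_eq) (use assms in auto)
  then show ?thesis by (simp add: add.commute)
qed

lemma ft_shift:
  assumes "f \<in> borel_measurable borel"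
  shows "ft (\<lambda>x. f (x + a)) \<eta> = cis (a \<bullet> \<eta>) * ft f \<eta>"
proof -
  have "ft (\<lambda>x. f (x + a)) \<eta> = (\<integral>x. cis (a \<bullet> \<eta>) * (f (x + a) * cis (- ((x + a) \<bullet> \<eta>))) \<partial>lborel)"
    unfolding ft_def by (rule Bochner_Integration.integral_cong) (auto simp: cis_mult inner_add_left algebra_simps)
  also have "\<dots> = cis (a \<bullet> \<eta>) * (\<integral>x. f x * cis (- (x \<bullet> \<eta>)) \<partial>lborel)"
    using integral_lborel_shift[of "\<lambda>x. f x * cis (- (x \<bullet> \<eta>))" a] assms by simp
  finally show ?thesis by (simp add: ft_def)
qed

text \<open>The derivative is taken along the sequence 1 / (n + 1), the form in which dominated
  convergence can use it.\<close>

lemma difference_quotient_LIMSEQ: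
  fixes g :: "real \<Rightarrow> complex"
  assumes "(g has_vector_derivative d) (at 0)"
  shows "(\<lambda>n. (g (inverse (real (Suc n))) - g 0) * of_nat (Suc n)) \<longlonglongrightarrow> d"
proof -
  have "((\<lambda>h. (g h - g 0 - h *\<^sub>R d) /\<^sub>R norm h) \<longlongrightarrow> 0) (at 0)"
    using assms by (simp add: has_vector_derivative_def has_derivative_def)
  moreover have "filterlim (\<lambda>n. inverse (real (Suc n))) (at 0) sequentially"
    by (auto simp: filterlim_at simp del: of_nat_Suc intro!: LIMSEQ_inverse_real_of_nat)
  ultimately have "(\<lambda>n. (g (inverse (real (Suc n))) - g 0 - inverse (real (Suc n)) *\<^sub>R d) /\<^sub>R norm (inverse (real (Suc n)))) \<longlonglongrightarrow> 0"
    by (rule filterlim_compose)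
  then have "(\<lambda>n. (g (inverse (real (Suc n))) - g 0) * of_nat (Suc n) - d) \<longlonglongrightarrow> 0"
    by (rule Lim_transform_eventually)
      (auto simp: scaleR_conv_of_real field_simps simp del: of_nat_Suc intro!: always_eventually)
  then show ?thesis by (simp add: LIM_zero_iff)
qed

text \<open>The difference quotient along \<open>b\<close> has Fourier transform \<open>n (cis (\<eta> \<bullet> b / n) - 1) ft \<phi> \<eta>\<close> by
  translation invariance; letting \<open>n\<close> tend to infinity avoids integration by parts.\<close>

lemma ft_frechet_derivative:
  fixes \<phi> :: "'a::euclidean_space \<Rightarrow> complex"
  assumes \<phi>: "test_fun \<phi>" and b: "b \<in> Basis"
  shows "ft (\<lambda>x. frechet_derivative \<phi> (at x) b) \<eta> = \<i> * (\<eta> \<bullet> b) * ft \<phi> \<eta>"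
proof -
  let ?d = "\<lambda>x. frechet_derivative \<phi> (at x) b"
  let ?h = "\<lambda>n. inverse (real (Suc n))"
  let ?q = "\<lambda>n x. (\<phi> (x + ?h n *\<^sub>R b) - \<phi> x) * of_nat (Suc n)"
  note meas[measurable] = test_fun_borel[OF \<phi>] test_fun_borel[OF test_fun_frechet_derivative[OF \<phi> b]]
  have vd: "((\<lambda>t. \<phi> (x + t *\<^sub>R b)) has_vector_derivative ?d (x + t *\<^sub>R b)) (at t)" for x t
  proof -
    have "((\<lambda>t. \<phi> (x + t *\<^sub>R b)) has_derivative (\<lambda>s. frechet_derivative \<phi> (at (x + t *\<^sub>R b)) (s *\<^sub>R b))) (at t)"
      by (rule has_derivative_compose[OF _ test_fun_has_derivative[OF \<phi>]])
        (auto intro!: derivative_eq_intros)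
    moreover have "linear (frechet_derivative \<phi> (at (x + t *\<^sub>R b)))"
      using test_fun_has_derivative[OF \<phi>] has_derivative_linear by blast
    ultimately show ?thesis by (simp add: has_vector_derivative_def linear_scale)
  qed
  obtain C where C: "\<And>x. norm (?d x) \<le> C"
    using test_fun_bounded[OF test_fun_frechet_derivative[OF \<phi> b]] by blast
  obtain r where r: "closure (support_on UNIV \<phi>) \<subseteq> cball 0 r"
    using \<phi> unfolding test_fun_def by (metis (full_types) bounded_iff compact_imp_bounded mem_cball_0 subsetI)
  \<comment> \<open>The increment \<open>?h n *\<^sub>R b\<close> has norm at most 1, so all
    quotients vanish outside one ball of radius r + 1. With the mean value bound \<open>qC\<close>
    this gives an integrable majorant independent of n.\<close>
  have q0: "?q n x = 0" if "x \<notin> cball 0 (r + 1)" for n x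
  proof -
    have "norm (?h n *\<^sub>R b) \<le> 1" using b by (simp add: inverse_le_1_iff)
    then have "x + ?h n *\<^sub>R b \<notin> cball 0 r" "x \<notin> cball 0 r"
      using that norm_triangle_ineq4[of "x + ?h n *\<^sub>R b" "?h n *\<^sub>R b"] by (auto simp: not_le)
    with r have "\<phi> (x + ?h n *\<^sub>R b) = 0" "\<phi> x = 0"
      using test_fun_vanish[where f=\<phi>] by blast+
    then show ?thesis by simp
  qed
  have qC: "norm (?q n x) \<le> C" for n x
  proof -
    have "norm (\<phi> (x + ?h n *\<^sub>R b) - \<phi> (x + 0 *\<^sub>R b)) \<le> C * norm (?h n - 0)"
      by (rule differentiable_bound[where S="UNIV" and f'="\<lambda>t s. s *\<^sub>R ?d (x + t *\<^sub>R b)"])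
        (use vd C order_trans[OF norm_ge_zero C] in \<open>auto simp: has_vector_derivative_def mult.commute[of C] intro!: onorm_bound mult_left_mono\<close>)
    then show ?thesis by (simp add: norm_mult divide_inverse[symmetric] pos_le_divide_eq del: of_nat_Suc)
  qed
  have "(\<lambda>n. \<integral>x. ?q n x * cis (- (x \<bullet> \<eta>)) \<partial>lborel) \<longlonglongrightarrow> (\<integral>x. ?d x * cis (- (x \<bullet> \<eta>)) \<partial>lborel)"
  proof (rule integral_dominated_convergence[where w="\<lambda>x. indicator (cball 0 (r+1)) x * C"])
    show "integrable lborel (\<lambda>x. indicator (cball (0::'a) (r+1)) x * C)"
      using borel_integrable_compact[of "cball (0::'a) (r+1)" "\<lambda>x. C"] by simp
    show "AE x in lborel. (\<lambda>n. ?q n x * cis (- (x \<bullet> \<eta>))) \<longlonglongrightarrow> ?d x * cis (- (x \<bullet> \<eta>))"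
    proof (intro AE_I2 tendsto_mult tendsto_const)
      fix x
      show "(\<lambda>n. ?q n x) \<longlonglongrightarrow> ?d x"
        using difference_quotient_LIMSEQ[OF vd[of x 0]] by simp
    qed
    show "AE x in lborel. norm (?q n x * cis (- (x \<bullet> \<eta>))) \<le> indicator (cball 0 (r+1)) x * C" for n
    proof (rule AE_I2)
      fix x
      show "norm (?q n x * cis (- (x \<bullet> \<eta>))) \<le> indicator (cball 0 (r+1)) x * C"
      proof (cases "x \<in> cball 0 (r+1)")
        case True
        then show ?thesis using qC[where x=x and n=n] by (simp add: norm_mult del: of_nat_Suc)
      next
        case False
        show ?thesis using q0[OF False, where n=n] False by (simp add: norm_mult del: of_nat_Suc)
      qed
    qed
  qed measurable
  moreover have "(\<integral>x. ?q n x * cis (- (x \<bullet> \<eta>)) \<partial>lborel) = (cis ((\<eta> \<bullet> b) * ?h n) - 1) * of_nat (Suc n) * ft \<phi> \<eta>" for n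
  proof -
    have i1: "integrable lborel (\<lambda>x. \<phi> x * cis (- (x \<bullet> \<eta>)))"
      by (intro integrable_mult_cis test_fun_integrable \<phi>) measurable
    have i2: "integrable lborel (\<lambda>x. \<phi> (x + ?h n *\<^sub>R b) * cis (- (x \<bullet> \<eta>)))"
      by (intro integrable_mult_cis integrable_lborel_shift test_fun_integrable \<phi>) measurable
    have "(\<integral>x. ?q n x * cis (- (x \<bullet> \<eta>)) \<partial>lborel) =
      (\<integral>x. of_nat (Suc n) * (\<phi> (x + ?h n *\<^sub>R b) * cis (- (x \<bullet> \<eta>)) - \<phi> x * cis (- (x \<bullet> \<eta>))) \<partial>lborel)"
      by (rule Bochner_Integration.integral_cong) (auto simp: algebra_simps)
    also have "\<dots> = of_nat (Suc n) * (ft (\<lambda>x. \<phi> (x + ?h n *\<^sub>R b)) \<eta> - ft \<phi> \<eta>)"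
      using i1 i2 by (simp add: ft_def del: of_nat_Suc)
    also have "\<dots> = (cis ((\<eta> \<bullet> b) * ?h n) - 1) * of_nat (Suc n) * ft \<phi> \<eta>"
      by (subst ft_shift) (auto simp: algebra_simps inner_commute)
    finally show ?thesis .
  qed
  ultimately have "(\<lambda>n. (cis ((\<eta> \<bullet> b) * ?h n) - 1) * of_nat (Suc n) * ft \<phi> \<eta>) \<longlonglongrightarrow> ft ?d \<eta>"
    by (simp add: ft_def)
  moreover have "(\<lambda>n. (cis ((\<eta> \<bullet> b) * ?h n) - 1) * of_nat (Suc n) * ft \<phi> \<eta>) \<longlonglongrightarrow> \<i> * (\<eta> \<bullet> b) * ft \<phi> \<eta>"
  proof (rule tendsto_mult[OF _ tendsto_const])
    have "((\<lambda>t. cis ((\<eta> \<bullet> b) * t)) has_vector_derivative \<i> * (\<eta> \<bullet> b)) (at 0)"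
      by (auto intro!: derivative_eq_intros simp: has_vector_derivative_def scaleR_conv_of_real mult_ac)
    from difference_quotient_LIMSEQ[OF this]
    show "(\<lambda>n. (cis ((\<eta> \<bullet> b) * ?h n) - 1) * of_nat (Suc n)) \<longlonglongrightarrow> \<i> * (\<eta> \<bullet> b)"
      by simp
  qed
  ultimately show ?thesis by (rule LIMSEQ_unique)
qed

text \<open>Each power of the component is traded for a derivative. Derivatives of test functions
  are again test functions, and the transform of a test function is bounded by its L1 norm.\<close>

lemma test_fun_ft_component_bound:
  fixes \<phi> :: "'a::euclidean_space \<Rightarrow> complex"
  assumes b: "b \<in> Basis"
  shows "test_fun \<phi> \<Longrightarrow> \<exists>C. \<forall>\<eta>. \<bar>\<eta> \<bullet> b\<bar> ^ m * norm (ft \<phi> \<eta>) \<le> C"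
proof (induction m arbitrary: \<phi>)
  case 0
  then show ?case using norm_ft_le[OF test_fun_integrable[OF 0]] by auto
next
  case (Suc m)
  obtain C where "\<And>\<eta>. \<bar>\<eta> \<bullet> b\<bar> ^ m * norm (ft (\<lambda>x. frechet_derivative \<phi> (at x) b) \<eta>) \<le> C"
    using Suc.IH[OF test_fun_frechet_derivative[OF Suc.prems b]] by blast
  then show ?case
    using ft_frechet_derivative[OF Suc.prems b] by (auto simp: norm_mult mult_ac)
qed

lemma test_fun_ft_decay:
  fixes \<phi> :: "'a::euclidean_space \<Rightarrow> complex"
  assumes \<phi>: "test_fun \<phi>"
  shows "\<exists>C\<ge>0. \<forall>\<eta>. norm (ft \<phi> \<eta>) \<le> C / (1 + norm \<eta>) ^ m"
proof -
  have "\<exists>c. \<forall>\<eta>. \<bar>\<eta> \<bullet> b\<bar> ^ m * norm (ft \<phi> \<eta>) \<le> c" if "b \<in> Basis" for b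
    using test_fun_ft_component_bound[OF that \<phi>] .
  then obtain c where c: "\<And>b \<eta>. b \<in> Basis \<Longrightarrow> \<bar>\<eta> \<bullet> b\<bar> ^ m * norm (ft \<phi> \<eta>) \<le> c b"
    by metis
  let ?I = "\<integral>x. norm (\<phi> x) \<partial>lborel"
  let ?D = "real DIM('a)"
  let ?C = "(2 * ?D) ^ m * (\<Sum>b\<in>Basis. \<bar>c b\<bar>) + (2 * ?D) ^ m * ?I"
  have "norm (ft \<phi> \<eta>) * (1 + norm \<eta>) ^ m \<le> ?C" for \<eta> :: 'a
  proof -
    have D: "?D \<ge> 1" using DIM_positive[where 'a='a] by linarith
    define M where "M = Max ((\<lambda>b. \<bar>\<eta> \<bullet> b\<bar>) ` Basis)"
    have "M \<in> (\<lambda>b. \<bar>\<eta> \<bullet> b\<bar>) ` Basis" unfolding M_def by (rule Max_in) auto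
    then obtain b where b: "b \<in> Basis" "M = \<bar>\<eta> \<bullet> b\<bar>" by auto
    have "norm \<eta> \<le> (\<Sum>b\<in>Basis. \<bar>\<eta> \<bullet> b\<bar>)" by (rule norm_le_l1)
    also have "\<dots> \<le> (\<Sum>b\<in>(Basis::'a set). M)" by (intro sum_mono) (auto simp: M_def)
    finally have n: "norm \<eta> \<le> ?D * M" by simp
    have M0: "M \<ge> 0" using b by simp
    have S: "\<bar>c b\<bar> \<le> (\<Sum>b\<in>Basis. \<bar>c b\<bar>)" using b(1) by (intro member_le_sum) auto
    have "(1 + norm \<eta>) ^ m \<le> (2 * ?D) ^ m * (M ^ m + 1)"
    proof (cases "M \<ge> 1")
      case True
      then have "1 + norm \<eta> \<le> 2 * ?D * M" using n D mult_mono[of 1 ?D 1 M] by linarith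
      then have "(1 + norm \<eta>) ^ m \<le> (2 * ?D * M) ^ m" by (intro power_mono) auto
      also have "\<dots> \<le> (2 * ?D) ^ m * (M ^ m + 1)" by (simp add: power_mult_distrib)
      finally show ?thesis .
    next
      case False
      then have "1 + norm \<eta> \<le> 2 * ?D" using n D mult_left_mono[of M 1 ?D] by linarith
      then have "(1 + norm \<eta>) ^ m \<le> (2 * ?D) ^ m" by (intro power_mono) auto
      also have "\<dots> \<le> (2 * ?D) ^ m * (M ^ m + 1)"
        using M0 by (simp add: algebra_simps)
      finally show ?thesis .
    qed
    then have "norm (ft \<phi> \<eta>) * (1 + norm \<eta>) ^ m \<le> norm (ft \<phi> \<eta>) * ((2 * ?D) ^ m * (M ^ m + 1))"
      by (rule mult_left_mono) simp
    also have "\<dots> = (2 * ?D) ^ m * (M ^ m * norm (ft \<phi> \<eta>)) + (2 * ?D) ^ m * norm (ft \<phi> \<eta>)"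
      by (simp add: algebra_simps)
    also have "\<dots> \<le> ?C"
      using c[OF b(1), of \<eta>] S norm_ft_le[OF test_fun_integrable[OF \<phi>], of \<eta>]
      by (intro add_mono mult_left_mono) (auto simp: b(2))
    finally show ?thesis .
  qed
  moreover have "?C \<ge> 0" by (intro add_nonneg_nonneg mult_nonneg_nonneg sum_nonneg Bochner_Integration.integral_nonneg) auto
  ultimately show ?thesis
    by (intro exI[of _ ?C]) (auto simp: pos_le_divide_eq add_pos_nonneg)
qed


section \<open>Fourier inversion\<close>

lemma lborel_integrable_prod:
  fixes f :: "'a::euclidean_space \<Rightarrow> real \<Rightarrow> 'b::{real_normed_field, banach, second_countable_topology}"
  assumes "\<And>b. b \<in> Basis \<Longrightarrow> integrable lborel (f b)"
  shows "integrable lborel (\<lambda>x. \<Prod>b\<in>Basis. f b (x \<bullet> b))"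
proof -
  interpret product_sigma_finite "\<lambda>_::'a. lborel :: real measure" ..
  have [measurable]: "\<And>b. b \<in> Basis \<Longrightarrow> f b \<in> borel_measurable borel"
    using assms by auto
  have "integrable (\<Pi>\<^sub>M b\<in>(Basis::'a set). lborel) (\<lambda>g. \<Prod>b\<in>Basis. f b (g b))"
    using assms by (intro product_integrable_prod) auto
  then show ?thesis
    unfolding lborel_eq[where 'a='a]
    by (subst integrable_distr_eq) auto
qed

lemma lborel_integral_prod:
  fixes f :: "'a::euclidean_space \<Rightarrow> real \<Rightarrow> 'b::{real_normed_field, banach, second_countable_topology}"
  assumes "\<And>b. b \<in> Basis \<Longrightarrow> integrable lborel (f b)"
  shows "(\<integral>x. (\<Prod>b\<in>Basis. f b (x \<bullet> b)) \<partial>lborel) = (\<Prod>b\<in>Basis. \<integral>x. f b x \<partial>lborel)"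
proof -
  interpret product_sigma_finite "\<lambda>_::'a. lborel :: real measure" ..
  have [measurable]: "\<And>b. b \<in> Basis \<Longrightarrow> f b \<in> borel_measurable borel"
    using assms by auto
  have "(\<integral>g. (\<Prod>b\<in>Basis. f b (g b)) \<partial>(\<Pi>\<^sub>M b\<in>(Basis::'a set). lborel)) = (\<Prod>b\<in>Basis. \<integral>x. f b x \<partial>lborel)"
    using assms by (intro product_integral_prod) auto
  then show ?thesis
    by (subst lborel_eq) (subst integral_distr; simp)
qed

lemma (in pair_sigma_finite) integrable_pair_mult:
  fixes f :: "'a \<Rightarrow> 'c::{real_normed_field, banach, second_countable_topology}"
  assumes f: "integrable M1 f" and g: "integrable M2 g"
  shows "integrable (M1 \<Otimes>\<^sub>M M2) (\<lambda>(x, y). f x * g y)"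
proof (rule Fubini_integrable)
  have [measurable]: "f \<in> borel_measurable M1" "g \<in> borel_measurable M2"
    using f g by auto
  show "(\<lambda>(x, y). f x * g y) \<in> borel_measurable (M1 \<Otimes>\<^sub>M M2)" by measurable
qed (use f g in \<open>auto simp: norm_mult\<close>)

lemma integrable_inverse_1_plus_square: "integrable lborel (\<lambda>x::real. 1 / (1 + x\<^sup>2))"
proof -
  have "interval_lebesgue_integrable lborel 0 \<infinity> (\<lambda>x::real. 1 / (1 + x^2))"
    by (rule integrable_I0i_1_div_plus_square)
  then have p: "set_integrable lborel {0<..} (\<lambda>x::real. 1 / (1 + x^2))"
    by (simp add: interval_lebesgue_integrable_def zero_ereal_def)
  then have "integrable lborel (\<lambda>x::real. indicator {0<..} (0 + (-1) * x) *\<^sub>R (1 / (1 + (0 + (-1) * x)^2)))"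
    unfolding set_integrable_def by (rule lborel_integrable_real_affine) simp
  then have "set_integrable lborel {..<0} (\<lambda>x::real. 1 / (1 + x^2))"
    unfolding set_integrable_def
    by (rule Bochner_Integration.integrable_cong[THEN iffD1, rotated 2]) (auto simp: indicator_def)
  then have "set_integrable lborel ({..<0} \<union> {0<..}) (\<lambda>x::real. 1 / (1 + x^2))"
    using p by (rule set_integrable_Un) auto
  then have "integrable lborel (\<lambda>x::real. indicator ({..<0} \<union> {0<..}) x *\<^sub>R (1 / (1 + x^2)))"
    by (simp add: set_integrable_def)
  then show ?thesis
    by (rule integrable_cong_AE_imp) (use AE_lborel_singleton[of "0::real"] in \<open>auto simp: indicator_def\<close>)
qed

text \<open>One square is spent per coordinate: \<open>(1 + norm x)\<^sup>2\<close> dominates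
  \<open>1 + (x \<bullet> b)\<^sup>2\<close> for each basis vector b, so the integrand lies below a
  product of integrable functions of one variable. Hence the exponent is twice the
  dimension.\<close>

lemma integrable_inverse_power_norm:
  "integrable lborel (\<lambda>x::'a::euclidean_space. 1 / (1 + norm x) ^ (2 * DIM('a)))"
proof (rule Bochner_Integration.integrable_bound[OF lborel_integrable_prod[of "\<lambda>b::'a. \<lambda>t. 1 / (1 + t\<^sup>2) :: real"]])
  show "AE x::'a in lborel. norm (1 / (1 + norm x) ^ (2 * DIM('a)))
      \<le> norm (\<Prod>b\<in>Basis. 1 / (1 + (x \<bullet> b)\<^sup>2))"
  proof (rule AE_I2)
    fix x :: 'a
    have "(\<Prod>b\<in>(Basis::'a set). 1 / (1 + norm x)\<^sup>2) \<le> (\<Prod>b\<in>Basis. 1 / (1 + (x \<bullet> b)\<^sup>2))"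
    proof (intro prod_mono conjI divide_left_mono)
      fix b :: 'a assume "b \<in> Basis"
      then have "\<bar>x \<bullet> b\<bar> \<le> norm x" by (rule Basis_le_norm)
      then have "(x \<bullet> b)\<^sup>2 \<le> (norm x)\<^sup>2" using abs_le_square_iff[of "x \<bullet> b" "norm x"] by simp
      then show "1 + (x \<bullet> b)\<^sup>2 \<le> (1 + norm x)\<^sup>2" using norm_ge_zero[of x] unfolding power2_sum by (simp del: norm_ge_zero)
      show "0 < (1 + norm x)\<^sup>2 * (1 + (x \<bullet> b)\<^sup>2)"
        by (intro mult_pos_pos zero_less_power add_pos_nonneg) auto
    qed auto
    then have "1 / (1 + norm x) ^ (2 * DIM('a)) \<le> (\<Prod>b\<in>Basis. 1 / (1 + (x \<bullet> b)\<^sup>2))"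
      by (simp add: power_mult power_divide)
    moreover have "0 \<le> (\<Prod>b\<in>Basis. 1 / (1 + (x \<bullet> b)\<^sup>2))" by (intro prod_nonneg) auto
    ultimately show "norm (1 / (1 + norm x) ^ (2 * DIM('a))) \<le> norm (\<Prod>b\<in>Basis. 1 / (1 + (x \<bullet> b)\<^sup>2))"
      by (simp only: real_norm_def abs_of_nonneg) auto
  qed
qed (auto intro: integrable_inverse_1_plus_square)

section \<open>Gaussians and their Fourier transforms\<close>

definition gauss :: "'a::euclidean_space \<Rightarrow> real" where
  "gauss x = (\<Prod>b\<in>Basis. exp (- (x \<bullet> b)\<^sup>2 / 2))"

lemma gauss_borel[measurable]: "gauss \<in> borel_measurable borel"
  unfolding gauss_def by measurable

lemma gauss_pos: "0 < gauss x" and gauss_le_1: "gauss x \<le> 1"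
  unfolding gauss_def by (auto intro!: prod_pos prod_le_1)

lemma gauss_real: "gauss (t::real) = exp (- t\<^sup>2 / 2)"
  by (simp add: gauss_def)

lemma std_normal_density_gauss: "gauss t = sqrt (2 * pi) * std_normal_density t"
  by (simp add: std_normal_density_def gauss_real)

lemma gauss_real_integrable: "integrable lborel (gauss :: real \<Rightarrow> real)"
proof -
  have "integrable lborel (\<lambda>t. sqrt (2 * pi) * std_normal_density t)"
    by (intro integrable_mult_right integrable_normal_density) simp
  then show ?thesis by (simp add: std_normal_density_gauss[symmetric])
qed

text \<open>This is the characteristic function of the standard normal law, freed of the normalizing
  constant of its density.\<close>

lemma gauss_real_fourier:
  "(\<integral>x. of_real (gauss x) * cis (t * x :: real) \<partial>lborel) = of_real (sqrt (2 * pi) * gauss t)"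
proof -
  have "char std_normal_distribution t = (\<integral>x. std_normal_density x *\<^sub>R cis (t * x) \<partial>lborel)"
    unfolding char_def by (subst integral_density) (auto simp: cis_conv_exp)
  then have "(\<integral>x. std_normal_density x *\<^sub>R cis (t * x) \<partial>lborel) = of_real (gauss t)"
    by (simp add: char_std_normal_distribution gauss_real)
  moreover have "(\<integral>x. of_real (gauss x) * cis (t * x) \<partial>lborel)
      = (\<integral>x. of_real (sqrt (2 * pi)) * (std_normal_density x *\<^sub>R cis (t * x)) \<partial>lborel)"
    by (rule Bochner_Integration.integral_cong)
      (auto simp: std_normal_density_gauss scaleR_conv_of_real mult.assoc)
  ultimately show ?thesis by (simp only: integral_mult_right_zero of_real_mult)
qed

lemma cis_inner: "cis (x \<bullet> y) = (\<Prod>b\<in>Basis. cis ((x \<bullet> b) * (y \<bullet> b)))"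
proof -
  have "cis (\<Sum>b\<in>I. g b) = (\<Prod>b\<in>I. cis (g b))" if "finite I" for I :: "'a set" and g
    using that by (induction I) (auto simp: cis_mult[symmetric])
  then show ?thesis by (subst euclidean_inner) simp
qed

lemma gauss_integrable: "integrable lborel (gauss :: 'a::euclidean_space \<Rightarrow> real)"
  using lborel_integrable_prod[of "\<lambda>b::'a. gauss :: real \<Rightarrow> real"] gauss_real_integrable
  unfolding gauss_real gauss_def[where 'a='a, abs_def] by simp

lemma gauss_fourier:
  fixes t :: "'a::euclidean_space"
  shows "(\<integral>x. of_real (gauss x) * cis (t \<bullet> x) \<partial>lborel) = of_real (sqrt (2 * pi) ^ DIM('a) * gauss t)"
proof -
  have prod: "of_real (gauss x) = (\<Prod>b\<in>Basis. of_real (gauss (x \<bullet> b)) :: complex)" for x :: 'a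
    unfolding gauss_real gauss_def[where 'a='a] by simp
  have "(\<integral>x. of_real (gauss x) * cis (t \<bullet> x) \<partial>lborel)
      = (\<integral>x. (\<Prod>b\<in>Basis. of_real (gauss (x \<bullet> b)) * cis ((t \<bullet> b) * (x \<bullet> b))) \<partial>lborel)"
    by (simp only: prod cis_inner prod.distrib)
  also have "\<dots> = (\<Prod>b\<in>Basis. \<integral>x. of_real (gauss x) * cis ((t \<bullet> b) * x) \<partial>lborel)"
    by (rule lborel_integral_prod)
      (intro integrable_mult_cis integrable_of_real gauss_real_integrable, measurable)
  also have "\<dots> = of_real (sqrt (2 * pi) ^ DIM('a)) * (\<Prod>b\<in>Basis. of_real (gauss (t \<bullet> b)))"
    by (simp only: gauss_real_fourier of_real_mult prod.distrib prod_constant of_real_power)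
  finally show ?thesis by (simp only: prod of_real_mult)
qed

lemma gauss_minus: "gauss (- x) = gauss x"
  by (simp add: gauss_def)

section \<open>Inversion by Gaussian regularization\<close>

lemma integral_lborel_affine:
  fixes f :: "'a::euclidean_space \<Rightarrow> complex"
  assumes [measurable]: "f \<in> borel_measurable borel" and "\<epsilon> > 0"
  shows "(\<integral>x. f x \<partial>lborel) = of_real (\<epsilon> ^ DIM('a)) * (\<integral>x. f (t + \<epsilon> *\<^sub>R x) \<partial>lborel)"
proof -
  have "(\<integral>x. f x \<partial>lborel) = (\<integral>x. f x \<partial>density (distr lborel borel (\<lambda>x. t + \<epsilon> *\<^sub>R x)) (\<lambda>_. ennreal (\<epsilon> ^ DIM('a))))"
    using assms(2) by (subst lborel_affine[of \<epsilon> t]) (auto simp: ennreal_power)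
  also have "\<dots> = (\<integral>x. \<epsilon> ^ DIM('a) *\<^sub>R f (t + \<epsilon> *\<^sub>R x) \<partial>lborel)"
    using assms(2) by (subst integral_density) (auto simp: integral_distr)
  finally show ?thesis by (simp add: scaleR_conv_of_real)
qed

text \<open>The Gaussian factor makes the double integral over y and \<eta> absolutely convergent.
  After Fubini the inner integral is a Gaussian in \<open>x - y\<close> of width proportional to
  \<epsilon>, and the substitution \<open>y = x + \<epsilon> *\<^sub>R z\<close> brings it to unit
  width.\<close>

lemma gauss_regularized_inversion:
  fixes f :: "'a::euclidean_space \<Rightarrow> complex"
  assumes f: "integrable lborel f" and \<epsilon>: "\<epsilon> > 0"
  shows "(\<integral>\<eta>. ft f \<eta> * cis (x \<bullet> \<eta>) * of_real (gauss (\<epsilon> *\<^sub>R \<eta>)) \<partial>lborel)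
    = of_real (sqrt (2 * pi) ^ DIM('a)) * (\<integral>z. f (x + \<epsilon> *\<^sub>R z) * of_real (gauss z) \<partial>lborel)"
proof -
  note [measurable] = borel_measurable_integrable[OF f]
  let ?K = "\<lambda>w. \<integral>\<eta>. cis (w \<bullet> \<eta>) * of_real (gauss (\<epsilon> *\<^sub>R \<eta>)) \<partial>lborel"
  have K: "of_real (\<epsilon> ^ DIM('a)) * ?K (- (\<epsilon> *\<^sub>R z)) = of_real (sqrt (2 * pi) ^ DIM('a)) * of_real (gauss z)" for z :: 'a
  proof -
    have "of_real (sqrt (2 * pi) ^ DIM('a)) * of_real (gauss (- z)) = (\<integral>\<eta>. of_real (gauss \<eta>) * cis (- z \<bullet> \<eta>) \<partial>lborel)"
      by (subst gauss_fourier) simp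
    also have "\<dots> = of_real (\<epsilon> ^ DIM('a)) * (\<integral>\<eta>. of_real (gauss (0 + \<epsilon> *\<^sub>R \<eta>)) * cis (- z \<bullet> (0 + \<epsilon> *\<^sub>R \<eta>)) \<partial>lborel)"
      by (rule integral_lborel_affine[OF _ \<epsilon>]) measurable
    finally show ?thesis by (simp add: gauss_minus mult.commute)
  qed
  have gi: "integrable lborel (\<lambda>\<eta>::'a. gauss (\<epsilon> *\<^sub>R \<eta>))"
  proof -
    have "integrable (density (distr lborel borel (\<lambda>x::'a. 0 + \<epsilon> *\<^sub>R x)) (\<lambda>_. ennreal (\<epsilon> ^ DIM('a)))) (gauss :: 'a \<Rightarrow> real)"
      using gauss_integrable \<epsilon> by (subst (asm) lborel_affine[of \<epsilon> 0]) (auto simp: ennreal_power)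
    then have "integrable (distr lborel borel (\<lambda>x::'a. 0 + \<epsilon> *\<^sub>R x)) (\<lambda>x. \<epsilon> ^ DIM('a) *\<^sub>R gauss x)"
      by (subst (asm) integrable_density) (use \<epsilon> in auto)
    then have "integrable lborel (\<lambda>x::'a. \<epsilon> ^ DIM('a) *\<^sub>R gauss (0 + \<epsilon> *\<^sub>R x))"
      by (subst (asm) integrable_distr_eq) auto
    then have "integrable lborel (\<lambda>x::'a. (1 / \<epsilon> ^ DIM('a)) *\<^sub>R (\<epsilon> ^ DIM('a) *\<^sub>R gauss (0 + \<epsilon> *\<^sub>R x)))"
      by (rule integrable_scaleR_right)
    moreover have "(1 / \<epsilon> ^ DIM('a)) *\<^sub>R (\<epsilon> ^ DIM('a) *\<^sub>R gauss (0 + \<epsilon> *\<^sub>R x)) = gauss (\<epsilon> *\<^sub>R x)" for x :: 'a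
      using \<epsilon> by simp
    ultimately show ?thesis by (simp only:)
  qed
  have "(\<integral>\<eta>. ft f \<eta> * cis (x \<bullet> \<eta>) * of_real (gauss (\<epsilon> *\<^sub>R \<eta>)) \<partial>lborel)
      = (\<integral>\<eta>. \<integral>y. f y * cis ((x - y) \<bullet> \<eta>) * of_real (gauss (\<epsilon> *\<^sub>R \<eta>)) \<partial>lborel \<partial>lborel)"
    unfolding ft_def
    by (simp add: integral_mult_left_zero[symmetric] cis_mult inner_diff_left mult.assoc
         del: integral_mult_left_zero integral_mult_right_zero)
  also have "\<dots> = (\<integral>y. \<integral>\<eta>. f y * cis ((x - y) \<bullet> \<eta>) * of_real (gauss (\<epsilon> *\<^sub>R \<eta>)) \<partial>lborel \<partial>lborel)"
  proof (rule lborel_pair.Fubini_integral)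
    have "integrable (lborel \<Otimes>\<^sub>M lborel) (\<lambda>(y, \<eta>::'a). f y * of_real (gauss (\<epsilon> *\<^sub>R \<eta>)) :: complex)"
      by (intro lborel_pair.integrable_pair_mult f integrable_of_real gi)
    then show "integrable (lborel \<Otimes>\<^sub>M lborel)
      (\<lambda>(y, \<eta>). f y * cis ((x - y) \<bullet> \<eta>) * of_real (gauss (\<epsilon> *\<^sub>R \<eta>)))"
      by (rule Bochner_Integration.integrable_bound) (auto simp: norm_mult)
  qed
  also have "\<dots> = (\<integral>y. f y * ?K (x - y) \<partial>lborel)"
    by (simp add: mult.assoc)
  also have "\<dots> = of_real (\<epsilon> ^ DIM('a)) * (\<integral>z. f (x + \<epsilon> *\<^sub>R z) * ?K (x - (x + \<epsilon> *\<^sub>R z)) \<partial>lborel)"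
    by (rule integral_lborel_affine[OF _ \<epsilon>]) measurable
  also have "\<dots> = (\<integral>z. f (x + \<epsilon> *\<^sub>R z) * (of_real (\<epsilon> ^ DIM('a)) * ?K (- (\<epsilon> *\<^sub>R z))) \<partial>lborel)"
    by (simp add: mult.left_commute)
  also have "\<dots> = (\<integral>z. f (x + \<epsilon> *\<^sub>R z) * (of_real (sqrt (2 * pi) ^ DIM('a)) * of_real (gauss z)) \<partial>lborel)"
    by (simp only: K)
  also have "\<dots> = (\<integral>z. of_real (sqrt (2 * pi) ^ DIM('a)) * (f (x + \<epsilon> *\<^sub>R z) * of_real (gauss z)) \<partial>lborel)"
    by (simp only: mult.left_commute)
  finally show ?thesis by (simp only: integral_mult_right_zero)
qed

text \<open>Dominated convergence on both sides of the regularized identity, with \<epsilon> = 1 /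
  (n + 1). Continuity is asked for at the single point x because the formula is later applied to a
  slice of a Radon transform, whose behaviour is known only near the point of evaluation.\<close>

theorem fourier_inversion:
  fixes f :: "'a::euclidean_space \<Rightarrow> complex"
  assumes f: "integrable lborel f" and F: "integrable lborel (ft f)"
    and bdd: "\<And>y. norm (f y) \<le> C" and cont: "isCont f x"
  shows "(\<integral>\<eta>. ft f \<eta> * cis (x \<bullet> \<eta>) \<partial>lborel) = of_real ((2 * pi) ^ DIM('a)) * f x"
proof (rule LIMSEQ_unique)
  note [measurable] = borel_measurable_integrable[OF f]
  let ?\<epsilon> = "\<lambda>n. inverse (real (Suc n))"
  have \<epsilon>0: "(\<lambda>n. ?\<epsilon> n *\<^sub>R z) \<longlonglongrightarrow> 0" for z :: 'a
    using tendsto_scaleR[OF LIMSEQ_inverse_real_of_nat tendsto_const[of z]] by simp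
  have contg: "isCont (gauss :: 'a \<Rightarrow> real) 0"
    unfolding gauss_def by (intro continuous_intros) auto
  show "(\<lambda>n. \<integral>\<eta>. ft f \<eta> * cis (x \<bullet> \<eta>) * of_real (gauss (?\<epsilon> n *\<^sub>R \<eta>)) \<partial>lborel)
      \<longlonglongrightarrow> (\<integral>\<eta>. ft f \<eta> * cis (x \<bullet> \<eta>) \<partial>lborel)"
  proof (rule integral_dominated_convergence[where w="\<lambda>\<eta>. norm (ft f \<eta>)"])
    show "AE \<eta> in lborel. (\<lambda>n. ft f \<eta> * cis (x \<bullet> \<eta>) * of_real (gauss (?\<epsilon> n *\<^sub>R \<eta>))) \<longlonglongrightarrow> ft f \<eta> * cis (x \<bullet> \<eta>)"
    proof (rule AE_I2)
      fix \<eta> :: 'a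
      have "(\<lambda>n. gauss (?\<epsilon> n *\<^sub>R \<eta>)) \<longlonglongrightarrow> gauss (0::'a)"
        by (rule isCont_tendsto_compose[OF contg \<epsilon>0])
      from tendsto_mult[OF tendsto_const[of "ft f \<eta> * cis (x \<bullet> \<eta>)"] tendsto_of_real[OF this]]
      show "(\<lambda>n. ft f \<eta> * cis (x \<bullet> \<eta>) * of_real (gauss (?\<epsilon> n *\<^sub>R \<eta>))) \<longlonglongrightarrow> ft f \<eta> * cis (x \<bullet> \<eta>)"
        by (simp add: gauss_def)
    qed
    show "AE \<eta> in lborel. norm (ft f \<eta> * cis (x \<bullet> \<eta>) * of_real (gauss (?\<epsilon> n *\<^sub>R \<eta>))) \<le> norm (ft f \<eta>)" for n
      by (intro AE_I2) (simp add: norm_mult mult_left_le gauss_le_1 abs_of_pos[OF gauss_pos])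
  qed (use F in auto)
  have L: "(\<lambda>n. \<integral>z. f (x + ?\<epsilon> n *\<^sub>R z) * of_real (gauss z) \<partial>lborel) \<longlonglongrightarrow> (\<integral>z. f x * of_real (gauss (z::'a)) \<partial>lborel)"
  proof (rule integral_dominated_convergence[where w="\<lambda>z. C * gauss (z::'a)"])
    show "AE z in lborel. (\<lambda>n. f (x + ?\<epsilon> n *\<^sub>R z) * of_real (gauss z)) \<longlonglongrightarrow> f x * of_real (gauss z)"
    proof (intro AE_I2 tendsto_mult tendsto_const)
      fix z
      have "(\<lambda>n. x + ?\<epsilon> n *\<^sub>R z) \<longlonglongrightarrow> x"
        using tendsto_add[OF tendsto_const \<epsilon>0] by simp
      with cont show "(\<lambda>n. f (x + ?\<epsilon> n *\<^sub>R z)) \<longlonglongrightarrow> f x"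
        by (rule isCont_tendsto_compose)
    qed
    show "AE z in lborel. norm (f (x + ?\<epsilon> n *\<^sub>R z) * of_real (gauss z)) \<le> C * gauss z" for n
      by (intro AE_I2) (simp add: norm_mult abs_of_pos[OF gauss_pos] bdd less_imp_le[OF gauss_pos] mult_right_mono)
  qed (use gauss_integrable in auto)
  have G: "(\<integral>z. of_real (gauss (z::'a)) \<partial>lborel) = (of_real (sqrt (2 * pi) ^ DIM('a)) :: complex)"
    using gauss_fourier[of "0::'a"] by (simp add: gauss_def)
  have "(\<lambda>n. of_real (sqrt (2 * pi) ^ DIM('a)) * (\<integral>z. f (x + ?\<epsilon> n *\<^sub>R z) * of_real (gauss z) \<partial>lborel))
      \<longlonglongrightarrow> of_real (sqrt (2 * pi) ^ DIM('a)) * (f x * of_real (sqrt (2 * pi) ^ DIM('a)))"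
    by (rule tendsto_mult[OF tendsto_const L[unfolded integral_mult_right_zero G]])
  \<comment> \<open>One factor \<open>sqrt (2 * pi) ^ DIM('a)\<close> comes from the transform of
    the Gaussian, the other from its total mass.\<close>
  moreover have "of_real (sqrt (2 * pi) ^ DIM('a)) * (f x * of_real (sqrt (2 * pi) ^ DIM('a))) = of_real ((2 * pi) ^ DIM('a)) * f x"
  proof -
    have "(2 * pi) ^ DIM('a) = sqrt (2 * pi) ^ DIM('a) * sqrt (2 * pi) ^ DIM('a)"
      by (simp only: power_mult_distrib[symmetric] real_sqrt_mult_self) simp
    then have "(of_real ((2 * pi) ^ DIM('a)) :: complex) = of_real (sqrt (2 * pi) ^ DIM('a)) * of_real (sqrt (2 * pi) ^ DIM('a))"
      by (simp only: of_real_mult)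
    then show ?thesis by (simp only: mult_ac)
  qed
  ultimately show "(\<lambda>n. \<integral>\<eta>. ft f \<eta> * cis (x \<bullet> \<eta>) * of_real (gauss (?\<epsilon> n *\<^sub>R \<eta>)) \<partial>lborel)
      \<longlonglongrightarrow> of_real ((2 * pi) ^ DIM('a)) * f x"
    by (simp only: gauss_regularized_inversion[OF f positive_imp_inverse_positive[OF of_nat_0_less_iff[THEN iffD2, OF zero_less_Suc]]])
qed


section \<open>Measures on the plane and the circle\<close>

lemma Basis_real2: "(Basis :: (real^2) set) = {axis 1 1, axis 2 1}"
  by (auto simp: Basis_vec_def UNIV_2)

lemma inner_real2: "(x :: real^2) \<bullet> y = x $ 1 * y $ 1 + x $ 2 * y $ 2"
  by (simp add: inner_vec_def UNIV_2)

lemma vec2_eq_iff: "(x :: real^2) = y \<longleftrightarrow> x $ 1 = y $ 1 \<and> x $ 2 = y $ 2"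
  by (auto simp: vec_eq_iff forall_2)

definition vec2 :: "real \<times> real \<Rightarrow> real^2" where
  "vec2 = (\<lambda>(a, b). vector [a, b])"

lemma vec2_nth[simp]: "vec2 z $ 1 = fst z" "vec2 z $ 2 = snd z"
  by (auto simp: vec2_def split: prod.split)

lemma vec2_eq: "vec2 z = fst z *\<^sub>R axis 1 1 + snd z *\<^sub>R axis 2 1"
  by (simp add: vec2_eq_iff axis_def)

lemma vec2_borel[measurable]: "vec2 \<in> borel_measurable borel"
  unfolding vec2_eq[abs_def] by (intro borel_measurable_continuous_onI continuous_intros)

lemma lborel_vec2: "distr lborel borel vec2 = lborel"
proof (rule lborel_eqI[symmetric])
  fix l u :: "real^2"
  assume le: "\<And>b. b \<in> Basis \<Longrightarrow> l \<bullet> b \<le> u \<bullet> b"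
  have "vec2 -` box l u = box (l $ 1, l $ 2) (u $ 1, u $ 2)"
    by (auto simp: box_def Basis_real2 Basis_prod_def inner_axis)
  moreover have "l $ 1 \<le> u $ 1" "l $ 2 \<le> u $ 2"
    using le[of "axis 1 1"] le[of "axis 2 1"] by (auto simp: Basis_real2 inner_axis)
  ultimately show "emeasure (distr lborel borel vec2) (box l u) = (\<Prod>b\<in>Basis. (u - l) \<bullet> b)"
    by (subst emeasure_distr)
      (auto simp: emeasure_lborel_box_eq Basis_real2 Basis_prod_def inner_axis axis_eq_axis
        prod.insert_if)
qed simp

lemma emeasure_lborel_lebesgue: "X \<in> sets borel \<Longrightarrow> emeasure lebesgue X = emeasure lborel X"
  by (simp add: emeasure_completion main_part_sets)

text \<open>Invariance under orthogonal maps is used on the completed measure: the preimage of a box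
  is measured there and the value is carried back to the Borel sets.\<close>

lemma lborel_orthogonal:
  fixes T :: "real^2 \<Rightarrow> real^2"
  assumes "orthogonal_transformation T"
  shows "distr lborel borel T = lborel"
proof (rule lborel_eqI[symmetric])
  fix l u :: "real^2"
  assume le: "\<And>b. b \<in> Basis \<Longrightarrow> l \<bullet> b \<le> u \<bullet> b"
  let ?I = "inv T"
  have bij: "bij T" and I: "orthogonal_transformation ?I"
    using assms orthogonal_transformation_bij orthogonal_transformation_inv by auto
  have vim: "T -` box l u = ?I ` box l u"
    using bij by (simp add: bij_vimage_eq_inv_image)
  have [measurable]: "T \<in> borel_measurable borel"
    by (intro borel_measurable_continuous_onI linear_continuous_on linear_conv_bounded_linear[THEN iffD1]
        orthogonal_transformation_linear assms)
  have Tb: "T -` box l u \<in> sets borel"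
    using measurable_sets[of T borel borel "box l u"] by simp
  have S: "box l u \<in> lmeasurable" by simp
  have "emeasure lborel (T -` box l u) = emeasure lebesgue (?I ` box l u)"
    unfolding vim[symmetric] by (rule emeasure_lborel_lebesgue[symmetric, OF Tb])
  also have "\<dots> = measure lebesgue (box l u)"
    using measurable_orthogonal_image[OF I S] measure_orthogonal_image[OF I S]
    by (simp add: emeasure_eq_measure2 fmeasurableD2)
  also have "\<dots> = emeasure lebesgue (box l u)"
    using S by (simp add: emeasure_eq_measure2 fmeasurableD2)
  also have "\<dots> = (\<Prod>b\<in>Basis. (u - l) \<bullet> b)"
    using le by (simp add: emeasure_lborel_box_eq)
  finally show "emeasure (distr lborel borel T) (box l u) = (\<Prod>b\<in>Basis. (u - l) \<bullet> b)"
    by (subst emeasure_distr) auto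
qed simp

text \<open>Coordinates adapted to a unit vector \<theta>: for fixed p, the points
  \<open>rot \<theta> (p, t)\<close> run through \<open>line \<theta> p\<close>. Integrating in t is
  then the Radon transform, and integrating in both variables is an integral over the rotated
  plane.\<close>

definition rot :: "real^2 \<Rightarrow> real \<times> real \<Rightarrow> real^2" where
  "rot \<theta> z = fst z *\<^sub>R \<theta> + snd z *\<^sub>R perp \<theta>"

lemma perp_nth[simp]: "perp \<theta> $ 1 = - (\<theta> $ 2)" "perp \<theta> $ 2 = \<theta> $ 1"
  by (auto simp: perp_def)

lemma perp_minus: "perp (- \<theta>) = - perp \<theta>"
  by (simp add: vec2_eq_iff)

lemma inner_rot: "norm \<theta> = 1 \<Longrightarrow> rot \<theta> z \<bullet> \<theta> = fst z"
proof -
  assume "norm \<theta> = 1"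
  then have "\<theta> $ 1 * \<theta> $ 1 + \<theta> $ 2 * \<theta> $ 2 = 1"
    using norm_eq_1[of \<theta>] by (simp add: inner_real2)
  then show ?thesis by (simp add: inner_real2 rot_def algebra_simps) (metis distrib_left mult.commute mult.right_neutral)
qed

lemma continuous_on_rot: "continuous_on UNIV (rot \<theta>)"
  unfolding rot_def by (intro continuous_intros)

lemma rot_borel[measurable]: "rot \<theta> \<in> borel_measurable borel"
  by (intro borel_measurable_continuous_onI continuous_on_rot)

lemma norm_rot: "norm \<theta> = 1 \<Longrightarrow> (norm (rot \<theta> z))\<^sup>2 = (fst z)\<^sup>2 + (snd z)\<^sup>2"
proof -
  assume "norm \<theta> = 1"
  then have "\<theta> $ 1 * \<theta> $ 1 + \<theta> $ 2 * \<theta> $ 2 = 1"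
    using norm_eq_1[of \<theta>] by (simp add: inner_real2)
  moreover have "(norm (rot \<theta> z))\<^sup>2 = ((fst z)\<^sup>2 + (snd z)\<^sup>2) * (\<theta> $ 1 * \<theta> $ 1 + \<theta> $ 2 * \<theta> $ 2)"
    unfolding power2_norm_eq_inner by (simp add: inner_real2 rot_def algebra_simps power2_eq_square)
  ultimately show ?thesis by simp
qed

lemma lborel_rot:
  assumes "norm \<theta> = 1"
  shows "distr lborel borel (rot \<theta>) = lborel"
proof -
  let ?T = "\<lambda>x :: real^2. x $ 1 *\<^sub>R \<theta> + x $ 2 *\<^sub>R perp \<theta>"
  have "linear ?T" by (rule linearI) (auto simp: algebra_simps)
  moreover have "norm (?T x) = norm x" for x
    using norm_rot[OF assms, of "(x $ 1, x $ 2)"] power2_eq_iff_nonneg[of "norm (?T x)" "norm x"]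
    by (simp add: rot_def norm_vec_def L2_set_def UNIV_2)
  ultimately have orth: "orthogonal_transformation ?T"
    by (simp add: orthogonal_transformation)
  have [measurable]: "?T \<in> borel_measurable borel"
    by (intro borel_measurable_continuous_onI continuous_intros)
  have "distr lborel borel (rot \<theta>) = distr (distr lborel borel vec2) borel ?T"
    by (subst distr_distr) (auto simp: o_def rot_def intro!: distr_cong)
  then show ?thesis by (simp add: lborel_vec2 lborel_orthogonal[OF orth])
qed

lemma circ_nth[simp]: "circ s $ 1 = cos s" "circ s $ 2 = sin s"
  by (auto simp: circ_def)

lemma circ_eq_vec2: "circ s = vec2 (cos s, sin s)"
  by (simp add: vec2_eq_iff)

lemma norm_circ[simp]: "norm (circ s) = 1"
  by (simp add: norm_vec_def L2_set_def UNIV_2)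

lemma continuous_on_circ: "continuous_on S circ"
  unfolding circ_eq_vec2[abs_def] vec2_eq by (intro continuous_intros)

lemma circ_borel[measurable]: "circ \<in> borel_measurable borel"
  by (intro borel_measurable_continuous_onI continuous_on_circ)

lemma circ_plus_pi: "circ (pi + s) = - circ s"
  by (simp add: vec2_eq_iff)

section \<open>Arc length on the unit circle\<close>

definition circle_measure :: "(real^2) measure" where
  "circle_measure = distr (restrict_space lborel {0..2 * pi}) borel circ"

lemma sets_circle_measure[simp, measurable_cong]: "sets circle_measure = sets borel"
  and space_circle_measure[simp]: "space circle_measure = UNIV"
  by (auto simp: circle_measure_def)

lemma nn_integral_circle:
  assumes [measurable]: "F \<in> borel_measurable borel"
  shows "(\<integral>\<^sup>+\<theta>. F \<theta> \<partial>circle_measure) = (\<integral>\<^sup>+s. F (circ s) * indicator {0..2 * pi} s \<partial>lborel)"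
  unfolding circle_measure_def
  by (subst nn_integral_distr) (auto intro!: nn_integral_restrict_space measurable_restrict_space1)

text \<open>Pairing antipodes serves two purposes: it makes the invariance under \<theta> to
  -\<theta> evident, and a signed radius over the open half circle covers the plane once up to a
  null set.\<close>

lemma nn_integral_circle_half:
  assumes [measurable]: "F \<in> borel_measurable borel"
  shows "(\<integral>\<^sup>+\<theta>. F \<theta> \<partial>circle_measure)
    = (\<integral>\<^sup>+s. (F (circ s) + F (- circ s)) * indicator {0<..<pi} s \<partial>lborel)"
proof -
  have "(\<integral>\<^sup>+s. F (circ s) * indicator {0..2 * pi} s \<partial>lborel)
      = (\<integral>\<^sup>+s. F (circ s) * indicator {0<..<pi} s + F (circ s) * indicator {pi<..<2 * pi} s \<partial>lborel)"
  proof (rule nn_integral_cong_AE)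
    show "AE s in lborel. F (circ s) * indicator {0..2 * pi} s
      = F (circ s) * indicator {0<..<pi} s + F (circ s) * indicator {pi<..<2 * pi} s"
      using AE_lborel_singleton[of 0] AE_lborel_singleton[of pi] AE_lborel_singleton[of "2 * pi"]
      by eventually_elim (auto simp: indicator_def)
  qed
  also have "\<dots> = (\<integral>\<^sup>+s. F (circ s) * indicator {0<..<pi} s \<partial>lborel)
      + (\<integral>\<^sup>+s. F (circ s) * indicator {pi<..<2 * pi} s \<partial>lborel)"
    by (rule nn_integral_add) auto
  also have "(\<integral>\<^sup>+s. F (circ s) * indicator {pi<..<2 * pi} s \<partial>lborel)
      = (\<integral>\<^sup>+s. F (- circ s) * indicator {0<..<pi} s \<partial>lborel)"
    by (subst nn_integral_real_affine[where c=1 and t=pi])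
      (auto simp: circ_plus_pi indicator_def intro!: nn_integral_cong)
  also have "(\<integral>\<^sup>+s. F (circ s) * indicator {0<..<pi} s \<partial>lborel) + \<dots>
      = (\<integral>\<^sup>+s. (F (circ s) + F (- circ s)) * indicator {0<..<pi} s \<partial>lborel)"
    by (subst nn_integral_add[symmetric]) (auto simp: distrib_right)
  finally show ?thesis by (simp add: nn_integral_circle)
qed

lemma circle_measure_uminus: "distr circle_measure borel uminus = circle_measure"
proof (rule measure_eqI)
  fix X assume "X \<in> sets (distr circle_measure borel (uminus :: real^2 \<Rightarrow> _))"
  then have [measurable]: "X \<in> sets borel" by simp
  have "emeasure (distr circle_measure borel uminus) X = (\<integral>\<^sup>+\<theta>. indicator X (- \<theta>) \<partial>circle_measure)"
    by (subst nn_integral_indicator[symmetric]) (simp, subst nn_integral_distr, auto)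
  also have "\<dots> = (\<integral>\<^sup>+\<theta>. indicator X \<theta> \<partial>circle_measure)"
    by (subst (1 2) nn_integral_circle_half) (auto simp: add.commute)
  finally show "emeasure (distr circle_measure borel uminus) X = emeasure circle_measure X"
    by (simp add: nn_integral_indicator)
qed simp

lemma finite_circle_measure: "finite_measure circle_measure"
proof
  have "emeasure circle_measure (space circle_measure) = (\<integral>\<^sup>+\<theta>. 1 \<partial>circle_measure)" by simp
  also have "\<dots> = emeasure lborel {0..2 * pi}" by (subst nn_integral_circle) simp_all
  finally show "emeasure circle_measure (space circle_measure) \<noteq> \<infinity>" by simp
qed

lemma AE_circle_norm: "AE \<theta> in circle_measure. norm \<theta> = 1"
  unfolding circle_measure_def
  by (subst AE_distr_iff) (auto intro!: measurable_restrict_space1)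

interpretation circle: finite_measure circle_measure by (rule finite_circle_measure)

section \<open>Polar coordinates with a signed radius\<close>

lemma borel_measurable_tan[measurable]: "(tan :: real \<Rightarrow> real) \<in> borel_measurable borel"
  unfolding tan_def by measurable

text \<open>The substitution is made on the compact intervals bounded by
  \<open>arctan (n + 1)\<close> and its negative, where the derivative of \<open>tan\<close> is
  continuous, and then extended by monotone convergence on both sides.\<close>

lemma nn_integral_tan_substitution:
  fixes G :: "real \<Rightarrow> ennreal"
  assumes [measurable]: "G \<in> borel_measurable borel"
  shows "(\<integral>\<^sup>+u. G u \<partial>lborel)
    = (\<integral>\<^sup>+s. G (tan s) * ennreal (1 / (cos s)\<^sup>2) * indicator {-pi/2<..<pi/2} s \<partial>lborel)"
proof -
  let ?a = "\<lambda>n. arctan (real (Suc n))"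
  let ?h = "\<lambda>s. G (tan s) * ennreal (1 / (cos s)\<^sup>2)"
  have ivl: "{- ?a n..?a n} \<subseteq> {-pi/2<..<pi/2}" for n
    using arctan_ubound[of "real (Suc n)"] by auto
  have cos0: "cos s \<noteq> 0" if "s \<in> {- ?a n..?a n}" for s n
    using ivl[of n] that cos_gt_zero_pi[of s] by auto
  have eq: "(\<integral>\<^sup>+u. G u * indicator {- real (Suc n)..real (Suc n)} u \<partial>lborel)
      = (\<integral>\<^sup>+s. ?h s * indicator {- ?a n..?a n} s \<partial>lborel)" for n
  proof -
    have "(\<integral>\<^sup>+u. G u * indicator {tan (- ?a n)..tan (?a n)} u \<partial>lborel)
      = (\<integral>\<^sup>+s. G (tan s) * ennreal (1 / (cos s)\<^sup>2) * indicator {- ?a n..?a n} s \<partial>lborel)"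
    proof (rule nn_integral_substitution_aux)
      show "- ?a n < ?a n" by simp
      show "(tan has_real_derivative 1 / (cos s)\<^sup>2) (at s)" if "s \<in> {- ?a n..?a n}" for s
        using DERIV_tan[OF cos0[OF that]] by (simp add: divide_inverse)
      show "continuous_on {- ?a n..?a n} (\<lambda>s. 1 / (cos s)\<^sup>2)"
        using cos0 by (intro continuous_intros) auto
    qed auto
    then show ?thesis by (simp add: tan_arctan del: of_nat_Suc)
  qed
  have "(\<integral>\<^sup>+u. G u \<partial>lborel) = (SUP n. \<integral>\<^sup>+u. G u * indicator {- real (Suc n)..real (Suc n)} u \<partial>lborel)"
  proof (subst nn_integral_monotone_convergence_SUP[symmetric])
    show "incseq (\<lambda>n u. G u * indicator {- real (Suc n)..real (Suc n)} u)"
      by (auto simp: incseq_def le_fun_def indicator_def)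
    show "(\<integral>\<^sup>+u. G u \<partial>lborel) = (\<integral>\<^sup>+u. (SUP n. G u * indicator {- real (Suc n)..real (Suc n)} u) \<partial>lborel)"
    proof (rule nn_integral_cong)
      fix u
      obtain n where "\<bar>u\<bar> \<le> real n" using real_arch_simple by blast
      then have "G u \<le> (SUP n. G u * indicator {- real (Suc n)..real (Suc n)} u)"
        by (intro SUP_upper2[of n]) (auto simp: indicator_def)
      moreover have "(SUP n. G u * indicator {- real (Suc n)..real (Suc n)} u) \<le> G u"
        by (intro SUP_least) (auto simp: indicator_def)
      ultimately show "G u = (SUP n. G u * indicator {- real (Suc n)..real (Suc n)} u)" by (rule antisym)
    qed
  qed auto
  also have "\<dots> = (SUP n. \<integral>\<^sup>+s. ?h s * indicator {- ?a n..?a n} s \<partial>lborel)"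
    by (simp only: eq)
  also have "\<dots> = (\<integral>\<^sup>+s. ?h s * indicator {-pi/2<..<pi/2} s \<partial>lborel)"
  proof (subst nn_integral_monotone_convergence_SUP[symmetric])
    have "?a m \<le> ?a n" if "m \<le> n" for m n using that by (simp add: arctan_le_iff)
    then show "incseq (\<lambda>n s. ?h s * indicator {- ?a n..?a n} s)"
      by (force simp: incseq_def le_fun_def indicator_def)
    show "(\<integral>\<^sup>+s. (SUP n. ?h s * indicator {- ?a n..?a n} s) \<partial>lborel) = (\<integral>\<^sup>+s. ?h s * indicator {-pi/2<..<pi/2} s \<partial>lborel)"
    proof (rule nn_integral_cong)
      fix s
      show "(SUP n. ?h s * indicator {- ?a n..?a n} s) = ?h s * indicator {-pi/2<..<pi/2} s"
      proof (rule antisym)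
        show "(SUP n. ?h s * indicator {- ?a n..?a n} s) \<le> ?h s * indicator {-pi/2<..<pi/2} s"
        proof (intro SUP_least mult_left_mono)
          fix n
          show "(indicator {- ?a n..?a n} s :: ennreal) \<le> indicator {-pi/2<..<pi/2} s"
            using ivl[of n] 
            by (metis indicator_simps order_refl subsetD zero_le)
        qed simp
        show "?h s * indicator {-pi/2<..<pi/2} s \<le> (SUP n. ?h s * indicator {- ?a n..?a n} s)"
        proof (cases "s \<in> {-pi/2<..<pi/2}")
          case True
          obtain n where n: "\<bar>tan s\<bar> \<le> real n" using real_arch_simple by blast
          have "arctan (tan s) = s" using True by (intro arctan_tan) auto
          moreover have "arctan (tan s) \<le> ?a n" "arctan (- real (Suc n)) \<le> arctan (tan s)"
            using n by (subst arctan_le_iff; simp)+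
          ultimately have "s \<in> {- ?a n..?a n}" by (simp add: arctan_minus del: of_nat_Suc)
          then show ?thesis using True by (intro SUP_upper2[of n]) auto
        qed auto
      qed
    qed
  qed auto
  finally show ?thesis .
qed

text \<open>On the horizontal line at height b substitute \<open>a = - (b * tan s)\<close>. The
  point becomes \<open>(b / cos s) *\<^sub>R circ (pi / 2 + s)\<close>, so s is an angle and
  \<open>\<tau> = b / cos s\<close> a signed radius. Exchanging the integrals and replacing b by
  \<open>cos s * \<tau>\<close> turns the Jacobian into \<open>\<bar>\<tau>\<bar>\<close>.\<close>

lemma nn_integral_polar_half:
  assumes [measurable]: "F \<in> borel_measurable borel"
  shows "(\<integral>\<^sup>+x. F x \<partial>lborel)
    = (\<integral>\<^sup>+s. (\<integral>\<^sup>+\<tau>. ennreal \<bar>\<tau>\<bar> * F (\<tau> *\<^sub>R circ s) \<partial>lborel) * indicator {0<..<pi} s \<partial>lborel)"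
proof -
  let ?I = "indicator {-pi/2<..<pi/2} :: real \<Rightarrow> ennreal"
  have F2[measurable]: "(\<lambda>(a, b). F (vec2 (a, b))) \<in> borel_measurable (borel \<Otimes>\<^sub>M borel)"
    using measurable_compose[OF vec2_borel assms]
    by (simp add: borel_prod case_prod_unfold)
  have m: "(\<lambda>z. F (vec2 (g z, h z))) \<in> borel_measurable M"
    if [measurable]: "g \<in> borel_measurable M" "h \<in> borel_measurable M" for g h and M :: "'z measure"
    using measurable_compose[OF measurable_Pair[OF that] F2] by simp
  have vc: "vec2 (- (b * tan s), b) = (b / cos s) *\<^sub>R circ (pi / 2 + s)" if "cos s \<noteq> 0" for b s
    using that by (simp add: vec2_eq_iff sin_add cos_add tan_def)
  have "(\<integral>\<^sup>+x. F x \<partial>lborel) = (\<integral>\<^sup>+z. F (vec2 z) \<partial>lborel)"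
    by (subst lborel_vec2[symmetric]) (simp add: nn_integral_distr)
  also have "\<dots> = (\<integral>\<^sup>+b. \<integral>\<^sup>+a. F (vec2 (a, b)) \<partial>lborel \<partial>lborel)"
  proof -
    have "(\<lambda>z. F (vec2 z)) \<in> borel_measurable (lborel \<Otimes>\<^sub>M lborel)"
      unfolding lborel_prod by measurable
    from lborel_pair.nn_integral_snd[OF this] show ?thesis by (simp only: lborel_prod)
  qed
  also have "\<dots> = (\<integral>\<^sup>+b. \<integral>\<^sup>+s. ennreal \<bar>b\<bar> * (F (vec2 (- (b * tan s), b)) * ennreal (1 / (cos s)\<^sup>2) * ?I s) \<partial>lborel \<partial>lborel)"
  proof (rule nn_integral_cong_AE)
    show "AE b in lborel. (\<integral>\<^sup>+a. F (vec2 (a, b)) \<partial>lborel)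
        = (\<integral>\<^sup>+s. ennreal \<bar>b\<bar> * (F (vec2 (- (b * tan s), b)) * ennreal (1 / (cos s)\<^sup>2) * ?I s) \<partial>lborel)"
      using AE_lborel_singleton[of 0]
    proof eventually_elim
      case (elim b)
      have "(\<integral>\<^sup>+a. F (vec2 (a, b)) \<partial>lborel) = ennreal \<bar>- b\<bar> * (\<integral>\<^sup>+u. F (vec2 (0 + (- b) * u, b)) \<partial>lborel)"
        by (rule nn_integral_real_affine) (use elim m in auto)
      also have "(\<integral>\<^sup>+u. F (vec2 (0 + (- b) * u, b)) \<partial>lborel)
          = (\<integral>\<^sup>+s. F (vec2 (0 + (- b) * tan s, b)) * ennreal (1 / (cos s)\<^sup>2) * ?I s \<partial>lborel)"
        by (rule nn_integral_tan_substitution) (rule m; measurable)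
      finally show ?case
        by (subst nn_integral_cmult) (auto intro!: borel_measurable_times m)
    qed
  qed
  also have "\<dots> = (\<integral>\<^sup>+s. \<integral>\<^sup>+b. ennreal \<bar>b\<bar> * (F (vec2 (- (b * tan s), b)) * ennreal (1 / (cos s)\<^sup>2) * ?I s) \<partial>lborel \<partial>lborel)"
    by (rule lborel_pair.Fubini') (auto simp: split_beta' intro!: borel_measurable_times m)
  also have "\<dots> = (\<integral>\<^sup>+s. (\<integral>\<^sup>+\<tau>. ennreal \<bar>\<tau>\<bar> * F (\<tau> *\<^sub>R circ (pi / 2 + s)) \<partial>lborel) * ?I s \<partial>lborel)"
  proof (rule nn_integral_cong)
    fix s
    show "(\<integral>\<^sup>+b. ennreal \<bar>b\<bar> * (F (vec2 (- (b * tan s), b)) * ennreal (1 / (cos s)\<^sup>2) * ?I s) \<partial>lborel)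
      = (\<integral>\<^sup>+\<tau>. ennreal \<bar>\<tau>\<bar> * F (\<tau> *\<^sub>R circ (pi / 2 + s)) \<partial>lborel) * ?I s"
    proof (cases "s \<in> {-pi/2<..<pi/2}")
      case True
      then have c: "cos s > 0" by (intro cos_gt_zero_pi) auto
      have "(\<integral>\<^sup>+b. ennreal \<bar>b\<bar> * (F (vec2 (- (b * tan s), b)) * ennreal (1 / (cos s)\<^sup>2)) \<partial>lborel)
        = ennreal \<bar>cos s\<bar> * (\<integral>\<^sup>+\<tau>. ennreal \<bar>0 + cos s * \<tau>\<bar> * (F (vec2 (- ((0 + cos s * \<tau>) * tan s), 0 + cos s * \<tau>)) * ennreal (1 / (cos s)\<^sup>2)) \<partial>lborel)"
        by (rule nn_integral_real_affine) (use c m in \<open>auto intro!: borel_measurable_times m\<close>)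
      also have "\<dots> = (\<integral>\<^sup>+\<tau>. ennreal \<bar>cos s\<bar> * (ennreal \<bar>0 + cos s * \<tau>\<bar> * (F (vec2 (- ((0 + cos s * \<tau>) * tan s), 0 + cos s * \<tau>)) * ennreal (1 / (cos s)\<^sup>2))) \<partial>lborel)"
        by (rule nn_integral_cmult[symmetric]) (auto intro!: borel_measurable_times m)
      also have "\<dots> = (\<integral>\<^sup>+\<tau>. ennreal \<bar>\<tau>\<bar> * F (\<tau> *\<^sub>R circ (pi / 2 + s)) \<partial>lborel)"
      proof (rule nn_integral_cong)
        fix \<tau>
        have "vec2 (- ((0 + cos s * \<tau>) * tan s), 0 + cos s * \<tau>) = \<tau> *\<^sub>R circ (pi / 2 + s)"
          using c vc[of s "0 + cos s * \<tau>"] by simp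
        \<comment> \<open>The scaling of the height variable, the height itself and the derivative
          of the tangent multiply to \<open>\<bar>\<tau>\<bar>\<close>: two cosines cancel the
          square in the denominator.\<close>
        moreover have "ennreal \<bar>cos s\<bar> * (ennreal \<bar>0 + cos s * \<tau>\<bar> * (y * ennreal (1 / (cos s)\<^sup>2))) = ennreal \<bar>\<tau>\<bar> * y" for y
        proof -
          have "\<bar>cos s\<bar> * (\<bar>0 + cos s * \<tau>\<bar> * (1 / (cos s)\<^sup>2)) = \<bar>\<tau>\<bar>"
            using c by (simp add: abs_mult power2_eq_square)
          then have "ennreal \<bar>cos s\<bar> * (ennreal \<bar>0 + cos s * \<tau>\<bar> * ennreal (1 / (cos s)\<^sup>2)) = ennreal \<bar>\<tau>\<bar>"
            by (simp only: ennreal_mult'[symmetric] abs_ge_zero mult_nonneg_nonneg zero_le_divide_1_iff zero_le_power2)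
          then show ?thesis by (metis mult.assoc mult.commute)
        qed
        ultimately show "ennreal \<bar>cos s\<bar> * (ennreal \<bar>0 + cos s * \<tau>\<bar> * (F (vec2 (- ((0 + cos s * \<tau>) * tan s), 0 + cos s * \<tau>)) * ennreal (1 / (cos s)\<^sup>2)))
          = ennreal \<bar>\<tau>\<bar> * F (\<tau> *\<^sub>R circ (pi / 2 + s))" by simp
      qed
      finally show ?thesis using True by simp
    qed simp
  qed
  also have "\<dots> = (\<integral>\<^sup>+s. (\<integral>\<^sup>+\<tau>. ennreal \<bar>\<tau>\<bar> * F (\<tau> *\<^sub>R circ s) \<partial>lborel) * indicator {0<..<pi} s \<partial>lborel)"
    by (subst (2) nn_integral_real_affine[where c=1 and t="pi/2"])
      (auto simp: indicator_def intro!: nn_integral_cong)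
  finally show ?thesis .
qed

text \<open>Over the whole circle (\<theta>, \<tau>) and (-\<theta>, -\<tau>) reach the same point,
  hence the factor 2.\<close>

lemma nn_integral_polar:
  assumes [measurable]: "F \<in> borel_measurable borel"
  shows "(\<integral>\<^sup>+\<theta>. \<integral>\<^sup>+\<tau>. ennreal \<bar>\<tau>\<bar> * F (\<tau> *\<^sub>R \<theta>) \<partial>lborel \<partial>circle_measure) = 2 * (\<integral>\<^sup>+x. F x \<partial>lborel)"
proof -
  have neg: "(\<integral>\<^sup>+\<tau>. ennreal \<bar>\<tau>\<bar> * F (\<tau> *\<^sub>R - \<theta>) \<partial>lborel) = (\<integral>\<^sup>+\<tau>. ennreal \<bar>\<tau>\<bar> * F (\<tau> *\<^sub>R \<theta>) \<partial>lborel)" for \<theta>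
    by (subst nn_integral_real_affine[where c="-1" and t=0]) auto
  have "(\<integral>\<^sup>+\<theta>. \<integral>\<^sup>+\<tau>. ennreal \<bar>\<tau>\<bar> * F (\<tau> *\<^sub>R \<theta>) \<partial>lborel \<partial>circle_measure)
    = (\<integral>\<^sup>+s. 2 * ((\<integral>\<^sup>+\<tau>. ennreal \<bar>\<tau>\<bar> * F (\<tau> *\<^sub>R circ s) \<partial>lborel) * indicator {0<..<pi} s) \<partial>lborel)"
    by (subst nn_integral_circle_half) (auto simp: neg[simplified] mult_2 distrib_right)
  also have "\<dots> = 2 * (\<integral>\<^sup>+s. (\<integral>\<^sup>+\<tau>. ennreal \<bar>\<tau>\<bar> * F (\<tau> *\<^sub>R circ s) \<partial>lborel) * indicator {0<..<pi} s \<partial>lborel)"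
    by (rule nn_integral_cmult) measurable
  finally show ?thesis by (simp add: nn_integral_polar_half)
qed


section \<open>The Radon transform of integrable functions\<close>

definition cyl_measure :: "((real^2) \<times> real) measure" where
  "cyl_measure = circle_measure \<Otimes>\<^sub>M lborel"

lemma sets_cyl_measure[simp, measurable_cong]: "sets cyl_measure = sets borel"
  unfolding cyl_measure_def by (metis borel_prod sets_circle_measure sets_lborel sets_pair_measure_cong)

lemma space_cyl_measure[simp]: "space cyl_measure = UNIV"
  by (simp add: cyl_measure_def space_pair_measure)

interpretation cylp: pair_sigma_finite circle_measure "lborel :: real measure"
  by standard

interpretation cyl: sigma_finite_measure cyl_measure
  unfolding cyl_measure_def by (rule cylp.sigma_finite_measure_axioms)

lemma borel_measurable_cyl_iff: "f \<in> measurable cyl_measure M \<longleftrightarrow> f \<in> measurable borel M"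
  by (simp add: measurable_def)

lemma borel_measurable_pairI:
  "f \<in> measurable borel M \<Longrightarrow> f \<in> measurable (circle_measure \<Otimes>\<^sub>M (lborel :: real measure)) M"
  using borel_measurable_cyl_iff[of f M] by (simp add: cyl_measure_def)

lemma borel_measurable_fst_borel[measurable]:
    "fst \<in> measurable (borel :: ('a::second_countable_topology \<times> 'b::second_countable_topology) measure) borel"
  and borel_measurable_snd_borel[measurable]:
    "snd \<in> measurable (borel :: ('a \<times> 'b) measure) borel"
  by (intro borel_measurable_continuous_onI continuous_intros)+

lemma scaleR_pair_borel: "(\<lambda>(\<theta>, \<tau>). \<tau> *\<^sub>R (\<theta> :: real^2)) \<in> borel_measurable borel"
  by (intro borel_measurable_continuous_onI) (auto simp: split_beta' intro!: continuous_intros)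

text \<open>The density is halved because the signed radius covers the plane twice. An equality of
  measures transports both integrability and the value of complex integrals.\<close>

lemma lborel_polar:
  "lborel = distr (density cyl_measure (\<lambda>(\<theta>, \<tau>). ennreal (\<bar>\<tau>\<bar> / 2))) borel (\<lambda>(\<theta>, \<tau>). \<tau> *\<^sub>R \<theta>)"
    (is "_ = ?M")
proof (rule measure_eqI)
  note [measurable] = scaleR_pair_borel
  have [measurable]: "(\<lambda>(\<theta> :: real^2, \<tau>). ennreal (\<bar>\<tau>\<bar> / 2)) \<in> borel_measurable borel"
    unfolding borel_prod[symmetric] by measurable
  fix X :: "(real^2) set" assume "X \<in> sets lborel"
  then have X[measurable]: "X \<in> sets borel" by simp
  have m: "(\<lambda>z. ennreal (\<bar>snd z\<bar> / 2) * indicator X (snd z *\<^sub>R fst z)) \<in> borel_measurable (circle_measure \<Otimes>\<^sub>M lborel)"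
    by measurable
  have "emeasure ?M X = (\<integral>\<^sup>+x. indicator X x \<partial>?M)" by (simp add: nn_integral_indicator)
  also have "\<dots> = (\<integral>\<^sup>+z. ennreal (\<bar>snd z\<bar> / 2) * indicator X (snd z *\<^sub>R fst z) \<partial>cyl_measure)"
    by (subst nn_integral_distr, simp, simp, subst nn_integral_density) (simp_all add: split_beta' borel_measurable_cyl_iff)
  also have "\<dots> = (\<integral>\<^sup>+\<theta>. \<integral>\<^sup>+\<tau>. ennreal (\<bar>\<tau>\<bar> / 2) * indicator X (\<tau> *\<^sub>R \<theta>) \<partial>lborel \<partial>circle_measure)"
    unfolding cyl_measure_def using lborel.nn_integral_fst[OF m] by simp
  also have "\<dots> = (\<integral>\<^sup>+\<theta>. \<integral>\<^sup>+\<tau>. ennreal \<bar>\<tau>\<bar> * (ennreal (1/2) * indicator X (\<tau> *\<^sub>R \<theta>)) \<partial>lborel \<partial>circle_measure)"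
  proof -
    have "ennreal (\<bar>\<tau>\<bar> / 2) = ennreal \<bar>\<tau>\<bar> * ennreal (1/2)" for \<tau> :: real
      by (subst ennreal_mult'[symmetric]) auto
    then show ?thesis by (simp only: mult.assoc)
  qed
  also have "\<dots> = 2 * (\<integral>\<^sup>+x. ennreal (1/2) * indicator X x \<partial>lborel)"
    by (rule nn_integral_polar) measurable
  also have "\<dots> = (2 * ennreal (1/2)) * emeasure lborel X"
    by (simp add: nn_integral_cmult mult.assoc)
  also have "2 * ennreal (1/2) = 1"
    using ennreal_mult'[of 2 "1/2"] by simp
  finally show "emeasure lborel X = emeasure ?M X" by simp
qed simp

lemma integral_polar:
  fixes F :: "real^2 \<Rightarrow> complex"
  assumes F: "integrable lborel F"
  shows "integrable cyl_measure (\<lambda>(\<theta>, \<tau>). of_real \<bar>\<tau>\<bar> * F (\<tau> *\<^sub>R \<theta>))"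
    and "(\<integral>(\<theta>, \<tau>). of_real \<bar>\<tau>\<bar> * F (\<tau> *\<^sub>R \<theta>) \<partial>cyl_measure) = 2 * (\<integral>x. F x \<partial>lborel)"
proof -
  note [measurable] = scaleR_pair_borel borel_measurable_integrable[OF F, simplified]
  have d[measurable]: "(\<lambda>(\<theta> :: real^2, \<tau> :: real). \<bar>\<tau>\<bar> / 2) \<in> borel_measurable borel"
    unfolding borel_prod[symmetric] by measurable
  let ?D = "density cyl_measure (\<lambda>z. ennreal ((\<lambda>(\<theta>, \<tau>). \<bar>\<tau>\<bar> / 2) z))"
  have L: "lborel = distr ?D borel (\<lambda>(\<theta>, \<tau>). \<tau> *\<^sub>R \<theta>)"
    using lborel_polar by (simp add: split_beta')
  have c: "(\<lambda>z. F ((\<lambda>(\<theta>, \<tau>). \<tau> *\<^sub>R \<theta>) z)) \<in> borel_measurable borel" by measurable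
  have i: "integrable ?D (\<lambda>z. F ((\<lambda>(\<theta>, \<tau>). \<tau> *\<^sub>R \<theta>) z))"
    using F by (subst (asm) L, subst (asm) integrable_distr_eq) auto
  then have i': "integrable cyl_measure (\<lambda>z. (\<lambda>(\<theta>, \<tau>). \<bar>\<tau>\<bar> / 2) z *\<^sub>R F ((\<lambda>(\<theta>, \<tau>). \<tau> *\<^sub>R \<theta>) z))"
    by (subst (asm) integrable_density) (auto simp: c borel_measurable_cyl_iff split_beta')
  have eq: "(\<lambda>(\<theta>, \<tau>). of_real \<bar>\<tau>\<bar> * F (\<tau> *\<^sub>R \<theta>)) = (\<lambda>z. 2 * ((\<lambda>(\<theta>, \<tau>). \<bar>\<tau>\<bar> / 2) z *\<^sub>R F ((\<lambda>(\<theta>, \<tau>). \<tau> *\<^sub>R \<theta>) z)))"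
    by (auto simp: fun_eq_iff scaleR_conv_of_real)
  show "integrable cyl_measure (\<lambda>(\<theta>, \<tau>). of_real \<bar>\<tau>\<bar> * F (\<tau> *\<^sub>R \<theta>))"
    unfolding eq by (intro integrable_mult_right i')
  have "(\<integral>x. F x \<partial>lborel) = (\<integral>z. F ((\<lambda>(\<theta>, \<tau>). \<tau> *\<^sub>R \<theta>) z) \<partial>?D)"
    by (subst L, rule integral_distr) auto
  also have "\<dots> = (\<integral>z. (\<lambda>(\<theta>, \<tau>). \<bar>\<tau>\<bar> / 2) z *\<^sub>R F ((\<lambda>(\<theta>, \<tau>). \<tau> *\<^sub>R \<theta>) z) \<partial>cyl_measure)"
    by (rule integral_density) (auto simp: c borel_measurable_cyl_iff split_beta')
  finally show "(\<integral>(\<theta>, \<tau>). of_real \<bar>\<tau>\<bar> * F (\<tau> *\<^sub>R \<theta>) \<partial>cyl_measure) = 2 * (\<integral>x. F x \<partial>lborel)"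
    unfolding eq by (simp only: integral_mult_right_zero)
qed

lemma distr_cyl_measure_uminus: "distr cyl_measure borel uminus = cyl_measure"
proof -
  have "cyl_measure = distr circle_measure borel uminus \<Otimes>\<^sub>M distr lborel borel uminus"
    by (simp add: circle_measure_uminus lborel_distr_uminus cyl_measure_def)
  also have "\<dots> = distr (circle_measure \<Otimes>\<^sub>M lborel) (borel \<Otimes>\<^sub>M borel) (\<lambda>(x, y). (- x, - y))"
    by (rule pair_measure_distr)
      (auto simp: lborel_distr_uminus intro!: sigma_finite_lborel)
  finally show ?thesis by (simp only: cyl_measure_def borel_prod uminus_prod_def[abs_def] split_beta')
qed

lemma borel_measurable_uminus_cont: "(uminus :: 'a::real_normed_vector \<Rightarrow> 'a) \<in> borel_measurable borel"
  by (intro borel_measurable_continuous_onI continuous_intros)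

lemma AE_cyl_uminus: "(AE z in cyl_measure. P z) \<Longrightarrow> AE z in cyl_measure. P (- z)"
  by (rule AE_distrD[of uminus cyl_measure borel])
    (simp_all only: distr_cyl_measure_uminus borel_measurable_cyl_iff borel_measurable_uminus_cont)

lemma AE_cyl_norm: "AE z in cyl_measure. norm (fst z) = 1"
  unfolding cyl_measure_def
proof (rule cylp.AE_pair_measure)
  show "{z \<in> space (circle_measure \<Otimes>\<^sub>M lborel). norm (fst z) = 1} \<in> sets (circle_measure \<Otimes>\<^sub>M lborel)"
    by measurable
qed (use AE_circle_norm in \<open>auto elim: eventually_mono\<close>)

section \<open>The slice theorem and the symmetry of the Radon transform\<close>

lemma radon_eq_rot: "radon f (\<theta>, p) = (\<integral>t. f (rot \<theta> (p, t)) \<partial>lebesgue)"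
  by (simp add: radon_def rot_def)

lemma radon_borel_eq:
  assumes [measurable]: "f \<in> borel_measurable borel"
  shows "radon f (\<theta>, p) = (\<integral>t. f (rot \<theta> (p, t)) \<partial>lborel)"
proof -
  have "(\<lambda>t. rot \<theta> (p, t)) \<in> borel_measurable borel"
    unfolding rot_def by (intro borel_measurable_continuous_onI continuous_intros)
  then show ?thesis unfolding radon_eq_rot by (intro integral_completion) simp
qed

lemma continuous_on_perp: "continuous_on S g \<Longrightarrow> continuous_on S (\<lambda>x. perp (g x))"
proof -
  have "perp x = vec2 (- x $ 2, x $ 1)" for x by (simp add: vec2_eq_iff)
  then show "continuous_on S g \<Longrightarrow> ?thesis" by (simp add: vec2_eq continuous_intros)
qed

lemma radon_borel[measurable]:
  assumes [measurable]: "f \<in> borel_measurable borel"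
  shows "radon f \<in> borel_measurable borel"
proof -
  have "(\<lambda>(z, t). rot (fst z) (snd z, t)) \<in> borel_measurable (borel :: (((real^2) \<times> real) \<times> real) measure)"
    unfolding rot_def split_beta'
    by (intro borel_measurable_continuous_onI continuous_intros continuous_on_perp) 
  then have "(\<lambda>(z, t). f (rot (fst z) (snd z, t))) \<in> borel_measurable (borel \<Otimes>\<^sub>M lborel)"
    using measurable_compose[OF _ assms]
    by (subst measurable_cong_sets[of "borel \<Otimes>\<^sub>M lborel" borel borel borel])
      (auto simp: split_beta' borel_prod[symmetric] intro!: sets_pair_measure_cong)
  then have "(\<lambda>z. \<integral>t. f (rot (fst z) (snd z, t)) \<partial>lborel) \<in> borel_measurable borel"
    using sigma_finite_measure.borel_measurable_lebesgue_integral[OF sigma_finite_lborel] by fast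
  moreover have "(\<lambda>z. \<integral>t. f (rot (fst z) (snd z, t)) \<partial>lborel) = radon f"
    using radon_borel_eq[OF assms] by auto
  ultimately show ?thesis by simp
qed

lemma rot_integrable:
  fixes f :: "real^2 \<Rightarrow> complex"
  assumes f: "integrable lborel f" and "norm \<theta> = 1"
  shows "integrable (lborel \<Otimes>\<^sub>M lborel) (\<lambda>(p, t). f (rot \<theta> (p, t)))"
proof -
  have "integrable (distr lborel borel (rot \<theta>)) f"
    by (simp add: lborel_rot assms)
  then have "integrable lborel (\<lambda>z. f (rot \<theta> z))"
    by (subst (asm) integrable_distr_eq) (use f in auto)
  then show ?thesis by (simp add: lborel_prod case_prod_unfold)
qed

text \<open>In rotated coordinates a plane integral splits into the offset and the position along
  the line, and the exponential depends on the offset only. The third claim is a contraction of L1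
  norms, uniform in \<theta>; with the finite length of the circle it makes the Radon transform
  integrable on the cylinder.\<close>

lemma radon_slice:
  fixes f :: "real^2 \<Rightarrow> complex"
  assumes f: "integrable lborel f" and \<theta>: "norm \<theta> = 1"
  shows "integrable lborel (\<lambda>p. radon f (\<theta>, p))"
    and "(\<integral>p. radon f (\<theta>, p) * cis (- (\<tau> * p)) \<partial>lborel) = ft f (\<tau> *\<^sub>R \<theta>)"
    and "(\<integral>p. norm (radon f (\<theta>, p)) \<partial>lborel) \<le> (\<integral>x. norm (f x) \<partial>lborel)"
proof -
  have fb[measurable]: "f \<in> borel_measurable borel" using f by auto
  note r = rot_integrable[OF f \<theta>]
  show i: "integrable lborel (\<lambda>p. radon f (\<theta>, p))"
    unfolding radon_borel_eq[OF fb] by (rule lborel_pair.integrable_fst[OF r])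
  let ?g = "\<lambda>x. f x * cis (- (x \<bullet> (\<tau> *\<^sub>R \<theta>)))"
  have g: "integrable lborel ?g" by (intro integrable_mult_cis f) measurable
  have "(\<integral>p. radon f (\<theta>, p) * cis (- (\<tau> * p)) \<partial>lborel)
      = (\<integral>p. \<integral>t. ?g (rot \<theta> (p, t)) \<partial>lborel \<partial>lborel)"
    unfolding radon_borel_eq[OF fb] by (simp add: inner_rot[OF \<theta>])
  also have "\<dots> = (\<integral>z. ?g (rot \<theta> z) \<partial>lborel)"
    using lborel_pair.integral_fst[OF rot_integrable[OF g \<theta>]] by (simp add: lborel_prod case_prod_unfold)
  also have "\<dots> = (\<integral>x. ?g x \<partial>distr lborel borel (rot \<theta>))"
    by (rule integral_distr[symmetric]) measurable
  finally show "(\<integral>p. radon f (\<theta>, p) * cis (- (\<tau> * p)) \<partial>lborel) = ft f (\<tau> *\<^sub>R \<theta>)"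
    by (simp add: lborel_rot[OF \<theta>] ft_def)
  have n: "integrable lborel (\<lambda>x. of_real (norm (f x)) :: complex)" using f by simp
  have rn: "integrable (lborel \<Otimes>\<^sub>M lborel) (\<lambda>(p, t). norm (f (rot \<theta> (p, t))))"
    using integrable_norm[OF r] by (simp add: case_prod_unfold)
  have "(\<integral>p. norm (radon f (\<theta>, p)) \<partial>lborel) \<le> (\<integral>p. \<integral>t. norm (f (rot \<theta> (p, t))) \<partial>lborel \<partial>lborel)"
    by (rule integral_mono) (use i lborel_pair.integrable_fst[OF rn] in \<open>auto simp: radon_borel_eq[OF fb]\<close>)
  also have "\<dots> = (\<integral>z. norm (f (rot \<theta> z)) \<partial>lborel)"
    using lborel_pair.integral_fst[OF rn] by (simp add: lborel_prod case_prod_unfold)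
  also have "\<dots> = (\<integral>x. norm (f x) \<partial>distr lborel borel (rot \<theta>))"
    by (rule integral_distr[symmetric]) measurable
  finally show "(\<integral>p. norm (radon f (\<theta>, p)) \<partial>lborel) \<le> (\<integral>x. norm (f x) \<partial>lborel)"
    by (simp add: lborel_rot[OF \<theta>])
qed

lemma integrable_radon:
  assumes f: "integrable lborel f"
  shows "integrable cyl_measure (radon f)"
  unfolding cyl_measure_def
proof (rule cylp.Fubini_integrable)
  have fb[measurable]: "f \<in> borel_measurable borel" using f by auto
  show m: "radon f \<in> borel_measurable (circle_measure \<Otimes>\<^sub>M lborel)"
    by (intro borel_measurable_pairI radon_borel fb)
  show "integrable circle_measure (\<lambda>\<theta>. \<integral>p. norm (radon f (\<theta>, p)) \<partial>lborel)"
  proof (rule circle.integrable_const_bound[where B="\<integral>x. norm (f x) \<partial>lborel"])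
    show "AE \<theta> in circle_measure. norm (\<integral>p. norm (radon f (\<theta>, p)) \<partial>lborel) \<le> (\<integral>x. norm (f x) \<partial>lborel)"
      using AE_circle_norm by eventually_elim (simp add: radon_slice[OF f])
    have [measurable]: "(\<lambda>(\<theta>, p). norm (radon f (\<theta>, p))) \<in> borel_measurable (circle_measure \<Otimes>\<^sub>M lborel)"
      using m by (simp add: case_prod_unfold)
    show "(\<lambda>\<theta>. \<integral>p. norm (radon f (\<theta>, p)) \<partial>lborel) \<in> borel_measurable circle_measure"
      by measurable
  qed
  show "AE \<theta> in circle_measure. integrable lborel (\<lambda>p. radon f (\<theta>, p))"
    using AE_circle_norm by eventually_elim (rule radon_slice[OF f])
qed

text \<open>(-\<theta>, -p) describes the same line, run through backwards.\<close>

lemma radon_uminus: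
  assumes [measurable]: "f \<in> borel_measurable borel"
  shows "radon f (- z) = radon f z"
proof (cases z)
  case (Pair \<theta> p)
  have [measurable]: "(\<lambda>t. rot \<theta> (p, t)) \<in> borel_measurable borel" for \<theta> p
    unfolding rot_def by (intro borel_measurable_continuous_onI continuous_intros)
  have "radon f (- \<theta>, - p) = (\<integral>t. f (rot \<theta> (p, 0 + (-1) * t)) \<partial>lborel)"
    by (simp add: radon_borel_eq rot_def perp_minus)
  also have "\<dots> = (\<integral>t. f (rot \<theta> (p, t)) \<partial>lborel)"
    by (subst (2) lborel_integral_real_affine[where c="-1" and t=0]) auto
  finally show ?thesis by (simp add: Pair radon_borel_eq)
qed


section \<open>Filtered backprojection\<close>

abbreviation modulate :: "('a::euclidean_space \<Rightarrow> complex) \<Rightarrow> 'a \<Rightarrow> 'a \<Rightarrow> complex" where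
  "modulate \<psi> \<xi> \<equiv> \<lambda>x. \<psi> x * cis (- (x \<bullet> \<xi>))"

lemma test_fun_mult_cis: "test_fun \<psi> \<Longrightarrow> test_fun (modulate \<psi> \<xi>)"
  by (rule test_fun_mult[OF _ smooth_cis])

text \<open>Peetre's inequality with exponent one. It moves polynomial weights from a shifted
  frequency to the shift.\<close>

lemma peetre: "1 + norm a \<le> (1 + norm (a + b)) * (1 + norm (b :: 'a::real_normed_vector))"
proof -
  have "norm a \<le> norm (a + b) + norm b"
    using norm_triangle_ineq4[of "a + b" b] by simp
  moreover have "0 \<le> norm (a + b) * norm b" by simp
  moreover have "(1 + norm (a + b)) * (1 + norm b) = 1 + norm (a + b) + norm b + norm (a + b) * norm b"
    by (simp add: algebra_simps)
  ultimately show ?thesis by linarith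
qed

lemma abs_cube_le: "\<bar>\<tau>\<bar> * (1 + \<tau>\<^sup>2) \<le> (1 + \<bar>\<tau> :: real\<bar>) ^ 3"
proof -
  have "(1 + \<bar>\<tau>\<bar>) ^ 3 = 1 + 3 * \<bar>\<tau>\<bar> + 3 * \<bar>\<tau>\<bar>\<^sup>2 + \<bar>\<tau>\<bar> * \<bar>\<tau>\<bar>\<^sup>2"
    by (simp add: power3_eq_cube power2_eq_square algebra_simps)
  then show ?thesis by (simp add: algebra_simps)
qed

text \<open>Of the three powers one pays for the factor \<open>\<bar>\<tau>\<bar>\<close> and two
  for the integrable majorant \<open>1 / (1 + \<tau>\<^sup>2)\<close>. By \<open>peetre\<close> the
  shift by \<xi> costs the same power of \<open>1 + norm \<xi>\<close>.\<close>

lemma abs_ft_bound: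
  fixes F :: "real^2 \<Rightarrow> complex"
  assumes F: "\<And>\<eta>. norm (F \<eta>) \<le> C / (1 + norm \<eta>) ^ 3" and \<theta>: "norm \<theta> = 1"
  shows "\<bar>\<tau>\<bar> * norm (F (\<tau> *\<^sub>R \<theta> + \<xi>)) \<le> C * (1 + norm \<xi>) ^ 3 * (1 / (1 + \<tau>\<^sup>2))"
proof -
  let ?X = "1 + norm (\<tau> *\<^sub>R \<theta> + \<xi>)" and ?Y = "1 + norm \<xi>"
  have C: "C \<ge> 0" using order_trans[OF norm_ge_zero F[of 0]] by simp
  have X: "?X > 0" by (simp add: add_pos_nonneg)
  have t: "0 < 1 + \<tau>\<^sup>2" by (simp add: add_pos_nonneg)
  have "1 + \<bar>\<tau>\<bar> \<le> ?X * ?Y"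
    using peetre[of "\<tau> *\<^sub>R \<theta>" \<xi>] \<theta> by simp
  then have "(1 + \<bar>\<tau>\<bar>) ^ 3 \<le> (?X * ?Y) ^ 3" by (intro power_mono) auto
  with abs_cube_le[of \<tau>] have "\<bar>\<tau>\<bar> * (1 + \<tau>\<^sup>2) \<le> ?X ^ 3 * ?Y ^ 3"
    by (simp only: power_mult_distrib)
  then have "\<bar>\<tau>\<bar> / ?X ^ 3 \<le> ?Y ^ 3 / (1 + \<tau>\<^sup>2)"
    using X t by (simp add: field_simps)
  then have "C * (\<bar>\<tau>\<bar> / ?X ^ 3) \<le> C * (?Y ^ 3 / (1 + \<tau>\<^sup>2))"
    using C by (rule mult_left_mono)
  moreover have "\<bar>\<tau>\<bar> * norm (F (\<tau> *\<^sub>R \<theta> + \<xi>)) \<le> \<bar>\<tau>\<bar> * (C / ?X ^ 3)"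
    by (intro mult_left_mono F) auto
  ultimately show ?thesis by (simp add: mult_ac)
qed

lemma abs_ft_integrable:
  fixes \<phi> :: "real^2 \<Rightarrow> complex"
  assumes \<phi>: "test_fun \<phi>" and \<theta>: "norm \<theta> = 1"
  shows "integrable lborel (\<lambda>\<tau>. of_real \<bar>\<tau>\<bar> * ft \<phi> (\<tau> *\<^sub>R \<theta>))"
proof -
  obtain C where C: "\<And>\<eta>. norm (ft \<phi> \<eta>) \<le> C / (1 + norm \<eta>) ^ 3"
    using test_fun_ft_decay[OF \<phi>] by blast
  have [measurable]: "\<phi> \<in> borel_measurable borel" by (rule test_fun_borel[OF \<phi>])
  show ?thesis
  proof (rule Bochner_Integration.integrable_bound)
    show "integrable lborel (\<lambda>\<tau>::real. C * (1 / (1 + \<tau>\<^sup>2)))"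
      by (intro integrable_mult_right integrable_inverse_1_plus_square)
    show "AE \<tau> in lborel. norm (of_real \<bar>\<tau>\<bar> * ft \<phi> (\<tau> *\<^sub>R \<theta>)) \<le> norm (C * (1 / (1 + \<tau>\<^sup>2)))"
    proof (rule AE_I2)
      fix \<tau>
      show "norm (of_real \<bar>\<tau>\<bar> * ft \<phi> (\<tau> *\<^sub>R \<theta>)) \<le> norm (C * (1 / (1 + \<tau>\<^sup>2)))"
      proof -
        have "\<bar>\<tau>\<bar> * norm (ft \<phi> (\<tau> *\<^sub>R \<theta>)) \<le> C * (1 / (1 + \<tau>\<^sup>2))"
          using abs_ft_bound[OF C \<theta>, of \<tau> 0] by simp
        from order_trans[OF this abs_ge_self] show ?thesis
          by (simp only: norm_mult norm_of_real abs_idempotent real_norm_def)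
      qed
    qed
  qed measurable
qed

text \<open>This is the filter applied to the Radon transform of \<open>\<phi>\<close>, with the
  transform in p already replaced by a slice of the plane transform. The constant is
  \<open>4 * pi\<close> from the filter times \<open>2 * pi\<close> from the inverse
  transform.\<close>

definition fbp_kernel :: "(real^2 \<Rightarrow> complex) \<Rightarrow> (real^2) \<times> real \<Rightarrow> complex" where
  "fbp_kernel \<phi> z = (\<integral>\<tau>. of_real \<bar>\<tau>\<bar> * ft \<phi> (\<tau> *\<^sub>R fst z) * cis (\<tau> * snd z) \<partial>lborel) / (8 * pi\<^sup>2)"

lemma fbp_kernel_borel[measurable]:
  assumes [measurable]: "\<phi> \<in> borel_measurable borel"
  shows "fbp_kernel \<phi> \<in> borel_measurable borel"
  unfolding fbp_kernel_def by measurable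

lemma fourier_p_radon:
  assumes \<phi>: "integrable lborel \<phi>" and \<theta>: "norm \<theta> = 1"
  shows "fourier_p (radon \<phi>) (\<theta>, \<tau>) = ft \<phi> (\<tau> *\<^sub>R \<theta>)"
proof -
  have "(\<lambda>p. radon \<phi> (\<theta>, p) * cis (- (\<tau> * p))) \<in> borel_measurable borel"
    using radon_slice(1)[OF \<phi> \<theta>] by measurable
  then show ?thesis
    unfolding fourier_p_def prod.case radon_slice(2)[OF \<phi> \<theta>, symmetric]
    by (intro integral_completion) simp
qed

lemma fbp_filter_radon:
  assumes \<phi>: "test_fun \<phi>" and \<theta>: "norm \<theta> = 1"
  shows "fbp_filter (radon \<phi>) (\<theta>, p) = fbp_kernel \<phi> (\<theta>, p)"
proof -
  have [measurable]: "\<phi> \<in> borel_measurable borel" by (rule test_fun_borel[OF \<phi>])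
  have "fbp_filter (radon \<phi>) (\<theta>, p)
      = (\<integral>\<tau>. of_real (\<bar>\<tau>\<bar> / (4 * pi)) * ft \<phi> (\<tau> *\<^sub>R \<theta>) * cis (\<tau> * p) \<partial>lebesgue) / (2 * pi)"
    by (simp add: fbp_filter_def inv_fourier_p_def fourier_p_radon[OF test_fun_integrable[OF \<phi>] \<theta>])
  also have "(\<integral>\<tau>. of_real (\<bar>\<tau>\<bar> / (4 * pi)) * ft \<phi> (\<tau> *\<^sub>R \<theta>) * cis (\<tau> * p) \<partial>lebesgue)
      = (\<integral>\<tau>. of_real (\<bar>\<tau>\<bar> / (4 * pi)) * ft \<phi> (\<tau> *\<^sub>R \<theta>) * cis (\<tau> * p) \<partial>lborel)"
    by (rule integral_completion) measurable
  also have "\<dots> = (\<integral>\<tau>. of_real \<bar>\<tau>\<bar> * ft \<phi> (\<tau> *\<^sub>R \<theta>) * cis (\<tau> * p) / of_real (4 * pi) \<partial>lborel)"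
    by (rule Bochner_Integration.integral_cong) auto
  also have "\<dots> = (\<integral>\<tau>. of_real \<bar>\<tau>\<bar> * ft \<phi> (\<tau> *\<^sub>R \<theta>) * cis (\<tau> * p) \<partial>lborel) / of_real (4 * pi)"
    by (rule integral_divide_zero)
  finally show ?thesis by (simp add: fbp_kernel_def power2_eq_square)
qed

lemma norm_fbp_kernel_le:
  assumes "norm \<theta> = 1" "\<And>\<tau>. norm (of_real \<bar>\<tau>\<bar> * ft \<phi> (\<tau> *\<^sub>R \<theta>)) \<le> B * (1 / (1 + \<tau>\<^sup>2))"
    and [measurable]: "\<phi> \<in> borel_measurable borel"
  shows "norm (fbp_kernel \<phi> (\<theta>, p)) \<le> B * (\<integral>\<tau>. 1 / (1 + \<tau>\<^sup>2) \<partial>lborel)"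
proof -
  have B: "B \<ge> 0" using assms(2)[of 0] by simp
  let ?I = "\<integral>\<tau>. of_real \<bar>\<tau>\<bar> * ft \<phi> (\<tau> *\<^sub>R \<theta>) * cis (\<tau> * p) \<partial>lborel"
  have "norm ?I \<le> (\<integral>\<tau>. B * (1 / (1 + \<tau>\<^sup>2)) \<partial>lborel)"
  proof (rule order_trans[OF integral_norm_bound integral_mono])
    show i: "integrable lborel (\<lambda>\<tau>::real. B * (1 / (1 + \<tau>\<^sup>2)))"
      by (intro integrable_mult_right integrable_inverse_1_plus_square)
    show b: "norm (of_real \<bar>\<tau>\<bar> * ft \<phi> (\<tau> *\<^sub>R \<theta>) * cis (\<tau> * p)) \<le> B * (1 / (1 + \<tau>\<^sup>2))" for \<tau>
      using assms(2)[of \<tau>] by (simp add: norm_mult)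
    show "integrable lborel (\<lambda>\<tau>. norm (of_real \<bar>\<tau>\<bar> * ft \<phi> (\<tau> *\<^sub>R \<theta>) * cis (\<tau> * p)))"
      by (rule Bochner_Integration.integrable_bound[OF i]) (use b order_trans[OF b abs_ge_self] in auto)
  qed
  then have "norm ?I \<le> B * (\<integral>\<tau>. 1 / (1 + \<tau>\<^sup>2) \<partial>lborel)" by (simp only: integral_mult_right_zero)
  moreover have "norm (fbp_kernel \<phi> (\<theta>, p)) \<le> norm ?I"
  proof -
    have "8 * pi\<^sup>2 \<ge> 1" using mult_mono[of 1 pi 1 pi] pi_gt3 by (simp add: power2_eq_square)
    then have "norm ?I / (8 * pi\<^sup>2) \<le> norm ?I / 1" by (intro divide_left_mono) auto
    then show ?thesis by (simp add: fbp_kernel_def norm_divide norm_mult norm_power)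
  qed
  ultimately show ?thesis by linarith
qed

text \<open>The bound is uniform in (\<theta>, p), so the kernel can be paired with integrable data.
  Its growth in \<xi> is the a priori bound for frequencies where no decay is known.\<close>

lemma fbp_kernel_bound:
  assumes \<psi>: "test_fun \<psi>"
  shows "\<exists>C\<ge>0. \<forall>\<xi> \<theta> p. norm \<theta> = 1 \<longrightarrow> norm (fbp_kernel (modulate \<psi> \<xi>) (\<theta>, p)) \<le> C * (1 + norm \<xi>) ^ 3"
proof -
  obtain C where C: "C \<ge> 0" "\<And>\<eta>. norm (ft \<psi> \<eta>) \<le> C / (1 + norm \<eta>) ^ 3"
    using test_fun_ft_decay[OF \<psi>] by blast
  let ?J = "\<integral>\<tau>. 1 / (1 + \<tau>\<^sup>2) \<partial>(lborel :: real measure)"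
  have J: "?J \<ge> 0" by (intro Bochner_Integration.integral_nonneg) (auto simp: add_nonneg_nonneg)
  have "norm (fbp_kernel (modulate \<psi> \<xi>) (\<theta>, p)) \<le> C * (1 + norm \<xi>) ^ 3 * ?J" if "norm \<theta> = 1" for \<xi> \<theta> p
    by (rule norm_fbp_kernel_le[OF that])
      (use abs_ft_bound[OF C(2) that] test_fun_borel[OF test_fun_mult_cis[OF \<psi>]] in
        \<open>auto simp: ft_mult_cis norm_mult\<close>)
  then show ?thesis using C(1) J by (intro exI[of _ "C * ?J"]) (auto simp: mult_ac)
qed

section \<open>Pairing the kernel with integrable data\<close>

lemma integrable_fbp_pairing:
  assumes g: "integrable cyl_measure g" and \<phi>: "test_fun \<phi>"
  shows "integrable cyl_measure (\<lambda>z. g z * fbp_kernel \<phi> z)"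
proof -
  obtain C where C: "C \<ge> 0" "\<And>\<theta> p. norm \<theta> = 1 \<Longrightarrow> norm (fbp_kernel \<phi> (\<theta>, p)) \<le> C"
    using fbp_kernel_bound[OF \<phi>] by (metis (no_types, lifting) cis_zero inner_zero_right minus_zero mult.right_neutral norm_zero power_one add.right_neutral ext)
  have m: "fbp_kernel \<phi> \<in> borel_measurable cyl_measure"
    unfolding borel_measurable_cyl_iff by (rule fbp_kernel_borel[OF test_fun_borel[OF \<phi>]])
  show ?thesis
  proof (rule Bochner_Integration.integrable_bound)
    show "integrable cyl_measure (\<lambda>z. C * norm (g z))" using g by simp
    show "AE z in cyl_measure. norm (g z * fbp_kernel \<phi> z) \<le> norm (C * norm (g z))"
      using AE_cyl_norm
    proof eventually_elim
      case (elim z)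
      then have "norm (fbp_kernel \<phi> z) \<le> C" using C(2)[of "fst z" "snd z"] by simp
      then have "norm (g z) * norm (fbp_kernel \<phi> z) \<le> norm (g z) * C" by (intro mult_left_mono) auto
      then show ?case using C(1) by (simp add: norm_mult mult.commute)
    qed
  qed (use m g in auto)
qed

lemma integral_circle:
  fixes J :: "real^2 \<Rightarrow> complex"
  assumes [measurable]: "J \<in> borel_measurable borel"
  shows "(\<integral>\<theta>. J \<theta> \<partial>circle_measure) = (\<integral>s. indicator {0..2*pi} s *\<^sub>R J (circ s) \<partial>lborel)"
  unfolding circle_measure_def
  by (subst integral_distr) (auto simp: integral_restrict_space intro!: measurable_restrict_space1)

text \<open>The bridge from the iterated Lebesgue integral over the parameter interval to the Borel
  product measure. Equality is asked for at the points \<open>(circ s, p)\<close>, which is where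
  \<open>fbp_filter_radon\<close> identifies the filtered test function with the kernel.\<close>

lemma cyl_dist_of_eq_integral:
  assumes H: "integrable cyl_measure H" and eq: "\<And>s p. g (circ s, p) * h (circ s, p) = H (circ s, p)"
  shows "cyl_dist_of g h = (\<integral>z. H z \<partial>cyl_measure)"
proof -
  have Hb[measurable]: "H \<in> borel_measurable borel"
    using borel_measurable_integrable[OF H] by (simp add: borel_measurable_cyl_iff)
  let ?J = "\<lambda>\<theta>. \<integral>p. H (\<theta>, p) \<partial>lborel"
  have inner: "(\<integral>p. g (circ s, p) * h (circ s, p) \<partial>lebesgue) = ?J (circ s)" for s
    unfolding eq by (rule integral_completion) measurable
  have J[measurable]: "?J \<in> borel_measurable borel" by measurable
  have "cyl_dist_of g h = (\<integral>s. indicator {0..2*pi} s *\<^sub>R ?J (circ s) \<partial>lebesgue)"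
    unfolding cyl_dist_of_def inner set_lebesgue_integral_def ..
  also have "\<dots> = (\<integral>s. indicator {0..2*pi} s *\<^sub>R ?J (circ s) \<partial>lborel)"
    by (rule integral_completion) measurable
  also have "\<dots> = (\<integral>\<theta>. ?J \<theta> \<partial>circle_measure)"
    by (rule integral_circle[symmetric]) (rule J)
  also have "\<dots> = (\<integral>z. H z \<partial>cyl_measure)"
    unfolding cyl_measure_def
    by (rule cylp.integral_fst') (use H in \<open>simp add: cyl_measure_def\<close>)
  finally show ?thesis .
qed

text \<open>Arbitrary data are allowed, with the filter moved to the test function. Since the
  expression is linear in g, the data of two distributions can be subtracted.\<close>

definition fbp :: "((real^2) \<times> real \<Rightarrow> complex) \<Rightarrow> (real^2) distribution" where
  "fbp g \<phi> = (\<integral>z. g z * fbp_kernel \<phi> z \<partial>cyl_measure)"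

lemma integrable_indicator_radon:
  assumes "integrable lborel f" "A \<in> sets borel"
  shows "integrable cyl_measure (\<lambda>z. indicator A z * radon f z)"
proof -
  have "integrable cyl_measure (\<lambda>z. indicator A z *\<^sub>R radon f z)"
    by (rule integrable_mult_indicator) (use assms integrable_radon in auto)
  moreover have "indicator A z *\<^sub>R radon f z = indicator A z * radon f z" for z
    by (simp add: indicator_def)
  ultimately show ?thesis by simp
qed

lemma recon_eq_fbp:
  assumes f: "integrable lborel f" and A: "A \<in> sets borel" and \<phi>: "test_fun \<phi>"
  shows "recon A f \<phi> = fbp (\<lambda>z. indicator A z * radon f z) \<phi>"
  unfolding recon_def backprojection_def dist_fbp_filter_def fbp_def
  by (rule cyl_dist_of_eq_integral)
    (use integrable_fbp_pairing[OF integrable_indicator_radon[OF f A] \<phi>] fbp_filter_radon[OF \<phi>] in auto)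

text \<open>Parity decides the pairing: integrating \<open>radon f\<close> against
  \<open>cis (\<tau> * p)\<close> gives \<open>ft f\<close> at the opposite frequency, so the
  integrand in frequency is \<open>ft \<phi> \<eta> * ft f (- \<eta>)\<close>. Inversion is then
  applied to \<open>\<phi>\<close>, whose transform is integrable, and not to
  \<open>f\<close>.\<close>

theorem fbp_radon:
  assumes f: "integrable lborel f" and \<phi>: "test_fun \<phi>"
  shows "fbp (radon f) \<phi> = (\<integral>x. f x * \<phi> x \<partial>lborel)"
proof -
  note i\<phi> = test_fun_integrable[OF \<phi>]
  note [measurable] = test_fun_borel[OF \<phi>] borel_measurable_integrable[OF f, simplified]
  obtain C where C: "C \<ge> 0" "\<And>\<eta>. norm (ft \<phi> \<eta>) \<le> C / (1 + norm \<eta>) ^ (2 * DIM(real^2))"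
    using test_fun_ft_decay[OF \<phi>] by blast
  have iF: "integrable lborel (ft \<phi>)"
  proof (rule Bochner_Integration.integrable_bound[OF integrable_mult_right[OF integrable_inverse_power_norm, of C]])
    show "AE \<eta> in lborel. norm (ft \<phi> \<eta>) \<le> norm (C * (1 / (1 + norm \<eta>) ^ (2 * DIM(real^2))))"
      using C by simp
  qed measurable
  have iFf: "integrable lborel (\<lambda>\<eta>. ft \<phi> \<eta> * ft f (- \<eta>))"
  proof (rule Bochner_Integration.integrable_bound[OF integrable_mult_right[OF integrable_norm[OF iF], of "\<integral>x. norm (f x) \<partial>lborel"]])
    show "AE \<eta> in lborel. norm (ft \<phi> \<eta> * ft f (- \<eta>)) \<le> norm ((\<integral>x. norm (f x) \<partial>lborel) * norm (ft \<phi> \<eta>))"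
      using norm_ft_le[OF f] by (intro AE_I2) (simp add: norm_mult mult.commute mult_left_mono)
  qed measurable
  have "fbp (radon f) \<phi> = (\<integral>\<theta>. \<integral>p. radon f (\<theta>, p) * fbp_kernel \<phi> (\<theta>, p) \<partial>lborel \<partial>circle_measure)"
    unfolding fbp_def cyl_measure_def
    by (rule cylp.integral_fst'[symmetric])
      (use integrable_fbp_pairing[OF integrable_radon[OF f] \<phi>] in \<open>simp add: cyl_measure_def\<close>)
  also have "\<dots> = (\<integral>\<theta>. (\<integral>\<tau>. of_real \<bar>\<tau>\<bar> * (ft \<phi> (\<tau> *\<^sub>R \<theta>) * ft f (- (\<tau> *\<^sub>R \<theta>))) \<partial>lborel) / (8 * pi\<^sup>2) \<partial>circle_measure)"
  proof (rule integral_cong_AE)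
    show "AE \<theta> in circle_measure. (\<integral>p. radon f (\<theta>, p) * fbp_kernel \<phi> (\<theta>, p) \<partial>lborel)
      = (\<integral>\<tau>. of_real \<bar>\<tau>\<bar> * (ft \<phi> (\<tau> *\<^sub>R \<theta>) * ft f (- (\<tau> *\<^sub>R \<theta>))) \<partial>lborel) / (8 * pi\<^sup>2)"
      using AE_circle_norm
    proof eventually_elim
      case (elim \<theta>)
      note r = radon_slice[OF f elim]
      let ?h = "\<lambda>\<tau>. of_real \<bar>\<tau>\<bar> * ft \<phi> (\<tau> *\<^sub>R \<theta>)"
      have "(\<integral>p. radon f (\<theta>, p) * fbp_kernel \<phi> (\<theta>, p) \<partial>lborel)
          = (\<integral>p. (\<integral>\<tau>. radon f (\<theta>, p) * (?h \<tau> * cis (\<tau> * p)) \<partial>lborel) / (8 * pi\<^sup>2) \<partial>lborel)"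
        by (simp add: fbp_kernel_def)
      also have "\<dots> = (\<integral>p. \<integral>\<tau>. radon f (\<theta>, p) * (?h \<tau> * cis (\<tau> * p)) \<partial>lborel \<partial>lborel) / (8 * pi\<^sup>2)"
        by (rule integral_divide_zero)
      also have "(\<integral>p. \<integral>\<tau>. radon f (\<theta>, p) * (?h \<tau> * cis (\<tau> * p)) \<partial>lborel \<partial>lborel)
          = (\<integral>\<tau>. \<integral>p. radon f (\<theta>, p) * (?h \<tau> * cis (\<tau> * p)) \<partial>lborel \<partial>lborel)"
      proof (rule lborel_pair.Fubini_integral[symmetric])
        have "integrable (lborel \<Otimes>\<^sub>M lborel) (\<lambda>(p, \<tau>). radon f (\<theta>, p) * ?h \<tau>)"
          by (intro lborel_pair.integrable_pair_mult r(1) abs_ft_integrable \<phi> elim)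
        moreover have "(\<lambda>(p, \<tau>). cis (\<tau> * p)) \<in> borel_measurable (lborel \<Otimes>\<^sub>M (lborel :: real measure))"
          by measurable
        ultimately have "integrable (lborel \<Otimes>\<^sub>M lborel) (\<lambda>(p, \<tau>). radon f (\<theta>, p) * ?h \<tau> * cis (\<tau> * p))"
          using integrable_mult_cis[of "lborel \<Otimes>\<^sub>M lborel" "\<lambda>(p, \<tau>). radon f (\<theta>, p) * ?h \<tau>" "\<lambda>(p, \<tau>). \<tau> * p"]
          by (simp add: case_prod_unfold)
        then show "integrable (lborel \<Otimes>\<^sub>M lborel) (\<lambda>(p, \<tau>). radon f (\<theta>, p) * (?h \<tau> * cis (\<tau> * p)))"
          by (simp add: mult.assoc)
      qed
      also have "\<dots> = (\<integral>\<tau>. ?h \<tau> * (\<integral>p. radon f (\<theta>, p) * cis (- ((- \<tau>) * p)) \<partial>lborel) \<partial>lborel)"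
        by (simp add: mult.left_commute[of "radon f _"])
      also have "\<dots> = (\<integral>\<tau>. of_real \<bar>\<tau>\<bar> * (ft \<phi> (\<tau> *\<^sub>R \<theta>) * ft f (- (\<tau> *\<^sub>R \<theta>))) \<partial>lborel)"
        by (subst r(2)) (simp add: mult.assoc)
      finally show ?case .
    qed
    have k[measurable]: "(\<lambda>z. radon f z * fbp_kernel \<phi> z) \<in> borel_measurable borel" by measurable
    have "(\<lambda>\<theta>. \<integral>p. (\<lambda>z. radon f z * fbp_kernel \<phi> z) (\<theta>, p) \<partial>lborel) \<in> borel_measurable borel"
      by measurable
    then show "(\<lambda>\<theta>. \<integral>p. radon f (\<theta>, p) * fbp_kernel \<phi> (\<theta>, p) \<partial>lborel) \<in> borel_measurable circle_measure"
      by simp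
    show "(\<lambda>\<theta>. (\<integral>\<tau>. of_real \<bar>\<tau>\<bar> * (ft \<phi> (\<tau> *\<^sub>R \<theta>) * ft f (- (\<tau> *\<^sub>R \<theta>))) \<partial>lborel) / (8 * pi\<^sup>2)) \<in> borel_measurable circle_measure"
      by measurable
  qed
  also have "\<dots> = (\<integral>\<theta>. \<integral>\<tau>. of_real \<bar>\<tau>\<bar> * (ft \<phi> (\<tau> *\<^sub>R \<theta>) * ft f (- (\<tau> *\<^sub>R \<theta>))) \<partial>lborel \<partial>circle_measure) / (8 * pi\<^sup>2)"
    by (rule integral_divide_zero)
  also have "\<dots> = (\<integral>(\<theta>, \<tau>). of_real \<bar>\<tau>\<bar> * (ft \<phi> (\<tau> *\<^sub>R \<theta>) * ft f (- (\<tau> *\<^sub>R \<theta>))) \<partial>cyl_measure) / (8 * pi\<^sup>2)"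
    unfolding cyl_measure_def
    by (subst cylp.integral_fst[symmetric])
      (use integral_polar(1)[OF iFf] in \<open>simp_all add: cyl_measure_def\<close>)
  \<comment> \<open>The 2 is the double covering by signed polar coordinates. Together with the
    \<open>(2 * pi)\<^sup>2\<close> of planar inversion it cancels
    \<open>8 * pi\<^sup>2\<close>.\<close>
  also have "\<dots> = 2 * (\<integral>\<eta>. ft \<phi> \<eta> * ft f (- \<eta>) \<partial>lborel) / (8 * pi\<^sup>2)"
    by (subst integral_polar(2)[OF iFf]) simp
  also have "(\<integral>\<eta>. ft \<phi> \<eta> * ft f (- \<eta>) \<partial>lborel) = (\<integral>\<eta>. \<integral>x. f x * (ft \<phi> \<eta> * cis (x \<bullet> \<eta>)) \<partial>lborel \<partial>lborel)"
  proof -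
    have "ft \<phi> \<eta> * ft f (- \<eta>) = (\<integral>x. f x * (ft \<phi> \<eta> * cis (x \<bullet> \<eta>)) \<partial>lborel)" for \<eta>
      unfolding ft_def[of f] by (subst integral_mult_right_zero[symmetric]) (simp add: mult.left_commute)
    then show ?thesis by simp
  qed
  also have "\<dots> = (\<integral>x. \<integral>\<eta>. f x * (ft \<phi> \<eta> * cis (x \<bullet> \<eta>)) \<partial>lborel \<partial>lborel)"
  proof (rule lborel_pair.Fubini_integral)
    have "integrable (lborel \<Otimes>\<^sub>M lborel) (\<lambda>(x, \<eta>). f x * ft \<phi> \<eta>)"
      by (intro lborel_pair.integrable_pair_mult f iF)
    then have "integrable (lborel \<Otimes>\<^sub>M lborel) (\<lambda>(x, \<eta>). f x * ft \<phi> \<eta> * cis (x \<bullet> \<eta>))"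
      using integrable_mult_cis[of "lborel \<Otimes>\<^sub>M lborel" "\<lambda>(x, \<eta>). f x * ft \<phi> \<eta>" "\<lambda>(x, \<eta>). x \<bullet> \<eta>"]
      by (simp add: case_prod_unfold)
    then show "integrable (lborel \<Otimes>\<^sub>M lborel) (\<lambda>(x, \<eta>). f x * (ft \<phi> \<eta> * cis (x \<bullet> \<eta>)))"
      by (simp add: mult.assoc)
  qed
  also have "\<dots> = (\<integral>x. f x * (of_real ((2 * pi) ^ DIM(real^2)) * \<phi> x) \<partial>lborel)"
  proof -
    obtain B where "\<And>x. norm (\<phi> x) \<le> B" using test_fun_bounded[OF \<phi>] by blast
    moreover have "isCont \<phi> x" for x
      using test_fun_continuous[OF \<phi>] by (simp add: continuous_on_eq_continuous_at)
    ultimately have "(\<integral>\<eta>. ft \<phi> \<eta> * cis (x \<bullet> \<eta>) \<partial>lborel) = of_real ((2 * pi) ^ DIM(real^2)) * \<phi> x" for x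
      by (intro fourier_inversion i\<phi> iF)
    then show ?thesis by (simp only: integral_mult_right_zero)
  qed
  also have "\<dots> = of_real ((2 * pi) ^ DIM(real^2)) * (\<integral>x. f x * \<phi> x \<partial>lborel)"
    by (simp only: mult.left_commute[of "f _"] integral_mult_right_zero)
  finally show ?thesis by (simp add: power2_eq_square)
qed


section \<open>Decay of the filtered backprojection away from the data\<close>

lemma norm_integral_le_inverse_square:
  fixes h :: "real \<Rightarrow> complex"
  assumes "\<And>\<tau>. norm (h \<tau>) \<le> B * (1 / (1 + \<tau>\<^sup>2))" "h \<in> borel_measurable borel"
  shows "integrable lborel h" "norm (\<integral>\<tau>. h \<tau> \<partial>lborel) \<le> B * (\<integral>\<tau>. 1 / (1 + \<tau>\<^sup>2) \<partial>lborel)"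
proof -
  have i: "integrable lborel (\<lambda>\<tau>::real. B * (1 / (1 + \<tau>\<^sup>2)))"
    by (intro integrable_mult_right integrable_inverse_1_plus_square)
  show h: "integrable lborel h"
    by (rule Bochner_Integration.integrable_bound[OF i]) (use assms order_trans[OF assms(1) abs_ge_self] in auto)
  have "norm (\<integral>\<tau>. h \<tau> \<partial>lborel) \<le> (\<integral>\<tau>. B * (1 / (1 + \<tau>\<^sup>2)) \<partial>lborel)"
    by (rule order_trans[OF integral_norm_bound integral_mono]) (use h i assms in auto)
  then show "norm (\<integral>\<tau>. h \<tau> \<partial>lborel) \<le> B * (\<integral>\<tau>. 1 / (1 + \<tau>\<^sup>2) \<partial>lborel)"
    by (simp only: integral_mult_right_zero)
qed

lemma test_fun_ft_line_integrable:
  fixes \<rho> :: "real^2 \<Rightarrow> complex"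
  assumes \<rho>: "test_fun \<rho>" and \<theta>: "norm \<theta> = 1"
  shows "integrable lborel (\<lambda>\<tau>. ft \<rho> (\<tau> *\<^sub>R \<theta>))"
proof -
  note [measurable] = test_fun_borel[OF \<rho>]
  obtain C where C: "C \<ge> 0" "\<And>\<eta>. norm (ft \<rho> \<eta>) \<le> C / (1 + norm \<eta>) ^ 2"
    using test_fun_ft_decay[OF \<rho>] by blast
  show ?thesis
  proof (rule norm_integral_le_inverse_square(1))
    fix \<tau> :: real
    have "1 + \<tau>\<^sup>2 \<le> (1 + \<bar>\<tau>\<bar>)\<^sup>2" by (simp add: power2_sum)
    then have "C / (1 + \<bar>\<tau>\<bar>)\<^sup>2 \<le> C / (1 + \<tau>\<^sup>2)"
      using C(1) by (intro divide_left_mono) (auto simp: add_pos_nonneg)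
    then show "norm (ft \<rho> (\<tau> *\<^sub>R \<theta>)) \<le> C * (1 / (1 + \<tau>\<^sup>2))"
      using C(2)[of "\<tau> *\<^sub>R \<theta>"] \<theta> by simp
  qed measurable
qed

text \<open>By the slice theorem \<open>ft \<rho> (\<tau> *\<^sub>R \<theta>)\<close> is the
  one-dimensional transform of the slice of \<open>radon \<rho>\<close> at \<theta>. Inversion
  returns the value of the slice at p, which is 0 because the line misses the support. By
  compactness the slice vanishes on a neighbourhood of p, and this supplies the continuity that
  inversion asks for.\<close>

lemma ft_line_integral_vanish:
  fixes \<rho> :: "real^2 \<Rightarrow> complex"
  assumes \<rho>: "test_fun \<rho>" and \<theta>: "norm \<theta> = 1"
    and miss: "\<And>x. x \<in> closure (support_on UNIV \<rho>) \<Longrightarrow> x \<bullet> \<theta> \<noteq> p"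
  shows "(\<integral>\<tau>. ft \<rho> (\<tau> *\<^sub>R \<theta>) * cis (\<tau> * p) \<partial>lborel) = 0"
proof -
  note [measurable] = test_fun_borel[OF \<rho>]
  let ?K = "closure (support_on UNIV \<rho>)"
  let ?r = "\<lambda>p. radon \<rho> (\<theta>, p)"
  note slice = radon_slice[OF test_fun_integrable[OF \<rho>] \<theta>]
  have req: "?r q = (\<integral>t. \<rho> (rot \<theta> (q, t)) \<partial>lborel)" for q
    by (rule radon_borel_eq) measurable
  have ftr: "ft ?r \<tau> = ft \<rho> (\<tau> *\<^sub>R \<theta>)" for \<tau> :: real
    using slice(2)[of \<tau>] by (simp add: ft_def mult.commute)
  have K: "compact ?K" using \<rho> by (simp add: test_fun_def)
  have zero: "?r q = 0" if "q \<notin> (\<lambda>x. x \<bullet> \<theta>) ` ?K" for q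
  proof -
    have "\<rho> (rot \<theta> (q, t)) = 0" for t
    proof (rule test_fun_vanish[of _ \<rho>])
      show "rot \<theta> (q, t) \<notin> ?K"
        using that inner_rot[OF \<theta>, of "(q, t)"] by force
    qed
    then show ?thesis by (simp add: req)
  qed
  have "open (- ((\<lambda>x. x \<bullet> \<theta>) ` ?K))"
    by (intro open_Compl compact_imp_closed compact_continuous_image continuous_intros K)
  moreover have "continuous_on (- ((\<lambda>x. x \<bullet> \<theta>) ` ?K)) ?r"
    using zero by (subst continuous_on_cong[OF refl, where g="\<lambda>_. 0"]) auto
  moreover have p: "p \<notin> (\<lambda>x. x \<bullet> \<theta>) ` ?K" using miss by auto
  ultimately have cont: "isCont ?r p"
    by (simp add: continuous_on_eq_continuous_at)
  obtain B where B: "\<And>x. norm (\<rho> x) \<le> B" using test_fun_bounded[OF \<rho>] by blast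
  obtain R where R: "\<And>x. x \<in> ?K \<Longrightarrow> norm x \<le> R"
    using compact_imp_bounded[OF K] by (auto simp: bounded_iff)
  \<comment> \<open>Since \<open>\<bar>t\<bar>\<close> is at most the norm of
    \<open>rot \<theta> (q, t)\<close>, every slice integral runs over the fixed interval from -R to
    R.\<close>
  have bdd: "norm (?r q) \<le> (\<integral>t. indicator {-R..R} t * B \<partial>lborel)" for q
  proof -
    have "norm (?r q) \<le> (\<integral>t. norm (\<rho> (rot \<theta> (q, t))) \<partial>lborel)"
      unfolding req by (rule integral_norm_bound)
    also have "\<dots> \<le> (\<integral>t. indicator {-R..R} t * B \<partial>lborel)"
    proof (rule integral_mono')
      show "integrable lborel (\<lambda>t. indicator {-R..R} t * B)"
        using borel_integrable_compact[of "{-R..R}" "\<lambda>t. B"] by simp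
      show "norm (\<rho> (rot \<theta> (q, t))) \<le> indicator {-R..R} t * B" for t
      proof (cases "t \<in> {-R..R}")
        case False
        have "t\<^sup>2 \<le> (norm (rot \<theta> (q, t)))\<^sup>2" by (simp add: norm_rot[OF \<theta>])
        then have "\<bar>t\<bar> \<le> norm (rot \<theta> (q, t))" by (simp add: abs_le_square_iff[symmetric])
        with False R have "rot \<theta> (q, t) \<notin> ?K" by force
        then show ?thesis using False test_fun_vanish[of _ \<rho>] by simp
      qed (simp add: B)
    qed (use order_trans[OF norm_ge_zero B] in auto)
    finally show ?thesis .
  qed
  have "(\<integral>\<tau>. ft ?r \<tau> * cis (p \<bullet> \<tau>) \<partial>lborel) = of_real ((2 * pi) ^ DIM(real)) * ?r p"
  proof (rule fourier_inversion[OF slice(1) _ bdd cont])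
    show "integrable lborel (ft ?r)"
      using test_fun_ft_line_integrable[OF \<rho> \<theta>] by (simp add: ftr[abs_def])
  qed
  then show ?thesis by (simp add: ftr zero[OF p] mult.commute[of p])
qed

text \<open>As \<theta> is a unit vector,
  \<open>\<tau> * ft \<phi> (\<tau> *\<^sub>R \<theta>)\<close> is \<open>- \<i>\<close> times the
  transform of the derivative of \<open>\<phi>\<close> along \<theta>. Differentiation does not
  enlarge the support, so \<open>ft_line_integral_vanish\<close> applies to each partial
  derivative.\<close>

lemma tau_ft_integral_vanish:
  fixes \<phi> :: "real^2 \<Rightarrow> complex"
  assumes \<phi>: "test_fun \<phi>" and \<theta>: "norm \<theta> = 1"
    and miss: "\<And>x. x \<in> closure (support_on UNIV \<phi>) \<Longrightarrow> x \<bullet> \<theta> \<noteq> p"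
  shows "(\<integral>\<tau>. of_real \<tau> * ft \<phi> (\<tau> *\<^sub>R \<theta>) * cis (\<tau> * p) \<partial>lborel) = 0"
proof -
  let ?d = "\<lambda>b x. frechet_derivative \<phi> (at x) b"
  have t: "test_fun (?d b)" if "b \<in> Basis" for b
    by (rule test_fun_frechet_derivative[OF \<phi> that])
  have supp: "closure (support_on UNIV (?d b)) \<subseteq> closure (support_on UNIV \<phi>)" for b
  proof (rule closure_minimal)
    show "support_on UNIV (?d b) \<subseteq> closure (support_on UNIV \<phi>)"
    proof
      fix x assume "x \<in> support_on UNIV (?d b)"
      then have "?d b x \<noteq> 0" by (simp add: support_on_def)
      then show "x \<in> closure (support_on UNIV \<phi>)"
        by (rule contrapos_np) (simp add: frechet_derivative_vanish)
    qed
  qed simp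
  have eq: "of_real \<tau> * ft \<phi> (\<tau> *\<^sub>R \<theta>) * cis (\<tau> * p)
      = (\<Sum>b\<in>Basis. of_real (\<theta> \<bullet> b) * (- \<i>) * (ft (?d b) (\<tau> *\<^sub>R \<theta>) * cis (\<tau> * p)))" for \<tau>
  proof -
    have "(\<Sum>b\<in>Basis. of_real (\<theta> \<bullet> b) * (- \<i>) * (ft (?d b) (\<tau> *\<^sub>R \<theta>) * cis (\<tau> * p)))
      = (\<Sum>b\<in>Basis. of_real ((\<theta> \<bullet> b) * (\<theta> \<bullet> b)) * (of_real \<tau> * ft \<phi> (\<tau> *\<^sub>R \<theta>) * cis (\<tau> * p)))"
      by (rule sum.cong) (auto simp: ft_frechet_derivative[OF \<phi>] mult_ac)
    also have "\<dots> = of_real (\<theta> \<bullet> \<theta>) * (of_real \<tau> * ft \<phi> (\<tau> *\<^sub>R \<theta>) * cis (\<tau> * p))"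
      by (subst euclidean_inner[of \<theta> \<theta>]) (simp add: sum_distrib_right)
    also have "\<theta> \<bullet> \<theta> = 1" using \<theta> by (simp add: norm_eq_1)
    finally show ?thesis by simp
  qed
  have i: "integrable lborel (\<lambda>\<tau>. ft (?d b) (\<tau> *\<^sub>R \<theta>) * cis (\<tau> * p))" if "b \<in> Basis" for b
    by (intro integrable_mult_cis test_fun_ft_line_integrable t that \<theta>) measurable
  have z: "(\<integral>\<tau>. ft (?d b) (\<tau> *\<^sub>R \<theta>) * cis (\<tau> * p) \<partial>lborel) = 0" if "b \<in> Basis" for b
    by (rule ft_line_integral_vanish[OF t[OF that] \<theta>]) (use miss supp in blast)
  show ?thesis
    unfolding eq
    by (subst Bochner_Integration.integral_sum) (use i z in \<open>auto intro: integrable_mult_right simp del: integrable_mult_right_iff\<close>)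
qed

text \<open>The vanishing integral is added with the sign s, which leaves only the half-line
  \<open>s * \<tau> \<ge> 0\<close> to be estimated; the factor 2 is the doubled symbol
  there.\<close>

lemma norm_fbp_kernel_half_le:
  fixes \<phi> :: "real^2 \<Rightarrow> complex"
  assumes \<phi>: "test_fun \<phi>" and \<theta>: "norm \<theta> = 1" and s: "\<bar>s\<bar> = 1"
    and miss: "\<And>x. x \<in> closure (support_on UNIV \<phi>) \<Longrightarrow> x \<bullet> \<theta> \<noteq> p"
    and B: "\<And>\<tau>. s * \<tau> \<ge> 0 \<Longrightarrow> \<bar>\<tau>\<bar> * norm (ft \<phi> (\<tau> *\<^sub>R \<theta>)) \<le> B * (1 / (1 + \<tau>\<^sup>2))"
  shows "norm (fbp_kernel \<phi> (\<theta>, p)) \<le> 2 * B * (\<integral>\<tau>. 1 / (1 + \<tau>\<^sup>2) \<partial>lborel)"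
proof -
  note [measurable] = test_fun_borel[OF \<phi>]
  let ?h = "\<lambda>\<tau>. of_real \<bar>\<tau>\<bar> * ft \<phi> (\<tau> *\<^sub>R \<theta>) * cis (\<tau> * p)"
  let ?g = "\<lambda>\<tau>. of_real \<tau> * ft \<phi> (\<tau> *\<^sub>R \<theta>) * cis (\<tau> * p)"
  have B0: "B \<ge> 0" using B[of 0] by simp
  have ih: "integrable lborel ?h"
    by (intro integrable_mult_cis abs_ft_integrable \<phi> \<theta>) measurable
  have ig: "integrable lborel ?g"
    by (rule Bochner_Integration.integrable_bound[OF ih]) (auto simp: norm_mult)
  have "(\<integral>\<tau>. ?h \<tau> \<partial>lborel) = (\<integral>\<tau>. ?h \<tau> + of_real s * ?g \<tau> \<partial>lborel)"
    using ih ig tau_ft_integral_vanish[OF \<phi> \<theta> miss] by simp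
  also have "norm \<dots> \<le> 2 * B * (\<integral>\<tau>. 1 / (1 + \<tau>\<^sup>2) \<partial>lborel)"
  proof (rule norm_integral_le_inverse_square(2))
    fix \<tau>
    have e: "?h \<tau> + of_real s * ?g \<tau> = of_real (\<bar>\<tau>\<bar> + s * \<tau>) * ft \<phi> (\<tau> *\<^sub>R \<theta>) * cis (\<tau> * p)"
      by (simp add: algebra_simps)
    show "norm (?h \<tau> + of_real s * ?g \<tau>) \<le> 2 * B * (1 / (1 + \<tau>\<^sup>2))"
    proof (cases "s * \<tau> \<ge> 0")
      case True
      then have "s * \<tau> = \<bar>\<tau>\<bar>" using s by (metis abs_mult abs_of_nonneg mult_1)
      then have "norm (?h \<tau> + of_real s * ?g \<tau>) = 2 * (\<bar>\<tau>\<bar> * norm (ft \<phi> (\<tau> *\<^sub>R \<theta>)))"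
        unfolding e norm_mult norm_cis norm_of_real by simp
      then show ?thesis using B[OF True] by simp
    next
      case False
      then have "s * \<tau> = - \<bar>\<tau>\<bar>" using s by (metis abs_mult abs_of_neg not_le mult_1 minus_minus)
      then show ?thesis unfolding e using B0 by (simp add: add_nonneg_nonneg)
    qed
  qed measurable
  also have "norm (fbp_kernel \<phi> (\<theta>, p)) \<le> norm (\<integral>\<tau>. ?h \<tau> \<partial>lborel)"
  proof -
    have "8 * pi\<^sup>2 \<ge> 1" using mult_mono[of 1 pi 1 pi] pi_gt3 by (simp add: power2_eq_square)
    then have "norm (\<integral>\<tau>. ?h \<tau> \<partial>lborel) / (8 * pi\<^sup>2) \<le> norm (\<integral>\<tau>. ?h \<tau> \<partial>lborel) / 1"
      by (intro divide_left_mono) auto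
    then show ?thesis by (simp add: fbp_kernel_def norm_divide norm_mult norm_power)
  qed
  finally show ?thesis .
qed

text \<open>m measures how far \<tau> \<theta> stays from pointing against \<xi>. With a and b for
  the lengths of the two vectors, the squared norm of the sum is at least
  \<open>a\<^sup>2 - 2 * (1 - m) * a * b + b\<^sup>2\<close>, hence at least
  \<open>m * (a\<^sup>2 + b\<^sup>2)\<close>, which dominates the square of
  \<open>m / 2 * (a + b)\<close>.\<close>

lemma norm_add_ge_of_inner:
  fixes \<xi> \<theta> :: "'a::real_inner"
  assumes \<theta>: "norm \<theta> = 1" and m: "0 < m" "m \<le> 1"
    and le: "- ((1 - m) * (\<bar>\<tau>\<bar> * norm \<xi>)) \<le> \<tau> * (\<theta> \<bullet> \<xi>)"
  shows "m / 2 * (\<bar>\<tau>\<bar> + norm \<xi>) \<le> norm (\<tau> *\<^sub>R \<theta> + \<xi>)"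
proof (rule power2_le_imp_le)
  let ?a = "\<bar>\<tau>\<bar>" and ?b = "norm \<xi>"
  have "(norm (\<tau> *\<^sub>R \<theta> + \<xi>))\<^sup>2 = ?a\<^sup>2 + 2 * (\<tau> * (\<theta> \<bullet> \<xi>)) + ?b\<^sup>2"
    using \<theta> unfolding power2_norm_eq_inner norm_eq_1
    by (simp add: inner_add_left inner_add_right inner_commute power2_eq_square algebra_simps)
  also have "\<dots> \<ge> ?a\<^sup>2 - 2 * ((1 - m) * (?a * ?b)) + ?b\<^sup>2" using le by linarith
  finally have 1: "(norm (\<tau> *\<^sub>R \<theta> + \<xi>))\<^sup>2 \<ge> ?a\<^sup>2 - 2 * ((1 - m) * (?a * ?b)) + ?b\<^sup>2" .
  have 2: "(1 - m) * (2 * (?a * ?b)) \<le> (1 - m) * (?a\<^sup>2 + ?b\<^sup>2)"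
    using m sum_squares_bound[of ?a ?b] by (intro mult_left_mono) (auto simp: mult_ac)
  have 3: "m * ((?a + ?b)\<^sup>2) \<le> m * (2 * (?a\<^sup>2 + ?b\<^sup>2))"
    using m sum_squares_bound[of ?a ?b] by (intro mult_left_mono) (auto simp: power2_sum)
  have "(m / 2 * (?a + ?b))\<^sup>2 = m * (m * ((?a + ?b)\<^sup>2)) / 4"
    by (simp add: power_mult_distrib power_divide power2_eq_square)
  also have "\<dots> \<le> 1 * (m * ((?a + ?b)\<^sup>2)) / 4"
    using m by (intro divide_right_mono mult_right_mono) auto
  also have "\<dots> \<le> m * (?a\<^sup>2 + ?b\<^sup>2)"
  proof -
    have "0 \<le> m * (?a\<^sup>2 + ?b\<^sup>2)" using m by (intro mult_nonneg_nonneg add_nonneg_nonneg) auto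
    moreover have "m * ((?a + ?b)\<^sup>2) \<le> 2 * (m * (?a\<^sup>2 + ?b\<^sup>2))" using 3 by (simp only: mult.left_commute)
    ultimately show ?thesis by linarith
  qed
  also have "\<dots> = ?a\<^sup>2 + ?b\<^sup>2 - (1 - m) * (?a\<^sup>2 + ?b\<^sup>2)" by (simp add: algebra_simps)
  also have "\<dots> \<le> (norm (\<tau> *\<^sub>R \<theta> + \<xi>))\<^sup>2" using 1 2 by linarith
  finally show "(m / 2 * (?a + ?b))\<^sup>2 \<le> (norm (\<tau> *\<^sub>R \<theta> + \<xi>))\<^sup>2" .
qed simp

text \<open>Of the k + 3 powers, k become decay in \<xi>, while the other three absorb
  \<open>\<bar>\<tau>\<bar>\<close> and leave \<open>1 / (1 + \<tau>\<^sup>2)\<close>. The lower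
  bound \<open>ge\<close> lets each power of the denominator serve either variable.\<close>

lemma abs_ft_decay:
  fixes F :: "real^2 \<Rightarrow> complex"
  assumes F: "\<And>\<eta>. norm (F \<eta>) \<le> C / (1 + norm \<eta>) ^ (k + 3)" and C: "C \<ge> 0"
    and c: "0 < c" "c \<le> 1" and ge: "c * (\<bar>\<tau>\<bar> + norm \<xi>) \<le> norm (\<tau> *\<^sub>R \<theta> + \<xi>)"
  shows "\<bar>\<tau>\<bar> * norm (F (\<tau> *\<^sub>R \<theta> + \<xi>)) \<le> C / c ^ (k + 3) / (1 + norm \<xi>) ^ k * (1 / (1 + \<tau>\<^sup>2))"
proof -
  let ?X = "1 + norm (\<tau> *\<^sub>R \<theta> + \<xi>)" and ?Y = "1 + norm \<xi>" and ?Z = "1 + \<bar>\<tau>\<bar>"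
  have pos: "?X > 0" "?Y > 0" "?Z > 0" "1 + \<tau>\<^sup>2 > 0" by (auto simp: add_pos_nonneg)
  have "c * (1 + \<bar>\<tau>\<bar> + norm \<xi>) \<le> ?X"
    using ge c by (simp add: algebra_simps)
  then have "(c * (1 + \<bar>\<tau>\<bar> + norm \<xi>)) ^ (k + 3) \<le> ?X ^ (k + 3)"
    using c by (intro power_mono) auto
  moreover have "?Y ^ k * ?Z ^ 3 \<le> (1 + \<bar>\<tau>\<bar> + norm \<xi>) ^ k * (1 + \<bar>\<tau>\<bar> + norm \<xi>) ^ 3"
    by (intro mult_mono power_mono) auto
  then have "c ^ (k + 3) * (?Y ^ k * ?Z ^ 3) \<le> (c * (1 + \<bar>\<tau>\<bar> + norm \<xi>)) ^ (k + 3)"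
    using c by (simp add: power_mult_distrib power_add mult_left_mono)
  moreover have "c ^ (k + 3) * (?Y ^ k * (\<bar>\<tau>\<bar> * (1 + \<tau>\<^sup>2))) \<le> c ^ (k + 3) * (?Y ^ k * ?Z ^ 3)"
    using c by (intro mult_left_mono abs_cube_le) auto
  ultimately have "c ^ (k + 3) * (?Y ^ k * (\<bar>\<tau>\<bar> * (1 + \<tau>\<^sup>2))) \<le> ?X ^ (k + 3)" by linarith
  then have "C * (c ^ (k + 3) * (?Y ^ k * (\<bar>\<tau>\<bar> * (1 + \<tau>\<^sup>2)))) \<le> C * ?X ^ (k + 3)"
    using C by (rule mult_left_mono)
  then have "\<bar>\<tau>\<bar> * (C / ?X ^ (k + 3)) \<le> C / c ^ (k + 3) / ?Y ^ k * (1 / (1 + \<tau>\<^sup>2))"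
    using pos c by (simp add: pos_divide_le_eq pos_le_divide_eq mult_ac)
  moreover have "\<bar>\<tau>\<bar> * norm (F (\<tau> *\<^sub>R \<theta> + \<xi>)) \<le> \<bar>\<tau>\<bar> * (C / ?X ^ (k + 3))"
    by (intro mult_left_mono F) auto
  ultimately show ?thesis by linarith
qed


lemma closure_support_mult_cis:
  "closure (support_on UNIV (modulate \<psi> \<xi>)) = closure (support_on UNIV \<psi>)"
  by (rule arg_cong[where f=closure]) (auto simp: support_on_def)

text \<open>The kernel has to be estimated only where the data do not vanish; this is where
  knowledge of the zero set of g acts.\<close>

lemma norm_fbp_le:
  assumes g: "integrable cyl_measure g" and \<phi>: "test_fun \<phi>"
    and D: "AE z in cyl_measure. g z = 0 \<or> norm (fbp_kernel \<phi> z) \<le> D"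
  shows "norm (fbp g \<phi>) \<le> (\<integral>z. norm (g z) \<partial>cyl_measure) * D"
proof -
  have "norm (fbp g \<phi>) \<le> (\<integral>z. norm (g z) * D \<partial>cyl_measure)"
    unfolding fbp_def
  proof (rule order_trans[OF integral_norm_bound integral_mono_AE])
    show "integrable cyl_measure (\<lambda>z. norm (g z * fbp_kernel \<phi> z))"
      by (rule integrable_norm[OF integrable_fbp_pairing[OF g \<phi>]])
    show "integrable cyl_measure (\<lambda>z. norm (g z) * D)" using g by simp
    show "AE z in cyl_measure. norm (g z * fbp_kernel \<phi> z) \<le> norm (g z) * D"
      using D by eventually_elim (auto simp: norm_mult intro: mult_left_mono)
  qed
  then show ?thesis by (simp only: integral_mult_left_zero)
qed

text \<open>Directions within distance r of \<theta>, written without dividing by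
  \<open>norm \<xi>\<close>: homogeneity is then evident, and the strict inequality excludes
  0.\<close>

definition conic_nhd :: "real \<Rightarrow> 'a::real_normed_vector \<Rightarrow> 'a set" where
  "conic_nhd r \<theta> = {\<xi>. norm (\<xi> - norm \<xi> *\<^sub>R \<theta>) < r * norm \<xi>}"

lemma open_cone_conic_nhd: "open_cone (conic_nhd r \<theta>)"
  unfolding open_cone_def
proof (intro conjI ballI allI impI)
  show "open (conic_nhd r \<theta>)"
    unfolding conic_nhd_def by (intro open_Collect_less continuous_intros)
  fix v and t :: real assume v: "v \<in> conic_nhd r \<theta>" and t: "t > 0"
  have "t *\<^sub>R v - norm (t *\<^sub>R v) *\<^sub>R \<theta> = t *\<^sub>R (v - norm v *\<^sub>R \<theta>)"
    using t by (simp add: algebra_simps)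
  then show "t *\<^sub>R v \<in> conic_nhd r \<theta>"
    using v t by (simp add: conic_nhd_def)
qed

text \<open>Near the peak of \<open>\<tau> \<mapsto> ft \<psi> (\<tau> \<theta> + \<xi>)\<close>, which exists only for \<open>\<theta>\<close> close to \<open>\<plusminus>\<xi> / \<bar>\<xi>\<bar>\<close>, the symbol
  \<open>\<bar>\<tau>\<bar>\<close> agrees with \<open>\<plusminus>\<tau>\<close>, that is, with a differential operator, which is local in \<open>p\<close>.\<close>

lemma fbp_local_decay:
  assumes g: "integrable cyl_measure g" and \<theta>0: "norm \<theta>0 = 1" and \<epsilon>: "\<epsilon> > 0"
    and zero: "AE z in cyl_measure. dist z (\<theta>0, x0 \<bullet> \<theta>0) < \<epsilon> \<or> dist (- z) (\<theta>0, x0 \<bullet> \<theta>0) < \<epsilon> \<longrightarrow> g z = 0"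
  shows "\<exists>\<delta> r. \<delta> > 0 \<and> r > 0 \<and> (\<forall>\<psi>. test_fun \<psi> \<and> closure (support_on UNIV \<psi>) \<subseteq> ball x0 \<delta> \<longrightarrow>
    rapidly_decaying_on (conic_nhd r \<theta>0) (\<lambda>\<xi>. fbp g (modulate \<psi> \<xi>)))"
proof -
  \<comment> \<open>Half of \<epsilon> is granted to the angle and half to the offset, since the
    distance on the cylinder is bounded by their sum.\<close>
  define e where "e = \<epsilon> / 2"
  have e: "e > 0" using \<epsilon> by (simp add: e_def)
  \<comment> \<open>Angular threshold. It is at most e, so that an angle within \<nu> forces the
    offset to be off by at least e, and so small that tilting the normal by \<nu> moves the offset
    of \<open>x0\<close> by at most e / 2.\<close>
  define \<nu> where "\<nu> = min 1 (min e (e / (2 * (norm x0 + 1))))"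
  have \<nu>: "0 < \<nu>" "\<nu> \<le> 1" "\<nu> \<le> e" "\<nu> \<le> e / (2 * (norm x0 + 1))"
    using e by (auto simp: \<nu>_def add_nonneg_pos intro!: divide_pos_pos mult_pos_pos)
  have "norm x0 * \<nu> \<le> (norm x0 + 1) * (e / (2 * (norm x0 + 1)))"
    using \<nu> by (intro mult_mono) auto
  also have "\<dots> = e / 2"
    using add_nonneg_pos[OF norm_ge_zero[of x0] zero_less_one] by (simp add: field_simps)
  finally have x0\<nu>: "norm x0 * \<nu> \<le> e / 2" .
  \<comment> \<open>A unit vector at distance at least \<nu> from \<theta>0 satisfies
    \<open>\<theta> \<bullet> \<theta>0 \<le> 1 - \<nu>\<^sup>2 / 2\<close>, which is
    \<open>1 - 2 * r\<close>. One r absorbs the opening of the cone, the other remains as the margin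
    in the angle to \<xi>.\<close>
  define r where "r = \<nu>\<^sup>2 / 4"
  have \<nu>2: "\<nu>\<^sup>2 \<le> 1" using \<nu> by (simp add: power_le_one)
  have r: "0 < r" "r \<le> 1" using \<nu> \<nu>2 by (auto simp: r_def)
  let ?V = "conic_nhd r \<theta>0"
  have "rapidly_decaying_on ?V (\<lambda>\<xi>. fbp g (modulate \<psi> \<xi>))"
    if \<psi>: "test_fun \<psi>" and supp: "closure (support_on UNIV \<psi>) \<subseteq> ball x0 (e / 2)" for \<psi>
    unfolding rapidly_decaying_on_def
  proof
    fix k :: nat
    obtain C where C: "C \<ge> 0" "\<And>\<eta>. norm (ft \<psi> \<eta>) \<le> C / (1 + norm \<eta>) ^ (k + 3)"
      using test_fun_ft_decay[OF \<psi>] by blast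
    let ?J = "\<integral>\<tau>. 1 / (1 + \<tau>\<^sup>2) \<partial>(lborel :: real measure)"
    let ?c = "r / 2"
    have J: "?J \<ge> 0" by (intro Bochner_Integration.integral_nonneg) (auto simp: add_nonneg_nonneg)
    have main: "norm (fbp_kernel (modulate \<psi> \<xi>) (\<theta>, p)) \<le> 2 * (C / ?c ^ (k + 3)) * ?J / (1 + norm \<xi>) ^ k"
      if \<theta>: "norm \<theta> = 1" and \<xi>: "\<xi> \<in> ?V"
        and far: "\<not> (dist (\<theta>, p) (\<theta>0, x0 \<bullet> \<theta>0) < \<epsilon> \<or> dist (- (\<theta>, p)) (\<theta>0, x0 \<bullet> \<theta>0) < \<epsilon>)" for \<theta> p \<xi>
    proof -
      let ?\<phi> = "\<lambda>x. \<psi> x * cis (- (x \<bullet> \<xi>))"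
      let ?B = "C / ?c ^ (k + 3) / (1 + norm \<xi>) ^ k"
      note t = test_fun_mult_cis[OF \<psi>, of \<xi>]
      have B0: "?B \<ge> 0" using C r by (intro divide_nonneg_nonneg) auto
      have B: "\<bar>\<tau>\<bar> * norm (ft ?\<phi> (\<tau> *\<^sub>R \<theta>)) \<le> ?B * (1 / (1 + \<tau>\<^sup>2))"
        if "- ((1 - r) * (\<bar>\<tau>\<bar> * norm \<xi>)) \<le> \<tau> * (\<theta> \<bullet> \<xi>)" for \<tau>
        unfolding ft_mult_cis
        by (rule abs_ft_decay[OF C(2) C(1)]) (use r norm_add_ge_of_inner[OF \<theta> r that] in auto)
      have \<xi>': "norm (\<xi> - norm \<xi> *\<^sub>R \<theta>0) \<le> r * norm \<xi>" using \<xi> by (simp add: conic_nhd_def)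
      have ip: "\<bar>\<theta> \<bullet> \<xi> - norm \<xi> * (\<theta> \<bullet> \<theta>0)\<bar> \<le> r * norm \<xi>"
      proof -
        have "\<theta> \<bullet> \<xi> - norm \<xi> * (\<theta> \<bullet> \<theta>0) = \<theta> \<bullet> (\<xi> - norm \<xi> *\<^sub>R \<theta>0)" by (simp add: inner_diff_right)
        also have "\<bar>\<dots>\<bar> \<le> norm \<theta> * norm (\<xi> - norm \<xi> *\<^sub>R \<theta>0)" by (rule Cauchy_Schwarz_ineq2)
        finally show ?thesis using \<xi>' \<theta> by simp
      qed
      have n2: "(norm (\<theta> - s *\<^sub>R \<theta>0))\<^sup>2 = 2 - 2 * s * (\<theta> \<bullet> \<theta>0)" if "\<bar>s\<bar> = 1" for s
      proof -
        have "s * s = 1" using that by (metis abs_mult_self_eq mult_1)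
        then show ?thesis using \<theta> \<theta>0 unfolding power2_norm_eq_inner norm_eq_1
          by (simp add: inner_diff_left inner_diff_right inner_commute mult.assoc[symmetric])
      qed
      have bound: "norm (fbp_kernel ?\<phi> (\<theta>, p)) \<le> 2 * ?B * ?J"
      proof (cases "\<exists>s. \<bar>s\<bar> = 1 \<and> norm (\<theta> - s *\<^sub>R \<theta>0) < \<nu>")
        case True
        then obtain s where s: "\<bar>s\<bar> = 1" "norm (\<theta> - s *\<^sub>R \<theta>0) < \<nu>" by blast
        have ss: "s * s = 1" using s(1) by (metis abs_mult_self_eq mult_1)
        have "(norm (\<theta> - s *\<^sub>R \<theta>0))\<^sup>2 \<le> \<nu>\<^sup>2" using s(2) by (intro power_mono) auto
        then have "1 - \<nu>\<^sup>2 / 2 \<le> s * (\<theta> \<bullet> \<theta>0)" using n2[OF s(1)] by simp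
        then have "norm \<xi> * (1 - \<nu>\<^sup>2 / 2) \<le> norm \<xi> * (s * (\<theta> \<bullet> \<theta>0))" by (intro mult_left_mono) auto
        moreover have "\<bar>s * (\<theta> \<bullet> \<xi> - norm \<xi> * (\<theta> \<bullet> \<theta>0))\<bar> \<le> r * norm \<xi>"
          using ip s(1) by (simp add: abs_mult)
        moreover have "r * norm \<xi> \<le> norm \<xi> * (1 - \<nu>\<^sup>2 / 2)"
        proof -
          have "r \<le> 1 - \<nu>\<^sup>2 / 2" using \<nu>2 by (simp add: r_def)
          then show ?thesis using mult_left_mono[OF _ norm_ge_zero[of \<xi>], of r "1 - \<nu>\<^sup>2 / 2"] by (simp only: mult.commute)
        qed
        \<comment> \<open>On the half-line \<open>s * \<tau> \<ge> 0\<close> the inner product of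
          \<tau> \<theta> and \<xi> is therefore nonnegative, so the lower bound for their sum is
          available.\<close>
        ultimately have pos: "s * (\<theta> \<bullet> \<xi>) \<ge> 0" by (simp add: algebra_simps abs_le_iff)
        show ?thesis
        proof (rule norm_fbp_kernel_half_le[OF t \<theta> s(1)])
          fix \<tau> assume "s * \<tau> \<ge> 0"
          then have "0 \<le> (s * \<tau>) * (s * (\<theta> \<bullet> \<xi>))" using pos by simp
          also have "\<dots> = (s * s) * (\<tau> * (\<theta> \<bullet> \<xi>))" by (simp add: mult_ac)
          finally have "0 \<le> \<tau> * (\<theta> \<bullet> \<xi>)" using ss by simp
          moreover have "0 \<le> (1 - r) * (\<bar>\<tau>\<bar> * norm \<xi>)" using r by simp
          ultimately show "\<bar>\<tau>\<bar> * norm (ft ?\<phi> (\<tau> *\<^sub>R \<theta>)) \<le> ?B * (1 / (1 + \<tau>\<^sup>2))"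
            by (intro B) linarith
        next
          fix x assume "x \<in> closure (support_on UNIV ?\<phi>)"
          then have "x \<in> ball x0 (e / 2)" using supp by (auto simp: closure_support_mult_cis)
          then have x: "norm (x - x0) < e / 2" by (simp add: dist_norm norm_minus_commute)
          \<comment> \<open>With the angle already within e, an offset closer than e would put
            (\<theta>, p) or its antipode into the \<epsilon>-neighbourhood excluded by
            \<open>far\<close>.\<close>
          have pe: "e \<le> \<bar>p - s * (x0 \<bullet> \<theta>0)\<bar>"
          proof (rule ccontr)
            assume "\<not> e \<le> \<bar>p - s * (x0 \<bullet> \<theta>0)\<bar>"
            moreover have "norm (\<theta> - s *\<^sub>R \<theta>0) < e" using s(2) \<nu>(3) by simp
            ultimately have "norm (\<theta> - s *\<^sub>R \<theta>0) + \<bar>p - s * (x0 \<bullet> \<theta>0)\<bar> < \<epsilon>"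
              by (simp add: e_def)
            moreover have "norm ((\<theta>, p) - s *\<^sub>R (\<theta>0, x0 \<bullet> \<theta>0)) \<le> norm (\<theta> - s *\<^sub>R \<theta>0) + \<bar>p - s * (x0 \<bullet> \<theta>0)\<bar>"
              using norm_Pair_le[of "\<theta> - s *\<^sub>R \<theta>0" "p - s * (x0 \<bullet> \<theta>0)"] by simp
            ultimately have "norm ((\<theta>, p) - s *\<^sub>R (\<theta>0, x0 \<bullet> \<theta>0)) < \<epsilon>" by linarith
            moreover from s(1) have "s = 1 \<or> s = - 1" by linarith
            ultimately show False
              using far norm_minus_cancel[of "(\<theta>, p) + (\<theta>0, x0 \<bullet> \<theta>0)"]
              by (auto simp: dist_norm norm_minus_commute simp del: norm_minus_cancel)
          qed
          show "x \<bullet> \<theta> \<noteq> p"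
          proof
            assume p: "x \<bullet> \<theta> = p"
            \<comment> \<open>The offset error splits into moving x to \<open>x0\<close> and tilting
              \<theta> to \<open>s *\<^sub>R \<theta>0\<close>; each costs at most e / 2, the first
              strictly less.\<close>
            have "p - s * (x0 \<bullet> \<theta>0) = (x - x0) \<bullet> \<theta> + x0 \<bullet> (\<theta> - s *\<^sub>R \<theta>0)"
              by (simp add: p[symmetric] inner_diff_left inner_diff_right)
            also have "\<bar>\<dots>\<bar> \<le> norm (x - x0) * norm \<theta> + norm x0 * norm (\<theta> - s *\<^sub>R \<theta>0)"
              by (intro order_trans[OF abs_triangle_ineq] add_mono Cauchy_Schwarz_ineq2)
            also have "\<dots> < e / 2 + e / 2"
            proof (rule add_less_le_mono)
              show "norm x0 * norm (\<theta> - s *\<^sub>R \<theta>0) \<le> e / 2"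
                using x0\<nu> s(2) mult_left_mono[OF less_imp_le[OF s(2)] norm_ge_zero[of x0]] by linarith
            qed (use x \<theta> in simp)
            finally show False using pe by simp
          qed
        qed
      next
        case False
        have le: "s * (\<theta> \<bullet> \<theta>0) \<le> 1 - 2 * r" if "\<bar>s\<bar> = 1" for s
        proof -
          have "\<nu> \<le> norm (\<theta> - s *\<^sub>R \<theta>0)" using False that by force
          then have "\<nu>\<^sup>2 \<le> (norm (\<theta> - s *\<^sub>R \<theta>0))\<^sup>2" using \<nu>(1) by (intro power_mono) auto
          then show ?thesis using n2[OF that] by (simp add: r_def)
        qed
        have abs: "\<bar>\<theta> \<bullet> \<theta>0\<bar> \<le> 1 - 2 * r" using le[of 1] le[of "-1"] by (simp add: abs_le_iff)
        have "\<bar>\<theta> \<bullet> \<xi>\<bar> \<le> norm \<xi> * \<bar>\<theta> \<bullet> \<theta>0\<bar> + r * norm \<xi>"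
        proof -
          have "\<bar>\<theta> \<bullet> \<xi>\<bar> \<le> \<bar>norm \<xi> * (\<theta> \<bullet> \<theta>0)\<bar> + r * norm \<xi>" using ip by linarith
          then show ?thesis by (simp only: abs_mult abs_norm_cancel)
        qed
        also have "\<dots> \<le> norm \<xi> * (1 - 2 * r) + r * norm \<xi>"
          using abs by (intro add_right_mono mult_left_mono) auto
        finally have "\<bar>\<theta> \<bullet> \<xi>\<bar> \<le> (1 - r) * norm \<xi>" by (simp add: algebra_simps)
        then have "\<bar>\<tau>\<bar> * \<bar>\<theta> \<bullet> \<xi>\<bar> \<le> \<bar>\<tau>\<bar> * ((1 - r) * norm \<xi>)" for \<tau> :: real by (intro mult_left_mono) auto
        then have "\<bar>\<tau> * (\<theta> \<bullet> \<xi>)\<bar> \<le> (1 - r) * (\<bar>\<tau>\<bar> * norm \<xi>)" for \<tau> :: real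
          by (simp only: abs_mult mult.left_commute)
        then have "- ((1 - r) * (\<bar>\<tau>\<bar> * norm \<xi>)) \<le> \<tau> * (\<theta> \<bullet> \<xi>)" for \<tau> :: real
          by (rule abs_le_D2[THEN minus_le_iff[THEN iffD1]])
        then have "norm (fbp_kernel ?\<phi> (\<theta>, p)) \<le> ?B * ?J"
          by (intro norm_fbp_kernel_le[OF \<theta>] test_fun_borel[OF t]) (use B in \<open>simp add: norm_mult\<close>)
        moreover have "0 \<le> ?B * ?J" using B0 J by (rule mult_nonneg_nonneg)
        ultimately show ?thesis by linarith
      qed
      also have "2 * ?B * ?J = 2 * (C / ?c ^ (k + 3)) * ?J / (1 + norm \<xi>) ^ k" by simp
      finally show ?thesis .
    qed
    let ?D = "2 * (C / ?c ^ (k + 3)) * ?J"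
    have "norm (fbp g (modulate \<psi> \<xi>)) \<le> ((\<integral>z. norm (g z) \<partial>cyl_measure) * ?D) / (1 + norm \<xi>) ^ k"
      if \<xi>: "\<xi> \<in> ?V" for \<xi>
    proof -
      have "AE z in cyl_measure. g z = 0 \<or> norm (fbp_kernel (modulate \<psi> \<xi>) z) \<le> ?D / (1 + norm \<xi>) ^ k"
        using zero AE_cyl_norm
      proof eventually_elim
        case (elim z)
        then show ?case using main[of "fst z" \<xi> "snd z"] \<xi> by (cases "g z = 0") auto
      qed
      from norm_fbp_le[OF g test_fun_mult_cis[OF \<psi>] this] show ?thesis by simp
    qed
    then show "\<exists>C. \<forall>\<xi>\<in>?V. norm (fbp g (modulate \<psi> \<xi>)) \<le> C / (1 + norm \<xi>) ^ k" by blast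
  qed
  then show ?thesis using e r by (intro exI[of _ "e / 2"] exI[of _ r]) auto
qed

section \<open>Localization of rapid decay\<close>

text \<open>Sweeping a ball of half the radius by positive scalars keeps a margin proportional to
  the length of \<xi>. The constant is the remaining half radius over a bound for the norms in the
  ball; dividing by the scalar t reduces the inclusion to the ball of full radius.\<close>

lemma shrink_open_cone:
  assumes V: "open_cone V" and \<xi>0: "\<xi>0 \<in> V"
  shows "\<exists>V' c. open_cone V' \<and> \<xi>0 \<in> V' \<and> 0 < c \<and> c \<le> 1 \<and> (\<forall>\<xi>\<in>V'. \<forall>\<eta>. norm \<eta> \<le> c * norm \<xi> \<longrightarrow> \<xi> - \<eta> \<in> V)"
proof -
  obtain r where r: "r > 0" "ball \<xi>0 r \<subseteq> V"
    using V \<xi>0 unfolding open_cone_def by (meson openE)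
  let ?V = "\<Union>t\<in>{0<..}. (*\<^sub>R) t ` ball \<xi>0 (r / 2)"
  let ?c = "min 1 ((r / 2) / (norm \<xi>0 + r))"
  have pos: "norm \<xi>0 + r > 0" using r by (simp add: add_nonneg_pos)
  have "open_cone ?V"
    unfolding open_cone_def
  proof (intro conjI ballI allI impI)
    show "open ?V" by (intro open_UN ballI open_scaling) auto
    fix v and t :: real assume "v \<in> ?V" "t > 0"
    then obtain u w where "u > 0" "w \<in> ball \<xi>0 (r / 2)" "v = u *\<^sub>R w" by auto
    with \<open>t > 0\<close> show "t *\<^sub>R v \<in> ?V" by (intro UN_I[of "t * u"] image_eqI[of _ _ w]) auto
  qed
  moreover have "\<xi>0 \<in> ?V" using r by (intro UN_I[of 1] image_eqI[of _ _ \<xi>0]) auto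
  moreover have "0 < ?c" "?c \<le> 1" using r pos by auto
  moreover have "\<xi> - \<eta> \<in> V" if \<xi>: "\<xi> \<in> ?V" and \<eta>: "norm \<eta> \<le> ?c * norm \<xi>" for \<xi> \<eta>
  proof -
    obtain t w where t: "t > 0" and w: "dist \<xi>0 w < r / 2" and eq: "\<xi> = t *\<^sub>R w" using \<xi> by auto
    have "norm w \<le> norm \<xi>0 + norm (w - \<xi>0)" using norm_triangle_ineq[of \<xi>0 "w - \<xi>0"] by simp
    then have nw: "norm w \<le> norm \<xi>0 + r" using w r by (simp add: dist_norm norm_minus_commute)
    have "?c * norm w \<le> (r / 2) / (norm \<xi>0 + r) * (norm \<xi>0 + r)"
      using r pos nw by (intro mult_mono) auto
    moreover have "(r / 2) / (norm \<xi>0 + r) * (norm \<xi>0 + r) = r / 2" using pos by (simp only: nonzero_eq_divide_eq times_divide_eq_left) simp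
    ultimately have cw: "?c * norm w \<le> r / 2" by linarith
    have "norm \<eta> \<le> ?c * (t * norm w)" using \<eta> eq t by simp
    also have "\<dots> = t * (?c * norm w)" by (rule mult.left_commute)
    also have "\<dots> \<le> t * (r / 2)" using cw t by (intro mult_left_mono) auto
    finally have "norm \<eta> / t \<le> r / 2" using t by (simp add: pos_divide_le_eq mult.commute)
    then have "norm ((1 / t) *\<^sub>R \<eta>) \<le> r / 2" using t by simp
    then have "dist \<xi>0 (w - (1 / t) *\<^sub>R \<eta>) < r"
      using w norm_triangle_ineq[of "\<xi>0 - w" "(1 / t) *\<^sub>R \<eta>"]
      unfolding dist_norm diff_diff_eq2 add_diff_eq[symmetric] by (simp only: add_diff_eq diff_add_eq)
    then have "w - (1 / t) *\<^sub>R \<eta> \<in> V" using r(2) by auto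
    then have "t *\<^sub>R (w - (1 / t) *\<^sub>R \<eta>) \<in> V" using V t by (auto simp: open_cone_def)
    then show ?thesis using t eq by (simp add: scaleR_diff_right)
  qed
  ultimately show ?thesis by blast
qed

text \<open>The convolution theorem, obtained by inserting the inversion formula for
  \<open>\<rho>\<close> and exchanging the integrals; the constant is that of the inversion.\<close>

lemma ft_mult_convolution:
  fixes \<rho> \<psi> :: "'a::euclidean_space \<Rightarrow> complex"
  assumes \<rho>: "test_fun \<rho>" and \<psi>: "test_fun \<psi>" and F: "integrable lborel (ft \<rho>)"
  shows "of_real ((2 * pi) ^ DIM('a)) * ft (\<lambda>x. \<rho> x * \<psi> x) \<zeta> = (\<integral>\<eta>. ft \<rho> \<eta> * ft \<psi> (\<zeta> - \<eta>) \<partial>lborel)"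
proof -
  note [measurable] = test_fun_borel[OF \<rho>] test_fun_borel[OF \<psi>]
  obtain B where "\<And>x. norm (\<rho> x) \<le> B" using test_fun_bounded[OF \<rho>] by blast
  moreover have "isCont \<rho> x" for x
    using test_fun_continuous[OF \<rho>] by (simp add: continuous_on_eq_continuous_at)
  ultimately have inv: "(\<integral>\<eta>. ft \<rho> \<eta> * cis (x \<bullet> \<eta>) \<partial>lborel) = of_real ((2 * pi) ^ DIM('a)) * \<rho> x" for x
    by (intro fourier_inversion test_fun_integrable[OF \<rho>] F)
  have "of_real ((2 * pi) ^ DIM('a)) * ft (\<lambda>x. \<rho> x * \<psi> x) \<zeta>
      = (\<integral>x. (of_real ((2 * pi) ^ DIM('a)) * \<rho> x) * (\<psi> x * cis (- (x \<bullet> \<zeta>))) \<partial>lborel)"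
    unfolding ft_def by (subst integral_mult_right_zero[symmetric]) (simp only: mult.assoc)
  also have "\<dots> = (\<integral>x. \<integral>\<eta>. (ft \<rho> \<eta> * cis (x \<bullet> \<eta>)) * (\<psi> x * cis (- (x \<bullet> \<zeta>))) \<partial>lborel \<partial>lborel)"
    by (simp only: inv[symmetric] integral_mult_left_zero)
  also have "\<dots> = (\<integral>x. \<integral>\<eta>. \<psi> x * ft \<rho> \<eta> * cis (- (x \<bullet> (\<zeta> - \<eta>))) \<partial>lborel \<partial>lborel)"
  proof -
    have "(ft \<rho> \<eta> * cis (x \<bullet> \<eta>)) * (\<psi> x * cis (- (x \<bullet> \<zeta>))) = \<psi> x * ft \<rho> \<eta> * cis (- (x \<bullet> (\<zeta> - \<eta>)))" for x \<eta>
    proof -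
      have "cis (- (x \<bullet> (\<zeta> - \<eta>))) = cis (x \<bullet> \<eta>) * cis (- (x \<bullet> \<zeta>))"
        by (simp add: cis_mult inner_diff_right)
      then show ?thesis by (simp add: mult_ac)
    qed
    then show ?thesis by (simp only:)
  qed
  also have "\<dots> = (\<integral>\<eta>. \<integral>x. \<psi> x * ft \<rho> \<eta> * cis (- (x \<bullet> (\<zeta> - \<eta>))) \<partial>lborel \<partial>lborel)"
  proof (rule lborel_pair.Fubini_integral[symmetric])
    have "integrable (lborel \<Otimes>\<^sub>M lborel) (\<lambda>(x, \<eta>). \<psi> x * ft \<rho> \<eta>)"
      by (intro lborel_pair.integrable_pair_mult test_fun_integrable \<psi> F)
    then show "integrable (lborel \<Otimes>\<^sub>M lborel) (\<lambda>(x, \<eta>). \<psi> x * ft \<rho> \<eta> * cis (- (x \<bullet> (\<zeta> - \<eta>))))"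
      using integrable_mult_cis[of "lborel \<Otimes>\<^sub>M lborel" "\<lambda>(x, \<eta>). \<psi> x * ft \<rho> \<eta>" "\<lambda>(x, \<eta>). - (x \<bullet> (\<zeta> - \<eta>))"]
      by (simp add: case_prod_unfold)
  qed
  also have "\<dots> = (\<integral>\<eta>. ft \<rho> \<eta> * ft \<psi> (\<zeta> - \<eta>) \<partial>lborel)"
  proof -
    have "(\<integral>x. \<psi> x * ft \<rho> \<eta> * cis (- (x \<bullet> (\<zeta> - \<eta>))) \<partial>lborel) = ft \<rho> \<eta> * ft \<psi> (\<zeta> - \<eta>)" for \<eta>
      unfolding ft_def[of \<psi>] by (subst integral_mult_right_zero[symmetric]) (simp only: mult_ac)
    then show ?thesis by simp
  qed
  finally show ?thesis .
qed


text \<open>The convolution identity passes through the integral in \<tau>. The weight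
  \<open>(1 + norm \<eta>) ^ 3\<close> is what \<open>abs_ft_bound\<close> leaves once
  \<open>peetre\<close> has split the shift \<open>\<xi> - \<eta>\<close>.\<close>

lemma fbp_kernel_mult:
  assumes \<rho>: "test_fun \<rho>" and \<psi>: "test_fun \<psi>" and \<theta>: "norm \<theta> = 1"
    and w: "integrable lborel (\<lambda>\<eta>. norm (ft \<rho> \<eta>) * (1 + norm \<eta>) ^ 3)"
    and F: "integrable lborel (ft \<rho>)"
  shows "of_real ((2 * pi) ^ DIM(real^2)) * fbp_kernel (modulate (\<lambda>x. \<rho> x * \<psi> x) \<xi>) (\<theta>, p)
    = (\<integral>\<eta>. ft \<rho> \<eta> * fbp_kernel (modulate \<psi> (\<xi> - \<eta>)) (\<theta>, p) \<partial>lborel)"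
proof -
  note [measurable] = test_fun_borel[OF \<rho>] test_fun_borel[OF \<psi>]
  obtain C where C: "C \<ge> 0" "\<And>\<eta>. norm (ft \<psi> \<eta>) \<le> C / (1 + norm \<eta>) ^ 3"
    using test_fun_ft_decay[OF \<psi>] by blast
  let ?c = "of_real ((2 * pi) ^ DIM(real^2)) :: complex"
  let ?h = "\<lambda>\<tau> \<eta>. ft \<rho> \<eta> * (of_real \<bar>\<tau>\<bar> * ft \<psi> (\<tau> *\<^sub>R \<theta> + \<xi> - \<eta>) * cis (\<tau> * p))"
  have "?c * fbp_kernel (modulate (\<lambda>x. \<rho> x * \<psi> x) \<xi>) (\<theta>, p)
    = (\<integral>\<tau>. of_real \<bar>\<tau>\<bar> * (?c * ft (\<lambda>x. \<rho> x * \<psi> x) (\<tau> *\<^sub>R \<theta> + \<xi>)) * cis (\<tau> * p) \<partial>lborel) / (8 * pi\<^sup>2)"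
    unfolding fbp_kernel_def ft_mult_cis times_divide_eq_right[of ?c] fst_conv snd_conv
    by (subst integral_mult_right_zero[symmetric]) (simp only: mult_ac)
  also have "\<dots> = (\<integral>\<tau>. \<integral>\<eta>. ?h \<tau> \<eta> \<partial>lborel \<partial>lborel) / (8 * pi\<^sup>2)"
  proof -
    have "of_real \<bar>\<tau>\<bar> * (?c * ft (\<lambda>x. \<rho> x * \<psi> x) (\<tau> *\<^sub>R \<theta> + \<xi>)) * cis (\<tau> * p) = (\<integral>\<eta>. ?h \<tau> \<eta> \<partial>lborel)" for \<tau>
      unfolding ft_mult_convolution[OF \<rho> \<psi> F]
      by (subst integral_mult_right_zero[symmetric], subst integral_mult_left_zero[symmetric])
        (simp only: mult_ac)
    then show ?thesis by (simp only:)
  qed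
  also have "(\<integral>\<tau>. \<integral>\<eta>. ?h \<tau> \<eta> \<partial>lborel \<partial>lborel) = (\<integral>\<eta>. \<integral>\<tau>. ?h \<tau> \<eta> \<partial>lborel \<partial>lborel)"
  proof (rule lborel_pair.Fubini_integral[symmetric])
    have i: "integrable (lborel \<Otimes>\<^sub>M lborel) (\<lambda>(\<tau>, \<eta>). (C * (1 + norm \<xi>) ^ 3 * (1 / (1 + \<tau>\<^sup>2))) * (norm (ft \<rho> \<eta>) * (1 + norm \<eta>) ^ 3))"
      by (intro lborel_pair.integrable_pair_mult w integrable_mult_right integrable_inverse_1_plus_square)
    show "integrable (lborel \<Otimes>\<^sub>M lborel) (\<lambda>(\<tau>, \<eta>). ?h \<tau> \<eta>)"
    proof (rule Bochner_Integration.integrable_bound[OF i])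
      show "AE z in lborel \<Otimes>\<^sub>M lborel. norm (case z of (\<tau>, \<eta>) \<Rightarrow> ?h \<tau> \<eta>)
        \<le> norm (case z of (\<tau>, \<eta>) \<Rightarrow> (C * (1 + norm \<xi>) ^ 3 * (1 / (1 + \<tau>\<^sup>2))) * (norm (ft \<rho> \<eta>) * (1 + norm \<eta>) ^ 3))"
      proof (rule AE_I2, clarify)
        fix \<tau> :: real and \<eta> :: "real^2"
        have "norm (?h \<tau> \<eta>) = norm (ft \<rho> \<eta>) * (\<bar>\<tau>\<bar> * norm (ft \<psi> (\<tau> *\<^sub>R \<theta> + (\<xi> - \<eta>))))"
          by (simp add: norm_mult add_diff_eq)
        also have "\<dots> \<le> norm (ft \<rho> \<eta>) * (C * (1 + norm (\<xi> - \<eta>)) ^ 3 * (1 / (1 + \<tau>\<^sup>2)))"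
          by (intro mult_left_mono abs_ft_bound C(2) \<theta>) auto
        also have "\<dots> \<le> norm (ft \<rho> \<eta>) * (C * ((1 + norm \<xi>) * (1 + norm \<eta>)) ^ 3 * (1 / (1 + \<tau>\<^sup>2)))"
          using peetre[of "\<xi> - \<eta>" \<eta>] C(1)
          by (intro mult_left_mono mult_right_mono power_mono) (auto simp: add_nonneg_nonneg)
        also have "\<dots> = (C * (1 + norm \<xi>) ^ 3 * (1 / (1 + \<tau>\<^sup>2))) * (norm (ft \<rho> \<eta>) * (1 + norm \<eta>) ^ 3)"
          unfolding power_mult_distrib by (simp only: mult_ac)
        finally show "norm (?h \<tau> \<eta>) \<le> norm ((C * (1 + norm \<xi>) ^ 3 * (1 / (1 + \<tau>\<^sup>2))) * (norm (ft \<rho> \<eta>) * (1 + norm \<eta>) ^ 3))"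
          by (rule order_trans[OF _ order_trans[OF abs_ge_self eq_refl[OF real_norm_def[symmetric]]]])
      qed
    qed measurable
  qed
  also have "\<dots> / (8 * pi\<^sup>2) = (\<integral>\<eta>. (\<integral>\<tau>. ?h \<tau> \<eta> \<partial>lborel) / (8 * pi\<^sup>2) \<partial>lborel)"
    by (rule integral_divide_zero[symmetric])
  also have "\<dots> = (\<integral>\<eta>. ft \<rho> \<eta> * fbp_kernel (modulate \<psi> (\<xi> - \<eta>)) (\<theta>, p) \<partial>lborel)"
    unfolding fbp_kernel_def ft_mult_cis fst_conv snd_conv
    by (simp only: integral_mult_right_zero times_divide_eq_right add_diff_eq)
  finally show ?thesis .
qed

text \<open>Multiplication by \<open>\<rho>\<close> before pairing becomes convolution with
  \<open>ft \<rho>\<close> in the modulation frequency, so decay can be studied on the frequency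
  side alone.\<close>

lemma fbp_mult:
  assumes g: "integrable cyl_measure g" and \<rho>: "test_fun \<rho>" and \<psi>: "test_fun \<psi>"
    and w: "integrable lborel (\<lambda>\<eta>. norm (ft \<rho> \<eta>) * (1 + norm \<eta>) ^ 3)"
    and F: "integrable lborel (ft \<rho>)"
  shows "of_real ((2 * pi) ^ DIM(real^2)) * fbp g (modulate (\<lambda>x. \<rho> x * \<psi> x) \<xi>)
    = (\<integral>\<eta>. ft \<rho> \<eta> * fbp g (modulate \<psi> (\<xi> - \<eta>)) \<partial>lborel)"
proof -
  note [measurable] = test_fun_borel[OF \<rho>] test_fun_borel[OF \<psi>]
  have gb[measurable]: "g \<in> borel_measurable borel"
    using borel_measurable_integrable[OF g] by (simp add: borel_measurable_cyl_iff)
  obtain C where C: "C \<ge> 0" "\<And>\<xi> \<theta> p. norm \<theta> = 1 \<Longrightarrow> norm (fbp_kernel (modulate \<psi> \<xi>) (\<theta>, p)) \<le> C * (1 + norm \<xi>) ^ 3"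
    using fbp_kernel_bound[OF \<psi>] by blast
  interpret P: pair_sigma_finite cyl_measure "lborel :: (real^2) measure" by standard
  let ?c = "of_real ((2 * pi) ^ DIM(real^2)) :: complex"
  let ?K = "\<lambda>z \<eta>. fbp_kernel (modulate \<psi> (\<xi> - \<eta>)) z"
  let ?h = "\<lambda>z \<eta>. g z * (ft \<rho> \<eta> * ?K z \<eta>)"
  have "?c * fbp g (modulate (\<lambda>x. \<rho> x * \<psi> x) \<xi>)
    = (\<integral>z. g z * (?c * fbp_kernel (modulate (\<lambda>x. \<rho> x * \<psi> x) \<xi>) z) \<partial>cyl_measure)"
    unfolding fbp_def by (subst integral_mult_right_zero[symmetric]) (simp only: mult.left_commute)
  also have "\<dots> = (\<integral>z. \<integral>\<eta>. ?h z \<eta> \<partial>lborel \<partial>cyl_measure)"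
  proof (rule integral_cong_AE)
    show "AE z in cyl_measure. g z * (?c * fbp_kernel (modulate (\<lambda>x. \<rho> x * \<psi> x) \<xi>) z) = (\<integral>\<eta>. ?h z \<eta> \<partial>lborel)"
      using AE_cyl_norm
    proof eventually_elim
      case (elim z)
      then show ?case
        using fbp_kernel_mult[OF \<rho> \<psi> elim w F, of \<xi> "snd z"] by (simp only: integral_mult_right_zero prod.collapse)
    qed
    have k: "fbp_kernel (modulate (\<lambda>x. \<rho> x * \<psi> x) \<xi>) \<in> borel_measurable borel"
      by (rule fbp_kernel_borel) measurable
    show "(\<lambda>z. g z * (?c * fbp_kernel (modulate (\<lambda>x. \<rho> x * \<psi> x) \<xi>) z)) \<in> borel_measurable cyl_measure"
      unfolding borel_measurable_cyl_iff by (intro borel_measurable_times borel_measurable_const gb k)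
    show "(\<lambda>z. \<integral>\<eta>. ?h z \<eta> \<partial>lborel) \<in> borel_measurable cyl_measure"
      unfolding borel_measurable_cyl_iff fbp_kernel_def ft_mult_cis by measurable
  qed
  also have "\<dots> = (\<integral>\<eta>. \<integral>z. ?h z \<eta> \<partial>cyl_measure \<partial>lborel)"
  proof (rule P.Fubini_integral[symmetric])
    have i: "integrable (cyl_measure \<Otimes>\<^sub>M lborel) (\<lambda>(z, \<eta>). (C * (1 + norm \<xi>) ^ 3 * norm (g z)) * (norm (ft \<rho> \<eta>) * (1 + norm \<eta>) ^ 3))"
      by (intro P.integrable_pair_mult w integrable_mult_right integrable_norm g)
    show "integrable (cyl_measure \<Otimes>\<^sub>M lborel) (\<lambda>(z, \<eta>). ?h z \<eta>)"
    proof (rule Bochner_Integration.integrable_bound[OF i])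
      have "AE z in cyl_measure. \<forall>\<eta>. norm (?h z \<eta>) \<le> norm ((C * (1 + norm \<xi>) ^ 3 * norm (g z)) * (norm (ft \<rho> \<eta>) * (1 + norm \<eta>) ^ 3))"
        using AE_cyl_norm
      proof eventually_elim
        case (elim z)
        show ?case
        proof
          fix \<eta>
          have "norm (?h z \<eta>) = norm (g z) * (norm (ft \<rho> \<eta>) * norm (?K z \<eta>))"
            by (simp add: norm_mult)
          also have "\<dots> \<le> norm (g z) * (norm (ft \<rho> \<eta>) * (C * (1 + norm (\<xi> - \<eta>)) ^ 3))"
            using C(2)[OF elim, of "\<xi> - \<eta>" "snd z"] by (intro mult_left_mono) auto
          also have "\<dots> \<le> norm (g z) * (norm (ft \<rho> \<eta>) * (C * ((1 + norm \<xi>) * (1 + norm \<eta>)) ^ 3))"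
            using peetre[of "\<xi> - \<eta>" \<eta>] C(1) norm_triangle_ineq4[of \<xi> \<eta>]
            by (intro mult_left_mono mult_right_mono power_mono) (auto simp: algebra_simps add_nonneg_nonneg)
          also have "\<dots> = (C * (1 + norm \<xi>) ^ 3 * norm (g z)) * (norm (ft \<rho> \<eta>) * (1 + norm \<eta>) ^ 3)"
            unfolding power_mult_distrib by (simp only: mult_ac)
          finally show "norm (?h z \<eta>) \<le> norm ((C * (1 + norm \<xi>) ^ 3 * norm (g z)) * (norm (ft \<rho> \<eta>) * (1 + norm \<eta>) ^ 3))"
            by (rule order_trans[OF _ order_trans[OF abs_ge_self eq_refl[OF real_norm_def[symmetric]]]])
        qed
      qed
      \<comment> \<open>The bound holds for almost every z and then for all \<eta> at once, so the
        exceptional set in the product lies over a null set N of the first factor.\<close>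
      then obtain N where N: "N \<in> null_sets cyl_measure"
        "{z \<in> space cyl_measure. \<not> (\<forall>\<eta>. norm (?h z \<eta>) \<le> norm ((C * (1 + norm \<xi>) ^ 3 * norm (g z)) * (norm (ft \<rho> \<eta>) * (1 + norm \<eta>) ^ 3)))} \<subseteq> N"
        by (auto simp: eventually_ae_filter)
      have "AE y in cyl_measure \<Otimes>\<^sub>M (lborel :: (real^2) measure). fst y \<notin> N"
      proof (rule P.AE_pair_measure)
        have [measurable]: "N \<in> sets cyl_measure" using N(1) by auto
        show "{y \<in> space (cyl_measure \<Otimes>\<^sub>M (lborel :: (real^2) measure)). fst y \<notin> N} \<in> sets (cyl_measure \<Otimes>\<^sub>M lborel)"
          by measurable
        show "AE x in cyl_measure. AE y in (lborel :: (real^2) measure). fst (x, y) \<notin> N"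
          using AE_not_in[OF N(1)] by eventually_elim simp
      qed
      then show "AE y in cyl_measure \<Otimes>\<^sub>M lborel. norm (case y of (z, \<eta>) \<Rightarrow> ?h z \<eta>)
        \<le> norm (case y of (z, \<eta>) \<Rightarrow> (C * (1 + norm \<xi>) ^ 3 * norm (g z)) * (norm (ft \<rho> \<eta>) * (1 + norm \<eta>) ^ 3))"
      proof eventually_elim
        case (elim y)
        then show ?case using N(2) by (auto split: prod.split)
      qed
    next
      have "(\<lambda>(z, \<eta>). ?h z \<eta>) \<in> borel_measurable (borel \<Otimes>\<^sub>M borel)"
        unfolding fbp_kernel_def ft_mult_cis by measurable
      then show "(\<lambda>(z, \<eta>). ?h z \<eta>) \<in> borel_measurable (cyl_measure \<Otimes>\<^sub>M lborel)"
        by (simp add: measurable_cong_sets[OF sets_pair_measure_cong[OF sets_cyl_measure sets_lborel] refl])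
    qed
  qed
  also have "\<dots> = (\<integral>\<eta>. ft \<rho> \<eta> * fbp g (modulate \<psi> (\<xi> - \<eta>)) \<partial>lborel)"
    unfolding fbp_def
    by (subst integral_mult_right_zero[symmetric]) (simp only: mult.left_commute)
  finally show ?thesis .
qed

lemma fbp_bound:
  assumes g: "integrable cyl_measure g" and \<psi>: "test_fun \<psi>"
  shows "\<exists>G\<ge>0. \<forall>\<xi>. norm (fbp g (modulate \<psi> \<xi>)) \<le> G * (1 + norm \<xi>) ^ 3"
proof -
  obtain C where C: "C \<ge> 0" "\<And>\<xi> \<theta> p. norm \<theta> = 1 \<Longrightarrow> norm (fbp_kernel (modulate \<psi> \<xi>) (\<theta>, p)) \<le> C * (1 + norm \<xi>) ^ 3"
    using fbp_kernel_bound[OF \<psi>] by blast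
  have "norm (fbp g (modulate \<psi> \<xi>)) \<le> (\<integral>z. norm (g z) \<partial>cyl_measure) * (C * (1 + norm \<xi>) ^ 3)" for \<xi>
  proof (rule norm_fbp_le[OF g test_fun_mult_cis[OF \<psi>]])
    show "AE z in cyl_measure. g z = 0 \<or> norm (fbp_kernel (modulate \<psi> \<xi>) z) \<le> C * (1 + norm \<xi>) ^ 3"
      using AE_cyl_norm
    proof eventually_elim
      case (elim z)
      then show ?case using C(2)[of "fst z" \<xi> "snd z"] by simp
    qed
  qed
  then show ?thesis using C(1)
    by (intro exI[of _ "(\<integral>z. norm (g z) \<partial>cyl_measure) * C"]) (auto simp: mult.assoc intro!: mult_nonneg_nonneg)
qed

text \<open>For \<open>norm \<eta> \<le> c * norm \<xi>\<close> the shifted frequency stays where E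
  decays; otherwise decay of r in \<eta> is also decay in \<xi>. In the second case k + 10 splits
  into k for the decay claimed, 3 for the growth of E in \<xi>, 3 for its growth in \<eta>, and 4
  for integrability over the plane.\<close>

lemma localized_decay_estimate:
  fixes E r :: "'a::real_normed_vector \<Rightarrow> complex"
  assumes G: "G \<ge> 0" "\<And>\<xi>. norm (E \<xi>) \<le> G * (1 + norm \<xi>) ^ 3"
    and D: "D \<ge> 0" "\<And>\<eta>. norm (r \<eta>) \<le> D / (1 + norm \<eta>) ^ (k + 10)"
    and c: "0 < c" "c \<le> 1"
    and C: "C \<ge> 0" "norm \<eta> \<le> c * norm \<xi> \<Longrightarrow> norm (E (\<xi> - \<eta>)) \<le> C / (1 + norm (\<xi> - \<eta>)) ^ k"
  shows "norm (r \<eta> * E (\<xi> - \<eta>)) \<le> (C * D + G * D / c ^ (k + 3)) / (1 + norm \<xi>) ^ k * (1 / (1 + norm \<eta>) ^ 4)"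
proof -
  let ?X = "1 + norm \<xi>" and ?Y = "1 + norm \<eta>" and ?Z = "1 + norm (\<xi> - \<eta>)"
  have pos: "?X \<ge> 1" "?Y \<ge> 1" "?Z \<ge> 1" by auto
  have pos': "?X > 0" "?Y > 0" "?Z > 0" by (auto intro: add_pos_nonneg)
  have "norm (r \<eta> * E (\<xi> - \<eta>)) \<le> D / ?Y ^ (k + 10) * norm (E (\<xi> - \<eta>))"
    unfolding norm_mult by (intro mult_right_mono D) auto
  also have "\<dots> \<le> (C * D + G * D / c ^ (k + 3)) / ?X ^ k * (1 / ?Y ^ 4)"
  proof (cases "norm \<eta> \<le> c * norm \<xi>")
    case True
    have "?X \<le> ?Z * ?Y" using peetre[of \<xi> "- \<eta>"] by simp
    then have "?X ^ k \<le> ?Z ^ k * ?Y ^ k" using pos' by (simp only: power_mult_distrib[symmetric]) (intro power_mono, auto)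
    then have 1: "C / ?Z ^ k \<le> C * ?Y ^ k / ?X ^ k"
      using C(1) pos' by (simp add: pos_divide_le_eq pos_le_divide_eq mult_left_mono mult.assoc mult.commute[of "?Z ^ k"])
    have "?Y ^ k * ?Y ^ 4 \<le> ?Y ^ (k + 10)"
      using pos by (simp only: power_add[symmetric]) (intro power_increasing, auto)
    then have 2: "?Y ^ k / ?Y ^ (k + 10) \<le> 1 / ?Y ^ 4"
      using pos' by (simp add: pos_divide_le_eq pos_le_divide_eq)
    have "D / ?Y ^ (k + 10) * norm (E (\<xi> - \<eta>)) \<le> D / ?Y ^ (k + 10) * (C * ?Y ^ k / ?X ^ k)"
      using D(1) pos' C(2)[OF True] 1 by (intro mult_left_mono) auto
    also have "\<dots> = C * D / ?X ^ k * (?Y ^ k / ?Y ^ (k + 10))" by (simp add: mult_ac)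
    also have "\<dots> \<le> C * D / ?X ^ k * (1 / ?Y ^ 4)"
      using C(1) D(1) pos' by (intro mult_left_mono 2) auto
    also have "\<dots> \<le> (C * D + G * D / c ^ (k + 3)) / ?X ^ k * (1 / ?Y ^ 4)"
      using G(1) D(1) c pos' by (intro mult_right_mono divide_right_mono) auto
    finally show ?thesis .
  next
    case False
    have "?Z \<le> ?X * ?Y" using peetre[of "\<xi> - \<eta>" \<eta>] norm_triangle_ineq4[of \<xi> \<eta>]
      by (simp add: algebra_simps)
    then have "?Z ^ 3 \<le> ?X ^ 3 * ?Y ^ 3" using pos' by (simp only: power_mult_distrib[symmetric]) (intro power_mono, auto)
    then have 1: "norm (E (\<xi> - \<eta>)) \<le> G * (?X ^ 3 * ?Y ^ 3)"
      using order_trans[OF G(2)[of "\<xi> - \<eta>"] mult_left_mono[OF _ G(1)]] by blast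
    have "c * ?X \<le> ?Y" using False c by (simp add: algebra_simps)
    then have "(c * ?X) ^ (k + 3) \<le> ?Y ^ (k + 3)" using c pos' by (intro power_mono) auto
    then have "?X ^ k * ?X ^ 3 * ?Y ^ 7 \<le> ?Y ^ (k + 3) / c ^ (k + 3) * ?Y ^ 7"
      using c pos' by (intro mult_right_mono) (auto simp: pos_le_divide_eq power_mult_distrib power_add mult_ac)
    also have "\<dots> = ?Y ^ (k + 10) / c ^ (k + 3)" by (simp add: power_add[symmetric] add.commute)
    finally have K: "?X ^ k * ?X ^ 3 * ?Y ^ 7 \<le> ?Y ^ (k + 10) / c ^ (k + 3)" .
    have 2: "?X ^ 3 * ?Y ^ 3 / ?Y ^ (k + 10) \<le> 1 / c ^ (k + 3) / ?X ^ k * (1 / ?Y ^ 4)"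
    proof -
      have "?Y ^ 7 = ?Y ^ 3 * ?Y ^ 4" by (simp add: power_add[symmetric])
      then have "(?X ^ 3 * ?Y ^ 3) * (c ^ (k + 3) * ?X ^ k * ?Y ^ 4) \<le> ?Y ^ (k + 10)"
        using K c by (simp only: pos_le_divide_eq zero_less_power mult_ac)
      moreover have "a / N \<le> 1 / d / x * (1 / f)"
        if "a * (d * x * f) \<le> N" "d > 0" "x > 0" "f > 0" "N > 0" for a d x f N :: real
        using that by (simp add: pos_divide_le_eq pos_le_divide_eq mult_ac)
      ultimately show ?thesis using pos' c by (metis zero_less_power)
    qed
    have "D / ?Y ^ (k + 10) * norm (E (\<xi> - \<eta>)) \<le> D / ?Y ^ (k + 10) * (G * (?X ^ 3 * ?Y ^ 3))"
      using D(1) pos' by (intro mult_left_mono 1) auto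
    also have "\<dots> = G * D * (?X ^ 3 * ?Y ^ 3 / ?Y ^ (k + 10))" by (simp add: mult_ac)
    also have "\<dots> \<le> G * D * (1 / c ^ (k + 3) / ?X ^ k * (1 / ?Y ^ 4))"
      using G(1) D(1) by (intro mult_left_mono 2) auto
    also have "\<dots> = (G * D / c ^ (k + 3)) / ?X ^ k * (1 / ?Y ^ 4)" by simp
    also have "\<dots> \<le> (C * D + G * D / c ^ (k + 3)) / ?X ^ k * (1 / ?Y ^ 4)"
      using C(1) D(1) pos' by (intro mult_right_mono divide_right_mono) auto
    finally show ?thesis .
  qed
  finally show ?thesis .
qed

lemma integrable_inverse_power4: "integrable lborel (\<lambda>\<eta>::real^2. 1 / (1 + norm \<eta>) ^ 4)"
  using integrable_inverse_power_norm[where 'a="real^2"] by simp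

text \<open>Decay inside V, polynomial growth elsewhere and rapid decay of \<open>ft \<rho>\<close>
  combine in the convolution over \<eta>. The shrunken cone comes from V and \<xi>0 alone and hence
  does not depend on \<open>\<rho>\<close>.\<close>

lemma fbp_localize:
  assumes g: "integrable cyl_measure g" and \<psi>: "test_fun \<psi>"
    and V: "open_cone V" "\<xi>0 \<in> V"
    and decay: "rapidly_decaying_on V (\<lambda>\<xi>. fbp g (modulate \<psi> \<xi>))"
  shows "\<exists>V'. open_cone V' \<and> \<xi>0 \<in> V' \<and> (\<forall>\<rho>. test_fun \<rho> \<longrightarrow>
    rapidly_decaying_on V' (\<lambda>\<xi>. fbp g (modulate (\<lambda>x. \<rho> x * \<psi> x) \<xi>)))"
proof -
  obtain V' c where V': "open_cone V'" "\<xi>0 \<in> V'" and c: "0 < c" "c \<le> 1"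
    and sub: "\<And>\<xi> \<eta>. \<xi> \<in> V' \<Longrightarrow> norm \<eta> \<le> c * norm \<xi> \<Longrightarrow> \<xi> - \<eta> \<in> V"
    using shrink_open_cone[OF V] by blast
  let ?E = "\<lambda>\<xi>. fbp g (modulate \<psi> \<xi>)"
  obtain G where G: "G \<ge> 0" "\<And>\<xi>. norm (?E \<xi>) \<le> G * (1 + norm \<xi>) ^ 3"
    using fbp_bound[OF g \<psi>] by blast
  have "rapidly_decaying_on V' (\<lambda>\<xi>. fbp g (modulate (\<lambda>x. \<rho> x * \<psi> x) \<xi>))" if \<rho>: "test_fun \<rho>" for \<rho>
    unfolding rapidly_decaying_on_def
  proof
    fix k :: nat
    note [measurable] = test_fun_borel[OF \<rho>]
    obtain D where D: "D \<ge> 0" "\<And>\<eta>. norm (ft \<rho> \<eta>) \<le> D / (1 + norm \<eta>) ^ (k + 10)"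
      using test_fun_ft_decay[OF \<rho>] by blast
    \<comment> \<open>Seven powers: three for the weight and four for integrability over the
      plane.\<close>
    obtain D7 where D7: "D7 \<ge> 0" "\<And>\<eta>. norm (ft \<rho> \<eta>) \<le> D7 / (1 + norm \<eta>) ^ 7"
      using test_fun_ft_decay[OF \<rho>] by blast
    obtain C0 where C0: "\<And>\<xi>. \<xi> \<in> V \<Longrightarrow> norm (?E \<xi>) \<le> C0 / (1 + norm \<xi>) ^ k"
      using decay unfolding rapidly_decaying_on_def by blast
    define C where "C = max C0 0"
    have C: "C \<ge> 0" "norm (?E \<xi>) \<le> C / (1 + norm \<xi>) ^ k" if "\<xi> \<in> V" for \<xi>
      using order_trans[OF C0[OF that] divide_right_mono[of C0 C]] by (auto simp: C_def)
    have C': "C \<ge> 0" by (simp add: C_def)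
    have w: "integrable lborel (\<lambda>\<eta>. norm (ft \<rho> \<eta>) * (1 + norm \<eta>) ^ 3)"
    proof (rule Bochner_Integration.integrable_bound[OF integrable_mult_right[OF integrable_inverse_power4, of D7]])
      show "AE \<eta> in lborel. norm (norm (ft \<rho> \<eta>) * (1 + norm \<eta>) ^ 3) \<le> norm (D7 * (1 / (1 + norm \<eta>) ^ 4))"
      proof (rule AE_I2)
        fix \<eta> :: "real^2"
        have p: "1 + norm \<eta> > 0" by (simp add: add_pos_nonneg)
        have "norm (ft \<rho> \<eta>) * (1 + norm \<eta>) ^ 3 \<le> D7 / (1 + norm \<eta>) ^ 7 * (1 + norm \<eta>) ^ 3"
          by (intro mult_right_mono D7) auto
        also have "\<dots> = D7 * (1 / (1 + norm \<eta>) ^ 4)"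
        proof -
          have "(1 + norm \<eta>) ^ 7 = (1 + norm \<eta>) ^ 4 * (1 + norm \<eta>) ^ 3" by (simp add: power_add[symmetric])
          moreover have "D7 / (a * b) * b = D7 * (1 / a)" if "b \<noteq> 0" for a b :: real using that by simp
          ultimately show ?thesis using p by (metis less_irrefl zero_less_power)
        qed
        finally show "norm (norm (ft \<rho> \<eta>) * (1 + norm \<eta>) ^ 3) \<le> norm (D7 * (1 / (1 + norm \<eta>) ^ 4))"
          using D7(1) by simp
      qed
    qed measurable
    have F: "integrable lborel (ft \<rho>)"
    proof (rule Bochner_Integration.integrable_bound[OF w])
      show "AE \<eta> in lborel. norm (ft \<rho> \<eta>) \<le> norm (norm (ft \<rho> \<eta>) * (1 + norm \<eta>) ^ 3)"
      proof (rule AE_I2)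
        fix \<eta> :: "real^2"
        have "1 \<le> (1 + norm \<eta>) ^ 3" by (intro one_le_power) simp
        then show "norm (ft \<rho> \<eta>) \<le> norm (norm (ft \<rho> \<eta>) * (1 + norm \<eta>) ^ 3)"
          using mult_left_mono[of 1 "(1 + norm \<eta>) ^ 3" "norm (ft \<rho> \<eta>)"] by simp
      qed
    qed measurable
    let ?M = "C * D + G * D / c ^ (k + 3)"
    let ?J = "\<integral>\<eta>. 1 / (1 + norm \<eta>) ^ 4 \<partial>(lborel :: (real^2) measure)"
    have "norm (fbp g (modulate (\<lambda>x. \<rho> x * \<psi> x) \<xi>)) \<le> (?M * ?J) / (1 + norm \<xi>) ^ k" if \<xi>: "\<xi> \<in> V'" for \<xi>
    proof -
      let ?f = "fbp g (modulate (\<lambda>x. \<rho> x * \<psi> x) \<xi>)"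
      have "norm (of_real ((2 * pi) ^ DIM(real^2)) * ?f) \<le> (\<integral>\<eta>. norm (ft \<rho> \<eta> * ?E (\<xi> - \<eta>)) \<partial>lborel)"
        unfolding fbp_mult[OF g \<rho> \<psi> w F] by (rule integral_norm_bound)
      also have "\<dots> \<le> (\<integral>\<eta>. ?M / (1 + norm \<xi>) ^ k * (1 / (1 + norm (\<eta> :: real^2)) ^ 4) \<partial>lborel)"
      proof (rule integral_mono')
        show "integrable lborel (\<lambda>\<eta>::real^2. ?M / (1 + norm \<xi>) ^ k * (1 / (1 + norm \<eta>) ^ 4))"
          by (intro integrable_mult_right integrable_inverse_power4)
        show "norm (ft \<rho> \<eta> * ?E (\<xi> - \<eta>)) \<le> ?M / (1 + norm \<xi>) ^ k * (1 / (1 + norm \<eta>) ^ 4)" for \<eta>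
          by (rule localized_decay_estimate[where E="?E" and r="ft \<rho>", OF G D c C']) (use C sub[OF \<xi>] in auto)
        show "0 \<le> ?M / (1 + norm \<xi>) ^ k * (1 / (1 + norm \<eta>) ^ 4)" for \<eta> :: "real^2"
          using C' D(1) G(1) c by (intro mult_nonneg_nonneg divide_nonneg_nonneg add_nonneg_nonneg) auto
      qed
      also have "\<dots> = (?M * ?J) / (1 + norm \<xi>) ^ k"
        unfolding integral_mult_right_zero by simp
      also have "norm ?f \<le> norm (of_real ((2 * pi) ^ DIM(real^2)) * ?f)"
      proof -
        have "1 \<le> (2 * pi) ^ DIM(real^2)" using pi_gt3 by (intro one_le_power) simp
        then show ?thesis
          using mult_right_mono[of 1 "(2 * pi) ^ DIM(real^2)" "norm ?f"]
          by (simp only: norm_mult norm_of_real) (simp add: abs_of_nonneg)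
      qed
      finally show ?thesis .
    qed
    then show "\<exists>C. \<forall>\<xi>\<in>V'. norm (fbp g (modulate (\<lambda>x. \<rho> x * \<psi> x) \<xi>)) \<le> C / (1 + norm \<xi>) ^ k" by blast
  qed
  with V' show ?thesis by blast
qed


section \<open>Locally vanishing data\<close>

lemma smooth_box_bump_circ: "smooth (\<lambda>(s, p :: real). box_bump n a b (circ s, p))"
  unfolding smooth_def case_prod_unfold
proof
  fix k
  have "Ck k (\<lambda>x :: real \<times> real. (circ (fst x), snd x) \<bullet> i)" if "i \<in> Basis" for i
  proof -
    from that consider "i = (axis 1 1, 0)" | "i = (axis 2 1, 0)" | "i = (0, 1)"
      by (auto simp: Basis_prod_def Basis_real2)
    then show ?thesis
      by cases (simp_all add: inner_axis Ck_cos_compose Ck_sin_compose Ck_bounded_linear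
          bounded_linear_fst bounded_linear_snd)
  qed
  then show "Ck k (\<lambda>x. box_bump n a b (circ (fst x), snd x))"
    by (rule Ck_box_bump_compose)
qed

lemma box_bump_borel: "box_bump n a b \<in> borel_measurable borel"
proof (rule borel_measurable_continuous_onI)
  have "Ck 0 (\<lambda>x. box_bump n a b x)"
    by (rule Ck_box_bump_compose) (intro Ck_bounded_linear bounded_linear_inner_left)
  then show "continuous_on UNIV (box_bump n a b)" by simp
qed

lemma closed_cyl: "closed cyl"
  unfolding cyl_def by (intro closed_Times closed_UNIV closed_sphere)

lemma AE_cyl: "AE z in cyl_measure. z \<in> cyl"
  using AE_cyl_norm by eventually_elim (auto simp: cyl_def mem_Times_iff)

text \<open>Bumps of increasing steepness on one box are test functions supported in U, and they
  converge boundedly to the indicator of the open box.\<close>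

lemma cyl_integral_box_eq_0:
  assumes g: "integrable cyl_measure g"
    and zero: "\<And>h. cyl_test_fun h \<Longrightarrow> closure (support_on cyl h) \<subseteq> U \<Longrightarrow> cyl_dist_of g h = 0"
    and sub: "cyl \<inter> cbox a b \<subseteq> U"
  shows "(\<integral>z. g z * indicator (box a b) z \<partial>cyl_measure) = 0"
proof -
  have gb[measurable]: "g \<in> borel_measurable borel"
    using borel_measurable_integrable[OF g] by (simp add: borel_measurable_cyl_iff)
  note bm = box_bump_borel
  let ?h = "\<lambda>n. box_bump (real (Suc n)) a b"
  have gi: "integrable cyl_measure (\<lambda>z. g z * ?h n z)" for n
  proof (rule Bochner_Integration.integrable_bound[OF g])
    show "(\<lambda>z. g z * ?h n z) \<in> borel_measurable cyl_measure"
      unfolding borel_measurable_cyl_iff by (intro borel_measurable_times gb bm)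
    show "AE z in cyl_measure. norm (g z * ?h n z) \<le> norm (g z)"
      by (simp add: norm_mult mult_left_le norm_box_bump_le)
  qed
  have "(\<integral>z. g z * ?h n z \<partial>cyl_measure) = 0" for n
  proof -
    have K: "compact (cyl \<inter> cbox a b)" by (intro closed_Int_compact closed_cyl compact_cbox)
    have v: "?h n z = 0" if "z \<in> cyl" "z \<notin> cyl \<inter> cbox a b" for z
      using that box_subset_cbox[of a b] by (intro box_bump_eq_0) auto
    note s = support_on_closure_compact[of "cyl \<inter> cbox a b" cyl "?h n", OF K v]
    have "cyl_dist_of g (?h n) = 0"
    proof (rule zero)
      show "cyl_test_fun (?h n)"
        unfolding cyl_test_fun_def using s(1) smooth_box_bump_circ by blast
      show "closure (support_on cyl (?h n)) \<subseteq> U" using s(2) sub by blast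
    qed
    then show ?thesis using cyl_dist_of_eq_integral[OF gi refl] by simp
  qed
  moreover have "(\<lambda>n. \<integral>z. g z * ?h n z \<partial>cyl_measure) \<longlonglongrightarrow> (\<integral>z. g z * indicator (box a b) z \<partial>cyl_measure)"
  proof (rule integral_dominated_convergence[where w="\<lambda>z. norm (g z)"])
    show "(\<lambda>z. g z * indicator (box a b) z) \<in> borel_measurable cyl_measure"
      unfolding borel_measurable_cyl_iff by measurable
    show "AE z in cyl_measure. (\<lambda>n. g z * ?h n z) \<longlonglongrightarrow> g z * indicator (box a b) z"
      by (intro AE_I2 tendsto_mult tendsto_const box_bump_tendsto)
  qed (use g gi in \<open>auto simp: norm_mult mult_left_le norm_box_bump_le\<close>)
  ultimately show ?thesis by (simp add: LIMSEQ_const_iff)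
qed

text \<open>Boxes are stable under intersection and generate the Borel sets, and the sets X
  satisfying the claim form a Dynkin class. Intersecting with the fixed box keeps every test
  function inside U.\<close>

lemma cyl_integral_borel_eq_0:
  assumes g: "integrable cyl_measure g"
    and zero: "\<And>h. cyl_test_fun h \<Longrightarrow> closure (support_on cyl h) \<subseteq> U \<Longrightarrow> cyl_dist_of g h = 0"
    and sub: "cyl \<inter> cbox a b \<subseteq> U" and X: "X \<in> sets borel"
  shows "(\<integral>z. indicator (X \<inter> box a b) z *\<^sub>R g z \<partial>cyl_measure) = 0"
proof -
  have i: "integrable cyl_measure (\<lambda>z. indicator (Y \<inter> box a b) z *\<^sub>R g z)" if "Y \<in> sets borel" for Y
    by (rule integrable_mult_indicator) (use that g in auto)
  have box0: "(\<integral>z. indicator (box c d \<inter> box a b) z *\<^sub>R g z \<partial>cyl_measure) = 0" for c d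
  proof -
    obtain l u where lu: "box c d \<inter> box a b = box l u" using box_Int_box by blast
    \<comment> \<open>An empty \<open>box l u\<close> may have corners whose closed box is nonempty
      and leaves \<open>cbox a b\<close>. That case is split off; its integral is trivially
      0.\<close>
    have sub': "cyl \<inter> cbox l u \<subseteq> U" if "box l u \<noteq> {}"
    proof -
      have "cbox l u = closure (box l u)" using that by (simp add: closure_box)
      also have "\<dots> \<subseteq> cbox a b" by (rule closure_minimal) (use lu box_subset_cbox[of a b] in auto)
      finally show ?thesis using sub by blast
    qed
    show ?thesis
    proof (cases "box l u = {}")
      case False
      have "(\<integral>z. indicator (box l u) z *\<^sub>R g z \<partial>cyl_measure) = (\<integral>z. g z * indicator (box l u) z \<partial>cyl_measure)"
        by (rule Bochner_Integration.integral_cong) (auto simp: indicator_def)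
      then show ?thesis using cyl_integral_box_eq_0[OF g zero sub'[OF False]] by (simp add: lu)
    qed (simp add: lu)
  qed
  let ?G = "range (\<lambda>(a, b). box a b :: ((real^2) \<times> real) set)"
  have st: "Int_stable ?G" by (auto simp: Int_stable_def box_Int_box)
  have Xs: "X \<in> sigma_sets UNIV ?G" using X by (simp add: borel_eq_box)
  have sb: "Y \<in> sets borel" if "Y \<in> sigma_sets UNIV ?G" for Y using that by (simp add: borel_eq_box)
  show ?thesis
    using st subset_UNIV[of ?G, folded Pow_UNIV] Xs
  proof (induction rule: sigma_sets_induct_disjoint)
    case (basic Y)
    then show ?case using box0 by auto
  next
    case empty
    then show ?case by simp
  next
    case (compl Y)
    have "(\<integral>z. indicator ((UNIV - Y) \<inter> box a b) z *\<^sub>R g z \<partial>cyl_measure)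
        = (\<integral>z. indicator (box a b \<inter> box a b) z *\<^sub>R g z - indicator (Y \<inter> box a b) z *\<^sub>R g z \<partial>cyl_measure)"
      by (rule Bochner_Integration.integral_cong) (auto simp: indicator_def)
    also have "\<dots> = 0"
      using i[OF sb[OF compl(1)]] i[of "box a b"] box0[of a b] compl(2) by (subst Bochner_Integration.integral_diff) auto
    finally show ?case .
  next
    case (union Y)
    have Y: "Y n \<in> sets borel" for n using sb union(2) by blast
    have "(\<integral>z\<in>(\<Union>n. Y n \<inter> box a b). g z \<partial>cyl_measure) = (\<Sum>n. \<integral>z\<in>(Y n \<inter> box a b). g z \<partial>cyl_measure)"
    proof (rule lebesgue_integral_countable_add)
      show "Y n \<inter> box a b \<in> sets cyl_measure" for n using Y by auto
      show "(Y n \<inter> box a b) \<inter> (Y m \<inter> box a b) = {}" if "n \<noteq> m" for n m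
        using union(1) that by (auto simp: disjoint_family_on_def)
      show "set_integrable cyl_measure (\<Union>n. Y n \<inter> box a b) g"
        unfolding set_integrable_def using Y by (intro integrable_mult_indicator g) auto
    qed
    also have "\<dots> = 0" using union(3) by (simp add: set_lebesgue_integral_def)
    also have "(\<Union>n. Y n \<inter> box a b) = (\<Union>n. Y n) \<inter> box a b" by blast
    finally show ?case by (simp add: set_lebesgue_integral_def)
  qed
qed

text \<open>On a small box all integrals of g over Borel subsets vanish. Taking the subset where a
  real functional of g is positive shows that this functional is nonpositive almost everywhere; the
  real part, the imaginary part and their negatives together force g to vanish.\<close>

lemma AE_eq_0_outside_cyl_dist_support:
  assumes g: "integrable cyl_measure g" and z0: "z0 \<in> cyl" "z0 \<notin> cyl_dist_support (cyl_dist_of g)"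
  shows "\<exists>\<epsilon>>0. AE z in cyl_measure. dist z z0 < \<epsilon> \<longrightarrow> g z = 0"
proof -
  have gb[measurable]: "g \<in> borel_measurable borel"
    using borel_measurable_integrable[OF g] by (simp add: borel_measurable_cyl_iff)
  obtain U where U: "openin cyl_top U" "z0 \<in> U"
    and zero: "\<And>h. cyl_test_fun h \<Longrightarrow> closure (support_on cyl h) \<subseteq> U \<Longrightarrow> cyl_dist_of g h = 0"
    using z0 unfolding cyl_dist_support_def by blast
  obtain T where T: "open T" "U = cyl \<inter> T" using U(1) by (auto simp: openin_open)
  obtain a b where ab: "cbox a b \<subseteq> T" "z0 \<in> box a b"
    using open_contains_cbox[of T z0] T U(2) by (metis IntD2)
  have sub: "cyl \<inter> cbox a b \<subseteq> U" using ab T by auto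
  have nonpos: "AE z in cyl_measure. z \<in> box a b \<longrightarrow> L (g z) \<le> 0" if L: "bounded_linear L" for L :: "complex \<Rightarrow> real"
  proof -
    have [measurable]: "L \<in> borel_measurable borel"
      using L by (intro borel_measurable_continuous_onI linear_continuous_on)
    let ?X = "{z. L (g z) > 0}"
    have X: "?X \<in> sets borel" by measurable
    let ?h = "\<lambda>z. indicator (?X \<inter> box a b) z *\<^sub>R g z"
    have hi: "integrable cyl_measure ?h"
      by (rule integrable_mult_indicator) (use X g in auto)
    have "(\<integral>z. L (?h z) \<partial>cyl_measure) = L (\<integral>z. ?h z \<partial>cyl_measure)"
      by (rule integral_bounded_linear[OF L hi])
    also have "\<dots> = 0"
      using cyl_integral_borel_eq_0[OF g zero sub X] linear_0[OF bounded_linear.linear[OF L]] by simp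
    finally have "(\<integral>z. L (?h z) \<partial>cyl_measure) = 0" .
    moreover have "L (?h z) \<ge> 0" for z
      by (auto simp: indicator_def linear_0[OF bounded_linear.linear[OF L]])
    ultimately have "AE z in cyl_measure. L (?h z) = 0"
      using integral_nonneg_eq_0_iff_AE[OF integrable_bounded_linear[OF L hi]] by auto
    then show ?thesis
    proof eventually_elim
      case (elim z)
      show ?case
      proof (intro impI, rule ccontr)
        assume "z \<in> box a b" "\<not> L (g z) \<le> 0"
        then have "?h z = g z" "L (g z) > 0" by (auto simp: indicator_def)
        with elim show False by simp
      qed
    qed
  qed
  have "AE z in cyl_measure. z \<in> box a b \<longrightarrow> g z = 0"
    using nonpos[OF bounded_linear_Re] nonpos[OF bounded_linear_Im]
      nonpos[OF bounded_linear_minus[OF bounded_linear_Re]] nonpos[OF bounded_linear_minus[OF bounded_linear_Im]]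
    by eventually_elim (auto simp: complex_eq_iff)
  moreover obtain \<epsilon> where "\<epsilon> > 0" "ball z0 \<epsilon> \<subseteq> box a b"
    using open_box ab(2) openE by blast
  ultimately show ?thesis
    by (intro exI[of _ \<epsilon>]) (auto simp: dist_commute elim!: eventually_mono)
qed

text \<open>The antipode is included because z0 and -z0 describe the same line, so the directions
  \<theta> and -\<theta> see the same data.\<close>

definition zero_near :: "((real^2) \<times> real \<Rightarrow> complex) \<Rightarrow> (real^2) \<times> real \<Rightarrow> bool" where
  "zero_near g z0 \<longleftrightarrow> (\<exists>\<epsilon>>0. AE z in cyl_measure. dist z z0 < \<epsilon> \<or> dist (- z) z0 < \<epsilon> \<longrightarrow> g z = 0)"

lemma zero_near_uminus: "zero_near g (- z0) \<longleftrightarrow> zero_near g z0"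
proof -
  have "dist z (- z0) = dist (- z) z0" for z
    using dist_minus[of z "- z0"] by simp
  then show ?thesis unfolding zero_near_def by (simp add: disj_commute)
qed

section \<open>Transfer of smooth directions\<close>

lemma rapidly_decaying_on_diff:
  assumes "rapidly_decaying_on V F" "rapidly_decaying_on V G"
  shows "rapidly_decaying_on V (\<lambda>\<xi>. F \<xi> - G \<xi>)"
  unfolding rapidly_decaying_on_def
proof
  fix k
  obtain C D where "\<And>\<xi>. \<xi> \<in> V \<Longrightarrow> norm (F \<xi>) \<le> C / (1 + norm \<xi>) ^ k" "\<And>\<xi>. \<xi> \<in> V \<Longrightarrow> norm (G \<xi>) \<le> D / (1 + norm \<xi>) ^ k"
    using assms unfolding rapidly_decaying_on_def by meson
  then have "norm (F \<xi> - G \<xi>) \<le> (C + D) / (1 + norm \<xi>) ^ k" if "\<xi> \<in> V" for \<xi>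
    using that norm_triangle_ineq4[of "F \<xi>" "G \<xi>"] by (fastforce simp: add_divide_distrib)
  then show "\<exists>C. \<forall>\<xi>\<in>V. norm (F \<xi> - G \<xi>) \<le> C / (1 + norm \<xi>) ^ k" by blast
qed

lemma rapidly_decaying_on_subset: "rapidly_decaying_on V F \<Longrightarrow> W \<subseteq> V \<Longrightarrow> rapidly_decaying_on W F"
  unfolding rapidly_decaying_on_def by blast

lemma fbp_diff:
  assumes "integrable cyl_measure g1" "integrable cyl_measure g2" "test_fun \<phi>"
  shows "fbp (\<lambda>z. g1 z - g2 z) \<phi> = fbp g1 \<phi> - fbp g2 \<phi>"
  unfolding fbp_def left_diff_distrib
  by (intro Bochner_Integration.integral_diff integrable_fbp_pairing assms)

text \<open>\<open>u2\<close> is \<open>u1\<close> minus the filtered backprojection of g1 - g2,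
  whose data vanish near the line. For a common cutoff the given one is multiplied by a bump close
  to \<open>x0\<close>, and for a common cone the two cones are intersected.\<close>

lemma smooth_in_direction_transfer:
  assumes g1: "integrable cyl_measure g1" and g2: "integrable cyl_measure g2"
    and u1: "\<And>\<phi>. test_fun \<phi> \<Longrightarrow> u1 \<phi> = fbp g1 \<phi>" and u2: "\<And>\<phi>. test_fun \<phi> \<Longrightarrow> u2 \<phi> = fbp g2 \<phi>"
    and \<theta>: "norm \<theta> = 1" and \<omega>: "\<omega> \<noteq> 0"
    and zero: "zero_near (\<lambda>z. g1 z - g2 z) (\<theta>, x0 \<bullet> \<theta>)"
    and smooth: "smooth_in_direction u1 x0 (\<omega> *\<^sub>R \<theta>)"
  shows "smooth_in_direction u2 x0 (\<omega> *\<^sub>R \<theta>)"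
proof -
  \<comment> \<open>The conic neighbourhood is one-sided, so the sign of \<omega> is moved into the
    normal. The condition on the data is unaffected, as it treats a point and its antipode
    alike.\<close>
  define \<theta>' where "\<theta>' = sgn \<omega> *\<^sub>R \<theta>"
  have \<xi>0: "\<omega> *\<^sub>R \<theta> = \<bar>\<omega>\<bar> *\<^sub>R \<theta>'" by (simp add: \<theta>'_def sgn_if)
  have \<theta>': "norm \<theta>' = 1" using \<theta> \<omega> by (simp add: \<theta>'_def abs_sgn_eq)
  have "(\<theta>', x0 \<bullet> \<theta>') = (\<theta>, x0 \<bullet> \<theta>) \<or> (\<theta>', x0 \<bullet> \<theta>') = - (\<theta>, x0 \<bullet> \<theta>)"
    using \<omega> by (auto simp: \<theta>'_def sgn_if)
  then have "zero_near (\<lambda>z. g1 z - g2 z) (\<theta>', x0 \<bullet> \<theta>')"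
    using zero zero_near_uminus by metis
  then obtain \<epsilon> where \<epsilon>: "\<epsilon> > 0"
    "AE z in cyl_measure. dist z (\<theta>', x0 \<bullet> \<theta>') < \<epsilon> \<or> dist (- z) (\<theta>', x0 \<bullet> \<theta>') < \<epsilon> \<longrightarrow> g1 z - g2 z = 0"
    unfolding zero_near_def by blast
  have g: "integrable cyl_measure (\<lambda>z. g1 z - g2 z)" using g1 g2 by simp
  obtain \<delta> r where \<delta>: "\<delta> > 0" "r > 0"
    and local: "\<And>\<psi>. test_fun \<psi> \<Longrightarrow> closure (support_on UNIV \<psi>) \<subseteq> ball x0 \<delta> \<Longrightarrow>
      rapidly_decaying_on (conic_nhd r \<theta>') (\<lambda>\<xi>. fbp (\<lambda>z. g1 z - g2 z) (modulate \<psi> \<xi>))"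
    using fbp_local_decay[OF g \<theta>' \<epsilon>] by blast
  obtain \<psi> V where \<psi>: "test_fun \<psi>" "\<psi> x0 \<noteq> 0" and V: "open_cone V" "\<omega> *\<^sub>R \<theta> \<in> V"
    and decay: "rapidly_decaying_on V (dist_fourier (dist_mult \<psi> u1))"
    using smooth unfolding smooth_in_direction_def by blast
  have "rapidly_decaying_on V (\<lambda>\<xi>. fbp g1 (modulate \<psi> \<xi>))"
    using decay by (simp add: dist_fourier_def[abs_def] dist_mult_def u1 test_fun_mult_cis[OF \<psi>(1)])
  from fbp_localize[OF g1 \<psi>(1) V this] obtain V' where V': "open_cone V'" "\<omega> *\<^sub>R \<theta> \<in> V'"
    and decay': "\<And>\<rho>. test_fun \<rho> \<Longrightarrow> rapidly_decaying_on V' (\<lambda>\<xi>. fbp g1 (modulate (\<lambda>x. \<rho> x * \<psi> x) \<xi>))"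
    by blast
  obtain a b where ab: "cbox a b \<subseteq> ball x0 \<delta>" "x0 \<in> box a b"
    using open_contains_cbox[of "ball x0 \<delta>" x0] \<delta>(1) by (metis centre_in_ball open_ball)
  let ?\<rho> = "box_bump 1 a b"
  have \<rho>: "test_fun ?\<rho>" by (rule test_fun_box_bump) simp
  let ?\<psi> = "\<lambda>x. ?\<rho> x * \<psi> x"
  have \<psi>': "test_fun ?\<psi>" using \<rho> \<psi>(1) by (intro test_fun_mult) (auto simp: test_fun_def)
  have supp: "closure (support_on UNIV ?\<psi>) \<subseteq> ball x0 \<delta>"
  proof -
    have "closure (support_on UNIV ?\<psi>) \<subseteq> cbox a b"
      by (rule support_on_closure_compact) (use box_bump_eq_0[of 1 _ a b] box_subset_cbox[of a b] in auto)
    with ab(1) show ?thesis by blast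
  qed
  let ?W = "V' \<inter> conic_nhd r \<theta>'"
  have "rapidly_decaying_on ?W (\<lambda>\<xi>. fbp g1 (modulate ?\<psi> \<xi>)
      - fbp (\<lambda>z. g1 z - g2 z) (modulate ?\<psi> \<xi>))"
    by (intro rapidly_decaying_on_diff rapidly_decaying_on_subset[OF decay'[OF \<rho>]]
        rapidly_decaying_on_subset[OF local[OF \<psi>' supp]]) auto
  moreover have "dist_fourier (dist_mult ?\<psi> u2) = (\<lambda>\<xi>. fbp g1 (modulate ?\<psi> \<xi>)
      - fbp (\<lambda>z. g1 z - g2 z) (modulate ?\<psi> \<xi>))"
    unfolding dist_fourier_def dist_mult_def
    by (simp add: u2 test_fun_mult_cis[OF \<psi>'] fbp_diff[OF g1 g2])
  ultimately have "rapidly_decaying_on ?W (dist_fourier (dist_mult ?\<psi> u2))" by simp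
  moreover have "open_cone ?W"
    using V'(1) open_cone_conic_nhd[of r \<theta>'] by (auto simp: open_cone_def)
  moreover have "\<omega> *\<^sub>R \<theta> \<in> ?W"
    using V'(2) \<omega> \<delta>(2) \<theta>' by (simp add: \<xi>0 conic_nhd_def)
  moreover have "?\<psi> x0 \<noteq> 0" using \<psi>(2) box_bump_neq_0[OF _ ab(2), of 1] by simp
  ultimately show ?thesis unfolding smooth_in_direction_def using \<psi>' by blast
qed

section \<open>Borel representatives\<close>

lemma measurable_lebesgue_AE_cong:
  fixes f g :: "'a::euclidean_space \<Rightarrow> 'b::topological_space"
  assumes f: "f \<in> borel_measurable lebesgue" and ae: "AE x in lebesgue. f x = g x"
  shows "g \<in> borel_measurable lebesgue"
proof (rule borel_measurableI)
  fix S :: "'b set" assume "open S"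
  then have "f -` S \<inter> space lebesgue \<in> sets lebesgue" using f by measurable
  then show "g -` S \<inter> space lebesgue \<in> sets lebesgue"
    by (rule completion.in_sets_AE[rotated]) (use ae in \<open>auto elim!: eventually_mono\<close>)
qed

lemma integral_lebesgue_AE_cong:
  fixes f g :: "'a::euclidean_space \<Rightarrow> complex"
  assumes ae: "AE x in lebesgue. f x = g x"
  shows "(\<integral>x. f x \<partial>lebesgue) = (\<integral>x. g x \<partial>lebesgue)"
proof (cases "f \<in> borel_measurable lebesgue")
  case True
  then show ?thesis using measurable_lebesgue_AE_cong[OF True ae] ae by (intro integral_cong_AE)
next
  \<comment> \<open>Slices of a Lebesgue measurable function need not be measurable. In this case
    neither function is, and both integrals have the default value 0.\<close>
  case False
  have "AE x in lebesgue. g x = f x" using ae by eventually_elim simp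
  then have "g \<notin> borel_measurable lebesgue" using False measurable_lebesgue_AE_cong by blast
  with False show ?thesis
    by (metis borel_measurable_integrable not_integrable_integral_eq)
qed

text \<open>On the disc, which has finite area, \<open>norm (f x)\<close> is at most
  \<open>1 + (norm (f x))\<^sup>2\<close>, so f is integrable. Borel representatives are chosen
  separately for the real and the imaginary part.\<close>

lemma L2_disc_borel_representative:
  assumes f: "L2_disc f"
  obtains f' where "integrable lborel f'" "AE x in lborel. f x = f' x"
proof -
  have m: "f \<in> borel_measurable lebesgue" using f by (simp add: L2_disc_def)
  have fi: "integrable lebesgue f"
  proof (rule Bochner_Integration.integrable_bound)
    have "emeasure lborel (cball (0::real^2) 1) < \<infinity>"
      by (rule emeasure_compact_finite) simp
    then have "integrable lebesgue (\<lambda>x. indicator (cball (0::real^2) 1) x :: real)"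
      by (intro integrable_real_indicator) (auto simp: emeasure_lborel_lebesgue)
    then show "integrable lebesgue (\<lambda>x. indicator (cball (0::real^2) 1) x + (norm (f x))\<^sup>2)"
      using f by (intro Bochner_Integration.integrable_add) (auto simp: L2_disc_def)
    show "AE x in lebesgue. norm (f x) \<le> norm (indicator (cball (0::real^2) 1) x + (norm (f x))\<^sup>2)"
    proof (rule AE_I2)
      fix x :: "real^2"
      have "norm (f x) \<le> 1 + (norm (f x))\<^sup>2"
        using sum_squares_bound[of 1 "norm (f x)"] by (simp add: algebra_simps) (use norm_ge_zero[of "f x"] in linarith)
      then show "norm (f x) \<le> norm (indicator (cball (0::real^2) 1) x + (norm (f x))\<^sup>2)"
        using f by (cases "x \<in> cball 0 1") (auto simp: L2_disc_def)
    qed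
  qed (rule m)
  obtain a where a: "a \<in> borel_measurable lborel" "AE x in lborel. Re (f x) = a x"
    using completion_ex_borel_measurable_real[of "\<lambda>x. Re (f x)" lborel] m by auto
  obtain b where b: "b \<in> borel_measurable lborel" "AE x in lborel. Im (f x) = b x"
    using completion_ex_borel_measurable_real[of "\<lambda>x. Im (f x)" lborel] m by auto
  let ?f = "\<lambda>x. Complex (a x) (b x)"
  have fb: "?f \<in> borel_measurable borel"
    using a(1) b(1) by (auto simp: borel_measurable_complex_iff)
  have ae: "AE x in lborel. f x = ?f x"
    using a(2) b(2) by eventually_elim (simp add: complex_eq_iff)
  then have "AE x in lebesgue. f x = ?f x" by (rule AE_completion)
  then have "integrable lebesgue ?f"
    using fi fb by (intro integrable_cong_AE_imp[OF fi]) (auto intro: measurable_completion elim: eventually_mono)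
  then have "integrable lborel ?f" using fb by (subst (asm) integrable_completion) auto
  with ae that show ?thesis by blast
qed

text \<open>For fixed \<theta> the rotation carries the exceptional set to a null set, and by Fubini
  almost every line normal to \<theta> meets it in a null set of the line.\<close>

lemma radon_AE_cong:
  assumes ae: "AE x in lborel. f x = f' x" and \<theta>: "norm \<theta> = 1"
  shows "AE p in lebesgue. radon f (\<theta>, p) = radon f' (\<theta>, p)"
proof (rule AE_completion)
  have "AE z in lborel. f (rot \<theta> z) = f' (rot \<theta> z)"
  proof (rule AE_distrD[of "rot \<theta>" lborel borel])
    show "AE z in distr lborel borel (rot \<theta>). f z = f' z"
      unfolding lborel_rot[OF \<theta>] by (rule ae)
  qed simp
  then have "AE z in lborel \<Otimes>\<^sub>M lborel. f (rot \<theta> z) = f' (rot \<theta> z)" unfolding lborel_prod .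
  from lborel_pair.AE_pair[OF this]
  show "AE p in lborel. radon f (\<theta>, p) = radon f' (\<theta>, p)"
  proof eventually_elim
    case (elim p)
    from AE_completion[OF elim] show ?case
      unfolding radon_eq_rot by (rule integral_lebesgue_AE_cong)
  qed
qed

lemma cyl_dist_of_radon_AE_cong:
  assumes "AE x in lborel. f x = f' x"
  shows "cyl_dist_of (\<lambda>z. c z * radon f z) h = cyl_dist_of (\<lambda>z. c z * radon f' z) h"
proof -
  have "(\<integral>p. c (circ s, p) * radon f (circ s, p) * h (circ s, p) \<partial>lebesgue)
    = (\<integral>p. c (circ s, p) * radon f' (circ s, p) * h (circ s, p) \<partial>lebesgue)" for s
    by (rule integral_lebesgue_AE_cong) (use radon_AE_cong[OF assms norm_circ[of s]] in \<open>auto elim!: eventually_mono\<close>)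
  then show ?thesis unfolding cyl_dist_of_def by simp
qed


section \<open>Limited data\<close>

lemma assumption_A_closed:
  assumes "assumption_A A"
  shows "closed A" "A \<subseteq> cyl"
proof -
  show "A \<subseteq> cyl" using assms by (auto simp: assumption_A_def)
  have "closedin cyl_top A"
    using assms closedin_closure_of unfolding assumption_A_def by metis
  then show "closed A" using closed_cyl by (rule closedin_closed_trans)
qed

lemma assumption_A_uminus: "assumption_A A \<Longrightarrow> - z \<in> A \<longleftrightarrow> z \<in> A"
  by (cases z) (auto simp: assumption_A_def, metis minus_minus)

lemma dist_of_eq_fbp:
  assumes f: "integrable lborel f'" "AE x in lborel. f x = f' x" and \<phi>: "test_fun \<phi>"
  shows "dist_of f \<phi> = fbp (radon f') \<phi>"
proof -
  note [measurable] = borel_measurable_integrable[OF f(1)] test_fun_borel[OF \<phi>]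
  have "AE x in lebesgue. f x * \<phi> x = f' x * \<phi> x"
    by (rule AE_completion) (use f(2) in \<open>auto elim!: eventually_mono\<close>)
  then have "dist_of f \<phi> = (\<integral>x. f' x * \<phi> x \<partial>lebesgue)"
    unfolding dist_of_def by (rule integral_lebesgue_AE_cong)
  also have "\<dots> = (\<integral>x. f' x * \<phi> x \<partial>lborel)" by (rule integral_completion) measurable
  finally show ?thesis by (simp add: fbp_radon[OF f(1) \<phi>])
qed

lemma recon_AE_cong: "AE x in lborel. f x = f' x \<Longrightarrow> recon A f = recon A f'"
  unfolding recon_def backprojection_def dist_fbp_filter_def
  by (simp add: cyl_dist_of_radon_AE_cong)

text \<open>The measure on the cylinder is invariant under z to -z, so for data with an even zero
  set vanishing near z0 entails vanishing near -z0.\<close>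

lemma zero_nearI:
  assumes g: "\<And>z. g (- z) = 0 \<longleftrightarrow> g z = 0" and "\<epsilon> > 0"
    and ae: "AE z in cyl_measure. dist z z0 < \<epsilon> \<longrightarrow> g z = 0"
  shows "zero_near g z0"
proof -
  have "AE z in cyl_measure. dist (- z) z0 < \<epsilon> \<longrightarrow> g z = 0"
    using AE_cyl_uminus[OF ae] by (simp add: g)
  with ae have "AE z in cyl_measure. dist z z0 < \<epsilon> \<or> dist (- z) z0 < \<epsilon> \<longrightarrow> g z = 0"
    by eventually_elim blast
  then show ?thesis using assms(2) unfolding zero_near_def by blast
qed

lemma zero_near_interior:
  assumes A: "assumption_A A" and z0: "z0 \<in> cyl_top interior_of A" and f: "f \<in> borel_measurable borel"
  shows "zero_near (\<lambda>z. radon f z - indicator A z * radon f z) z0"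
proof -
  obtain T where T: "open T" "cyl_top interior_of A = cyl \<inter> T"
    using openin_interior_of[of cyl_top A] unfolding openin_open by blast
  obtain \<epsilon> where \<epsilon>: "\<epsilon> > 0" "ball z0 \<epsilon> \<subseteq> T"
    using T z0 by (metis IntD2 openE)
  show ?thesis
  proof (rule zero_nearI[OF _ \<epsilon>(1)])
    show "(radon f (- z) - indicator A (- z) * radon f (- z) = 0) = (radon f z - indicator A z * radon f z = 0)" for z
      by (simp add: radon_uminus[OF f] indicator_def assumption_A_uminus[OF A])
    show "AE z in cyl_measure. dist z z0 < \<epsilon> \<longrightarrow> radon f z - indicator A z * radon f z = 0"
      using AE_cyl
    proof eventually_elim
      case (elim z)
      show ?case
      proof
        assume "dist z z0 < \<epsilon>"
        then have "z \<in> cyl_top interior_of A" using elim \<epsilon>(2) T(2) by (auto simp: dist_commute)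
        then have "z \<in> A" using interior_of_subset[of cyl_top A] by blast
        then show "radon f z - indicator A z * radon f z = 0" by simp
      qed
    qed
  qed
qed

text \<open>The data vanish for one of two reasons: off A the indicator is 0 on a whole ball because
  A is closed, and off the support the Radon transform is 0 almost everywhere nearby.\<close>

lemma zero_near_invisible:
  assumes A: "assumption_A A" and f: "integrable lborel f" and z0: "z0 \<in> cyl"
    and out: "z0 \<notin> A \<inter> cyl_dist_support (cyl_dist_of (radon f))"
  shows "zero_near (\<lambda>z. indicator A z * radon f z) z0"
proof -
  have fb: "f \<in> borel_measurable borel" using f by auto
  have even: "(indicator A (- z) * radon f (- z) = 0) = (indicator A z * radon f z = 0)" for z
    by (simp add: radon_uminus[OF fb] indicator_def assumption_A_uminus[OF A])
  show ?thesis
  proof (cases "z0 \<in> A")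
    case True
    then obtain \<epsilon> where \<epsilon>: "\<epsilon> > 0" "AE z in cyl_measure. dist z z0 < \<epsilon> \<longrightarrow> radon f z = 0"
      using AE_eq_0_outside_cyl_dist_support[OF integrable_radon[OF f] z0] out by blast
    show ?thesis
      by (rule zero_nearI[where g="\<lambda>z. indicator A z * radon f z", OF even \<epsilon>(1)]) (use \<epsilon>(2) in \<open>auto elim!: eventually_mono\<close>)
  next
    case False
    then obtain \<epsilon> where \<epsilon>: "\<epsilon> > 0" "ball z0 \<epsilon> \<subseteq> - A"
      using assumption_A_closed(1)[OF A] by (metis ComplI openE open_Compl)
    show ?thesis
      by (rule zero_nearI[where g="\<lambda>z. indicator A z * radon f z", OF even \<epsilon>(1)], rule AE_I2)
        (use \<epsilon>(2) in \<open>auto simp: indicator_def dist_commute\<close>)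
  qed
qed

section \<open>Singularities of the limited data reconstruction\<close>

lemma smooth_in_direction_recon_interior:
  assumes f: "L2_disc f" and A: "assumption_A A" and z: "(\<theta>, x \<bullet> \<theta>) \<in> cyl_top interior_of A" and \<omega>: "\<omega> \<noteq> 0"
  shows "smooth_in_direction (recon A f) x (\<omega> *\<^sub>R \<theta>) \<longleftrightarrow> smooth_in_direction (dist_of f) x (\<omega> *\<^sub>R \<theta>)"
proof -
  obtain f' where f': "integrable lborel f'" "AE x in lborel. f x = f' x"
    using L2_disc_borel_representative[OF f] .
  have fb: "f' \<in> borel_measurable borel" using f'(1) by auto
  have Ab: "A \<in> sets borel" using assumption_A_closed(1)[OF A] by simp
  have \<theta>: "norm \<theta> = 1"
    using subsetD[OF interior_of_subset z] assumption_A_closed(2)[OF A] by (auto simp: cyl_def)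
  note i = integrable_radon[OF f'(1)] integrable_indicator_radon[OF f'(1) Ab]
  have u1: "dist_of f \<phi> = fbp (radon f') \<phi>" if "test_fun \<phi>" for \<phi>
    by (rule dist_of_eq_fbp[OF f' that])
  have u2: "recon A f \<phi> = fbp (\<lambda>z. indicator A z * radon f' z) \<phi>" if "test_fun \<phi>" for \<phi>
    unfolding recon_AE_cong[OF f'(2)] by (rule recon_eq_fbp[OF f'(1) Ab that])
  have z1: "zero_near (\<lambda>z. radon f' z - indicator A z * radon f' z) (\<theta>, x \<bullet> \<theta>)"
    by (rule zero_near_interior[OF A z fb])
  have "indicator A z * radon f' z - radon f' z = - (radon f' z - indicator A z * radon f' z)" for z
    by simp
  then have z2: "zero_near (\<lambda>z. indicator A z * radon f' z - radon f' z) (\<theta>, x \<bullet> \<theta>)"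
    using z1 unfolding zero_near_def by (simp only: neg_equal_0_iff_equal)
  show ?thesis
    using smooth_in_direction_transfer[OF i(1) i(2) u1 u2 \<theta> \<omega> z1]
      smooth_in_direction_transfer[OF i(2) i(1) u2 u1 \<theta> \<omega> z2] by blast
qed

text \<open>The reconstruction is compared with the zero distribution, which comes from the data 0
  and is smooth in every direction.\<close>

lemma smooth_in_direction_recon_outside:
  assumes f: "L2_disc f" and A: "assumption_A A" and \<theta>: "norm \<theta> = 1" and \<omega>: "\<omega> \<noteq> 0"
    and out: "(\<theta>, x \<bullet> \<theta>) \<notin> A \<inter> cyl_dist_support (cyl_dist_of (radon f))"
  shows "smooth_in_direction (recon A f) x (\<omega> *\<^sub>R \<theta>)"
proof -
  obtain f' where f': "integrable lborel f'" "AE x in lborel. f x = f' x"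
    using L2_disc_borel_representative[OF f] .
  have Ab: "A \<in> sets borel" using assumption_A_closed(1)[OF A] by simp
  note i = integrable_indicator_radon[OF f'(1) Ab]
  have u2: "recon A f \<phi> = fbp (\<lambda>z. indicator A z * radon f' z) \<phi>" if "test_fun \<phi>" for \<phi>
    unfolding recon_AE_cong[OF f'(2)] by (rule recon_eq_fbp[OF f'(1) Ab that])
  have "cyl_dist_of (radon f) = cyl_dist_of (radon f')"
    using cyl_dist_of_radon_AE_cong[OF f'(2), of "\<lambda>_. 1"] by auto
  then have z: "zero_near (\<lambda>z. indicator A z * radon f' z) (\<theta>, x \<bullet> \<theta>)"
    using out \<theta> by (intro zero_near_invisible[OF A f'(1)]) (auto simp: cyl_def)
  obtain a b where ab: "x \<in> box a b"
    using open_contains_cbox[of UNIV x] by (metis UNIV_I open_UNIV)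
  have s0: "smooth_in_direction (\<lambda>_. 0) x (\<omega> *\<^sub>R \<theta>)"
    unfolding smooth_in_direction_def
    by (intro exI[of _ "box_bump 1 a b"] exI[of _ UNIV])
      (auto simp: test_fun_box_bump box_bump_neq_0[OF _ ab] open_cone_def rapidly_decaying_on_def
        dist_fourier_def dist_mult_def intro!: exI[of _ 0])
  have z': "zero_near (\<lambda>z. 0 - indicator A z * radon f' z) (\<theta>, x \<bullet> \<theta>)"
    using z by (simp add: zero_near_def)
  show ?thesis
    by (rule smooth_in_direction_transfer[OF _ i _ u2 \<theta> \<omega> z' s0]) (auto simp: fbp_def)
qed

lemma WF_line_iff:
  assumes "norm \<theta> = 1"
  shows "(x, \<xi>) \<in> WF_line \<theta> p u \<longleftrightarrow> x \<bullet> \<theta> = p \<and> (\<exists>\<omega>. \<omega> \<noteq> 0 \<and> \<xi> = \<omega> *\<^sub>R \<theta> \<and> \<not> smooth_in_direction u x (\<omega> *\<^sub>R \<theta>))"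
  using assms by (auto simp: WF_line_def WF_def normals_def line_def)

lemma WF_line_interior:
  assumes "L2_disc f" "assumption_A A" "(\<theta>, p) \<in> cyl_top interior_of A"
  shows "WF_line \<theta> p (dist_of f) = WF_line \<theta> p (recon A f)"
proof -
  have \<theta>: "norm \<theta> = 1"
    using subsetD[OF interior_of_subset assms(3)] assumption_A_closed(2)[OF assms(2)] by (auto simp: cyl_def)
  show ?thesis
  proof (rule set_eqI)
    fix z
    show "z \<in> WF_line \<theta> p (dist_of f) \<longleftrightarrow> z \<in> WF_line \<theta> p (recon A f)"
      using smooth_in_direction_recon_interior[OF assms(1,2), of \<theta>] assms(3)
      by (cases z) (simp only: WF_line_iff[OF \<theta>], blast)
  qed
qed

lemma WF_line_outside:
  assumes "L2_disc f" "assumption_A A" "(\<theta>, p) \<in> cyl"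
    "(\<theta>, p) \<notin> A \<inter> cyl_dist_support (cyl_dist_of (radon f))"
  shows "WF_line \<theta> p (recon A f) = {}"
proof -
  have \<theta>: "norm \<theta> = 1" using assms(3) by (simp add: cyl_def)
  show ?thesis
  proof (rule equals0I)
    fix z assume "z \<in> WF_line \<theta> p (recon A f)"
    then show False
      using smooth_in_direction_recon_outside[OF assms(1,2) \<theta>] assms(4)
      by (cases z) (simp only: WF_line_iff[OF \<theta>], blast)
  qed
qed

text \<open>A nonzero covector is normal to exactly one unoriented line through its base point;
  \<open>sgn \<xi>\<close> is the unit normal chosen for it.\<close>

lemma WF_in_normals:
  assumes "(x, \<xi>) \<in> WF u"
  shows "norm (sgn \<xi>) = 1" "(x, \<xi>) \<in> normals (sgn \<xi>) (x \<bullet> sgn \<xi>)"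
proof -
  have \<xi>: "\<xi> \<noteq> 0" using assms by (auto simp: WF_def)
  then show "norm (sgn \<xi>) = 1" by (simp add: norm_sgn)
  have "\<xi> = norm \<xi> *\<^sub>R sgn \<xi>" using \<xi> by (simp add: sgn_div_norm)
  then show "(x, \<xi>) \<in> normals (sgn \<xi>) (x \<bullet> sgn \<xi>)" by (auto simp: normals_def line_def)
qed

theorem theorem3p4:
  fixes f :: "real^2 \<Rightarrow> complex" and A :: "((real^2) \<times> real) set"
  assumes "L2_disc f" and "assumption_A A"
  shows
    "(\<forall>(\<theta>, p) \<in> cyl_top interior_of A.
        WF_line \<theta> p (dist_of f) = WF_line \<theta> p (recon A f) \<and>
        WF_line \<theta> p (dist_of f) \<subseteq> visible A f \<and>
        artifacts A f \<inter> normals \<theta> p = {}) \<and>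
     (\<forall>(\<theta>, p) \<in> cyl. (\<theta>, p) \<notin> A \<inter> cyl_dist_support (cyl_dist_of (radon f)) \<longrightarrow>
        WF_line \<theta> p (recon A f) = {} \<and>
        WF_line \<theta> p (dist_of f) \<subseteq> invisible A f \<and>
        artifacts A f \<inter> normals \<theta> p = {}) \<and>
     (\<forall>x \<in> cball 0 1. (\<forall>\<theta> \<in> sphere 0 1. (\<theta>, x \<bullet> \<theta>) \<in> cyl_top interior_of A) \<longrightarrow>
        WF_at x (dist_of f) = WF_at x (recon A f) \<and>
        WF_at x (dist_of f) \<subseteq> visible A f) \<and>
     (\<forall>x \<xi>. (x, \<xi>) \<in> artifacts A f \<longrightarrow>
        (\<exists>(\<theta>, p) \<in> cyl_top frontier_of A. (x, \<xi>) \<in> normals \<theta> p))"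
proof -
  note int = WF_line_interior[OF assms] and out = WF_line_outside[OF assms]
  have at: "WF_at x (dist_of f) = WF_at x (recon A f)"
    if "\<forall>\<theta> \<in> sphere 0 1. (\<theta>, x \<bullet> \<theta>) \<in> cyl_top interior_of A" for x
  proof -
    have "(x, \<xi>) \<in> WF (dist_of f) \<longleftrightarrow> (x, \<xi>) \<in> WF (recon A f)" for \<xi>
    proof (cases "\<xi> = 0")
      case False
      then have "(sgn \<xi>, x \<bullet> sgn \<xi>) \<in> cyl_top interior_of A" using that by (simp add: norm_sgn)
      from int[OF this] show ?thesis using WF_in_normals(2) by (auto simp: WF_line_def)
    qed (simp add: WF_def)
    then show ?thesis by (auto simp: WF_at_def)
  qed
  have front: "\<exists>(\<theta>, p) \<in> cyl_top frontier_of A. (x, \<xi>) \<in> normals \<theta> p" if a: "(x, \<xi>) \<in> artifacts A f" for x \<xi>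
  proof -
    have r: "(x, \<xi>) \<in> WF (recon A f)" and n: "(x, \<xi>) \<notin> WF (dist_of f)"
      using a by (auto simp: artifacts_def)
    let ?z = "(sgn \<xi>, x \<bullet> sgn \<xi>)"
    note N = WF_in_normals[OF r]
    \<comment> \<open>Were the line in the interior, the singularity would belong to f as well; were
      it off A, there would be none. As A is contained in its closure, only the frontier
      remains.\<close>
    have "?z \<notin> cyl_top interior_of A"
      using int[of "sgn \<xi>" "x \<bullet> sgn \<xi>"] r n N(2) by (auto simp: WF_line_def)
    moreover have "?z \<in> A"
      using out[of "sgn \<xi>" "x \<bullet> sgn \<xi>"] r N by (auto simp: WF_line_def cyl_def)
    moreover have "A \<subseteq> cyl_top closure_of A"
      using assumption_A_closed(2)[OF assms(2)] by (intro closure_of_subset) simp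
    ultimately have "?z \<in> cyl_top frontier_of A" by (auto simp: frontier_of_def)
    with N(2) show ?thesis by blast
  qed
  show ?thesis
  proof (intro conjI)
    show "\<forall>(\<theta>, p) \<in> cyl_top interior_of A.
        WF_line \<theta> p (dist_of f) = WF_line \<theta> p (recon A f) \<and>
        WF_line \<theta> p (dist_of f) \<subseteq> visible A f \<and>
        artifacts A f \<inter> normals \<theta> p = {}"
    proof clarify
      fix \<theta> p assume "(\<theta>, p) \<in> cyl_top interior_of A"
      from int[OF this] show "WF_line \<theta> p (dist_of f) = WF_line \<theta> p (recon A f) \<and>
        WF_line \<theta> p (dist_of f) \<subseteq> visible A f \<and> artifacts A f \<inter> normals \<theta> p = {}"
        unfolding WF_line_def visible_def artifacts_def by blast
    qed
    show "\<forall>(\<theta>, p) \<in> cyl. (\<theta>, p) \<notin> A \<inter> cyl_dist_support (cyl_dist_of (radon f)) \<longrightarrow>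
        WF_line \<theta> p (recon A f) = {} \<and>
        WF_line \<theta> p (dist_of f) \<subseteq> invisible A f \<and>
        artifacts A f \<inter> normals \<theta> p = {}"
    proof (rule ballI)
      fix z assume z: "z \<in> cyl"
      obtain \<theta> p where zp: "z = (\<theta>, p)" by (cases z)
      have "WF_line \<theta> p (recon A f) = {} \<and> WF_line \<theta> p (dist_of f) \<subseteq> invisible A f \<and>
          artifacts A f \<inter> normals \<theta> p = {}"
        if "(\<theta>, p) \<notin> A \<inter> cyl_dist_support (cyl_dist_of (radon f))"
        using out[OF z[unfolded zp] that]
        unfolding WF_line_def invisible_def artifacts_def by blast
      then show "case z of (\<theta>, p) \<Rightarrow> (\<theta>, p) \<notin> A \<inter> cyl_dist_support (cyl_dist_of (radon f)) \<longrightarrow>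
          WF_line \<theta> p (recon A f) = {} \<and>
          WF_line \<theta> p (dist_of f) \<subseteq> invisible A f \<and>
          artifacts A f \<inter> normals \<theta> p = {}"
        unfolding zp prod.case by blast
    qed
    show "\<forall>x \<in> cball 0 1. (\<forall>\<theta> \<in> sphere 0 1. (\<theta>, x \<bullet> \<theta>) \<in> cyl_top interior_of A) \<longrightarrow>
        WF_at x (dist_of f) = WF_at x (recon A f) \<and>
        WF_at x (dist_of f) \<subseteq> visible A f"
    proof (intro ballI impI)
      fix x assume "\<forall>\<theta> \<in> sphere 0 1. (\<theta>, x \<bullet> \<theta>) \<in> cyl_top interior_of A"
      from at[OF this] show "WF_at x (dist_of f) = WF_at x (recon A f) \<and> WF_at x (dist_of f) \<subseteq> visible A f"
        unfolding WF_at_def visible_def by blast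
    qed
    show "\<forall>x \<xi>. (x, \<xi>) \<in> artifacts A f \<longrightarrow>
        (\<exists>(\<theta>, p) \<in> cyl_top frontier_of A. (x, \<xi>) \<in> normals \<theta> p)"
      using front by blast
  qed
qed

end
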